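(* Let $F$ be a field of characteristic $3$ and let $L$ be the $5$-dimensional Lie algebra over $F$ with basis $x,y,e_1,e_2,e_3$ and brackets $$[x,e_1]=0,\quad [x,e_2]=e_2,\quad [x,e_3]=2e_3,\quad [y,e_1]=e_3,\quad [y,e_2]=e_1,\quad [y,e_3]=e_2,\quad [x,y]=2y,$$ all other brackets of basis elements (apart from those determined by antisymmetry) being $0$. Let $K=\operatorname{span}\{e_1,e_2,e_3\}$ and $H=Fy+K$, so that $K$ is an ideal of $L$, $H$ is an ideal of codimension one in $L$, and $L=Fx+H$. In $U(H)$ put $$u=e_1+e_2+e_3,\qquad v=e_2^2+e_1e_3+2e_2e_3+2e_3^2 .$$ For $c\in\{1,2\}$ let $U(H)_c$ denote the weight space $U(H)_{\lambda_c}$, where $\lambda_c: H\to F$ is the linear form with $\lambda_c(y)=c$ and $\lambda_c(K)=0$. Then: (i) $Z(U(H))=F[\,y^{9}-y^{3},\,e_1^3,\,e_2^3,\,e_3^3,\,e_1e_2^2+e_1^2e_3+e_2e_3^2\,]$; (ii) $u\in U(H)_1$, $v\in U(H)_2$, and $Sz(U(H))=Z(U(H))[u,v]$; (iii) $u$ is not a semi-invariant of $U(L)$, and neither $U(H)_1$ nor $U(H)_2$ is $\mathrm{ad}L$ stable.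
   Context: For a finite dimensional Lie algebra $G$ over a field $F$, $U(G)$ is its enveloping algebra and $Z(U(G))$ is the center of $U(G)$. For a linear form $\lambda:G\to F$, the weight space is $U(G)_\lambda=\{w\in U(G) : [g,w]=\lambda(g)w \text{ for all } g\in G\}$. Elements of the weight spaces $U(G)_\lambda$ are called semi-invariants of $U(G)$. The sum of all weight spaces $U(G)_\lambda$ is direct and is denoted $Sz(U(G))$, the semi-center of $U(G)$. For an ideal $H$ of $L$, $U(H)$ is regarded as a subalgebra of $U(L)$, and a subspace $W\subseteq U(H)$ is called $\mathrm{ad}L$ stable if $[L,W]\subseteq W$, the bracket being the commutator in $U(L)$. The notation $A[a_1,\dots,a_n]$ denotes the subalgebra generated by $A$ and $a_1,\dots,a_n$. *)

theory Defs
  imports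
    "HOL-Algebra.QuotRing"
    "HOL-Algebra.Generated_Rings"
    "HOL-Library.Poly_Mapping"
begin

section \<open>Lie algebras over a field\<close>

text \<open>The Lie algebra is the whole type \<open>'l\<close>, with scalar multiplication \<open>s\<close> and bracket \<open>br\<close>;
  its Lie subalgebras and ideals are subsets of \<open>'l\<close>.\<close>

locale lie_algebra = vector_space s
  for s :: "'f::field \<Rightarrow> 'l::ab_group_add \<Rightarrow> 'l" +
  fixes br :: "'l \<Rightarrow> 'l \<Rightarrow> 'l"
  assumes br_add_left: "br (a + b) c = br a c + br b c"
    and br_add_right: "br a (b + c) = br a b + br a c"
    and br_scale_left: "br (s r a) b = s r (br a b)"
    and br_scale_right: "br a (s r b) = s r (br a b)"
    and br_self: "br a a = 0"
    and jacobi: "br a (br b c) + br b (br c a) + br c (br a b) = 0"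

definition lie_ideal ::
  "('f::field \<Rightarrow> 'l::ab_group_add \<Rightarrow> 'l) \<Rightarrow> ('l \<Rightarrow> 'l \<Rightarrow> 'l) \<Rightarrow> 'l set \<Rightarrow> bool"
  where "lie_ideal s br H \<longleftrightarrow> module.subspace s H \<and> (\<forall>a. \<forall>h\<in>H. br a h \<in> H)"

text \<open>Only the values on \<open>G\<close> are constrained.\<close>

definition linear_form_on ::
  "('f::field \<Rightarrow> 'l::ab_group_add \<Rightarrow> 'l) \<Rightarrow> 'l set \<Rightarrow> ('l \<Rightarrow> 'f) \<Rightarrow> bool"
  where "linear_form_on s G \<mu> \<longleftrightarrow>
    (\<forall>a\<in>G. \<forall>b\<in>G. \<mu> (a + b) = \<mu> a + \<mu> b) \<and> (\<forall>c. \<forall>a\<in>G. \<mu> (s c a) = c * \<mu> a)"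

section \<open>Free associative algebras\<close>

text \<open>The free monoid on \<open>'l\<close>, written additively because the ring structure of
  \<^typ>\<open>'k \<Rightarrow>\<^sub>0 'f\<close> is the monoid algebra of the additive monoid \<open>'k\<close>.\<close>

datatype 'l fmon = FMon (letters: "'l list")

instantiation fmon :: (type) monoid_add
begin
definition zero_fmon :: "'a fmon" where "zero_fmon = FMon []"
definition plus_fmon :: "'a fmon \<Rightarrow> 'a fmon \<Rightarrow> 'a fmon"
  where "plus_fmon v w = FMon (letters v @ letters w)"
instance
  by standard (simp_all add: zero_fmon_def plus_fmon_def)
end

type_synonym ('l, 'f) falg = "'l fmon \<Rightarrow>\<^sub>0 'f"

definition falg_const :: "'f::field \<Rightarrow> ('l, 'f) falg"
  where "falg_const c = Poly_Mapping.single 0 c"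

definition falg_gen :: "'l \<Rightarrow> ('l, 'f::field) falg"
  where "falg_gen a = Poly_Mapping.single (FMon [a]) 1"

text \<open>The free associative unital algebra on the set \<open>G\<close>.\<close>

definition free_algebra :: "'l set \<Rightarrow> ('l, 'f::field) falg ring"
  where "free_algebra G =
    \<lparr>carrier = {p. \<forall>w\<in>Poly_Mapping.keys p. set (letters w) \<subseteq> G},
     monoid.mult = (*), one = 1, ring.zero = 0, add = (+)\<rparr>"

section \<open>Enveloping algebras\<close>

text \<open>Modulo the relations expressing linearity, the free algebra on the set \<open>G\<close> is the tensor
  algebra of the vector space \<open>G\<close>; the last relations then give its usual quotient \<open>U(G)\<close>.\<close>

definition uea_relations ::
  "('f::field \<Rightarrow> 'l::ab_group_add \<Rightarrow> 'l) \<Rightarrow> ('l \<Rightarrow> 'l \<Rightarrow> 'l) \<Rightarrow> 'l set \<Rightarrow> ('l, 'f) falg set"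
  where "uea_relations s br G =
    {falg_gen (a + b) - (falg_gen a + falg_gen b) | a b. a \<in> G \<and> b \<in> G} \<union>
    {falg_gen (s c a) - falg_const c * falg_gen a | c a. a \<in> G} \<union>
    {falg_gen a * falg_gen b - falg_gen b * falg_gen a - falg_gen (br a b) | a b. a \<in> G \<and> b \<in> G}"

definition uea_ideal ::
  "('f::field \<Rightarrow> 'l::ab_group_add \<Rightarrow> 'l) \<Rightarrow> ('l \<Rightarrow> 'l \<Rightarrow> 'l) \<Rightarrow> 'l set \<Rightarrow> ('l, 'f) falg set"
  where "uea_ideal s br G = Idl\<^bsub>free_algebra G\<^esub> (uea_relations s br G)"

definition uea ::
  "('f::field \<Rightarrow> 'l::ab_group_add \<Rightarrow> 'l) \<Rightarrow> ('l \<Rightarrow> 'l \<Rightarrow> 'l) \<Rightarrow> 'l set \<Rightarrow> ('l, 'f) falg set ring"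
  where "uea s br G = free_algebra G Quot uea_ideal s br G"

definition uea_emb ::
  "('f::field \<Rightarrow> 'l::ab_group_add \<Rightarrow> 'l) \<Rightarrow> ('l \<Rightarrow> 'l \<Rightarrow> 'l) \<Rightarrow> 'l set \<Rightarrow> 'l \<Rightarrow> ('l, 'f) falg set"
  where "uea_emb s br G a = uea_ideal s br G +>\<^bsub>free_algebra G\<^esub> falg_gen a"

definition uea_const ::
  "('f::field \<Rightarrow> 'l::ab_group_add \<Rightarrow> 'l) \<Rightarrow> ('l \<Rightarrow> 'l \<Rightarrow> 'l) \<Rightarrow> 'l set \<Rightarrow> 'f \<Rightarrow> ('l, 'f) falg set"
  where "uea_const s br G c = uea_ideal s br G +>\<^bsub>free_algebra G\<^esub> falg_const c"

definition uea_scale ::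
  "('f::field \<Rightarrow> 'l::ab_group_add \<Rightarrow> 'l) \<Rightarrow> ('l \<Rightarrow> 'l \<Rightarrow> 'l) \<Rightarrow> 'l set \<Rightarrow> 'f
    \<Rightarrow> ('l, 'f) falg set \<Rightarrow> ('l, 'f) falg set"
  where "uea_scale s br G c w = uea_const s br G c \<otimes>\<^bsub>uea s br G\<^esub> w"

text \<open>For a Lie subalgebra \<open>H\<close> of \<open>G\<close>, the canonical algebra map \<open>U(H) \<rightarrow> U(G)\<close> extending the
  inclusion sends the coset \<open>I\<^sub>H + p\<close> to \<open>I\<^sub>G + p\<close>; as \<open>I\<^sub>H \<subseteq> I\<^sub>G\<close>, this is
  \<open>A \<mapsto> I\<^sub>G + A\<close> on cosets \<open>A\<close>.  Through it \<open>U(H)\<close> is regarded as a subalgebra of \<open>U(G)\<close>.\<close>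

definition uea_incl ::
  "('f::field \<Rightarrow> 'l::ab_group_add \<Rightarrow> 'l) \<Rightarrow> ('l \<Rightarrow> 'l \<Rightarrow> 'l) \<Rightarrow> 'l set
    \<Rightarrow> ('l, 'f) falg set \<Rightarrow> ('l, 'f) falg set"
  where "uea_incl s br G A = uea_ideal s br G <+>\<^bsub>free_algebra G\<^esub> A"

definition uea_adjoin ::
  "('f::field \<Rightarrow> 'l::ab_group_add \<Rightarrow> 'l) \<Rightarrow> ('l \<Rightarrow> 'l \<Rightarrow> 'l) \<Rightarrow> 'l set
    \<Rightarrow> ('l, 'f) falg set set \<Rightarrow> ('l, 'f) falg set set"
  where "uea_adjoin s br G S = generate_ring (uea s br G) (range (uea_const s br G) \<union> S)"

section \<open>Centre, semi-invariants and semi-centre\<close>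

definition ring_commutator :: "('a, 'b) ring_scheme \<Rightarrow> 'a \<Rightarrow> 'a \<Rightarrow> 'a"
  where "ring_commutator R a b = (a \<otimes>\<^bsub>R\<^esub> b) \<ominus>\<^bsub>R\<^esub> (b \<otimes>\<^bsub>R\<^esub> a)"

definition ring_center :: "('a, 'b) ring_scheme \<Rightarrow> 'a set"
  where "ring_center R = {z \<in> carrier R. \<forall>w\<in>carrier R. z \<otimes>\<^bsub>R\<^esub> w = w \<otimes>\<^bsub>R\<^esub> z}"

definition weight_space ::
  "('f::field \<Rightarrow> 'l::ab_group_add \<Rightarrow> 'l) \<Rightarrow> ('l \<Rightarrow> 'l \<Rightarrow> 'l) \<Rightarrow> 'l set \<Rightarrow> ('l \<Rightarrow> 'f)
    \<Rightarrow> ('l, 'f) falg set set"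
  where "weight_space s br G \<mu> =
    {w \<in> carrier (uea s br G).
      \<forall>g\<in>G. ring_commutator (uea s br G) (uea_emb s br G g) w = uea_scale s br G (\<mu> g) w}"

definition semi_invariant ::
  "('f::field \<Rightarrow> 'l::ab_group_add \<Rightarrow> 'l) \<Rightarrow> ('l \<Rightarrow> 'l \<Rightarrow> 'l) \<Rightarrow> 'l set
    \<Rightarrow> ('l, 'f) falg set \<Rightarrow> bool"
  where "semi_invariant s br G w \<longleftrightarrow>
    (\<exists>\<mu>. linear_form_on s G \<mu> \<and> w \<in> weight_space s br G \<mu>)"

definition semi_center ::
  "('f::field \<Rightarrow> 'l::ab_group_add \<Rightarrow> 'l) \<Rightarrow> ('l \<Rightarrow> 'l \<Rightarrow> 'l) \<Rightarrow> 'l set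
    \<Rightarrow> ('l, 'f) falg set set"
  where "semi_center s br G =
    {finsum (uea s br G) w \<Lambda> | w \<Lambda>. finite \<Lambda> \<and>
      (\<forall>\<mu>\<in>\<Lambda>. linear_form_on s G \<mu> \<and> w \<mu> \<in> weight_space s br G \<mu>)}"

definition ad_stable ::
  "('f::field \<Rightarrow> 'l::ab_group_add \<Rightarrow> 'l) \<Rightarrow> ('l \<Rightarrow> 'l \<Rightarrow> 'l) \<Rightarrow> 'l set
    \<Rightarrow> ('l, 'f) falg set set \<Rightarrow> bool"
  where "ad_stable s br G W \<longleftrightarrow>
    (\<forall>g\<in>G. \<forall>w\<in>W. ring_commutator (uea s br G) (uea_emb s br G g) w \<in> W)"

end

theory Submission
  imports Defs "HOL-Computational_Algebra.Polynomial"
begin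

text \<open>
  On \<open>K\<close> the operator \<open>ad y\<close> is a permutation of order three, hence unipotent in characteristic three; in
  the basis \<open>a = e1 + e2 + e3\<close>, \<open>b = e2 + 2 e3\<close>, \<open>c = e3\<close> it is a single Jordan block.  With
  \<open>S = F[a, b, c]\<close> and \<open>D\<close> the derivation of \<open>S\<close> extending \<open>ad y\<close>, the algebra \<open>U(H)\<close> acts faithfully on
  \<open>S[Y]\<close>, where \<open>K\<close> acts by multiplication and \<open>y\<close> as \<open>Y + D\<close>; applying an operator to \<open>1\<close>
  recovers its normal form.  Letting \<open>x\<close> act by the derivation that extends \<open>ad x\<close> and maps \<open>Y\<close> to \<open>2 Y\<close>
  makes \<open>S[Y]\<close> a module over \<open>U(L)\<close>.

  If \<open>f(y) \<noteq> 0\<close>, with coefficients in \<open>S\<close> on the left, satisfies \<open>[a, f] = \<alpha> f\<close> and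
  \<open>[b, f] = \<beta> f\<close>, then comparing degrees in \<open>y\<close> gives \<open>\<alpha> = \<beta> = 0\<close>, \<open>f(Y + 1) = f(Y)\<close> and
  \<open>f' = 0\<close>, so \<open>f\<close> is a polynomial in \<open>y\<^sup>9 - y\<^sup>3\<close>.
  Its coefficients \<open>r\<close> satisfy \<open>D r = \<gamma> r\<close>, where \<open>\<gamma>\<close> is the weight of \<open>y\<close>.  Write \<open>D = E + N\<close>
  with \<open>E\<close> the Euler derivation.  Then \<open>D\<^sup>3 = E\<close> and \<open>E\<^sup>3 = E\<close> force \<open>\<gamma>\<close> into the
  prime field, \<open>E r = \<gamma> r\<close> and \<open>N r = 0\<close>.  The kernel of \<open>N = a \<partial>\<^sub>b + b \<partial>\<^sub>c\<close> is
  \<open>F[a, q, b\<^sup>3, c\<^sup>3]\<close> with \<open>q = b\<^sup>2 + a c = v\<close>, and its part of degree divisible by three is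
  \<open>F[a\<^sup>3, b\<^sup>3, c\<^sup>3, a q]\<close>, where \<open>a q - b\<^sup>3\<close> is the cubic generator.

  For the last part, if \<open>t\<close> and \<open>[x, t]\<close> both have weight \<open>\<gamma>\<close> for \<open>ad y\<close>, then \<open>[x, y] = 2 y\<close> gives
  \<open>2 \<gamma> t = 0\<close>.
\<close>

section \<open>Additive endomorphisms\<close>

text \<open>A type rather than a set of maps, so that the operators form an instance of
  \<open>ring_1\<close>. Scalars will act through multiplication by constants.\<close>

typedef (overloaded) 'a endo = "{f :: 'a::comm_ring_1 \<Rightarrow> 'a. \<forall>x y. f (x + y) = f x + f y}"
  morphisms app Endo
  by (intro exI[of _ "\<lambda>x. x"]) simp

lemma app_add: "app f (x + y) = app f x + app f y"
  using app[of f] by simp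

lemma app_zero [simp]: "app f 0 = 0"
  using app_add[of f 0 0] by simp

lemma endo_eqI: "(\<And>x. app f x = app g x) \<Longrightarrow> f = g"
  by (simp add: app_inject[symmetric] fun_eq_iff)

lemma app_Endo: "(\<And>x y. f (x + y) = f x + f y) \<Longrightarrow> app (Endo f) x = f x"
  by (simp add: Endo_inverse)

instantiation endo :: (comm_ring_1) ring_1
begin

definition zero_endo :: "'a endo" where "zero_endo = Endo (\<lambda>x. 0)"
definition one_endo :: "'a endo" where "one_endo = Endo (\<lambda>x. x)"
definition plus_endo :: "'a endo \<Rightarrow> 'a endo \<Rightarrow> 'a endo"
  where "plus_endo f g = Endo (\<lambda>x. app f x + app g x)"
definition minus_endo :: "'a endo \<Rightarrow> 'a endo \<Rightarrow> 'a endo"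
  where "minus_endo f g = Endo (\<lambda>x. app f x - app g x)"
definition uminus_endo :: "'a endo \<Rightarrow> 'a endo"
  where "uminus_endo f = Endo (\<lambda>x. - app f x)"
definition times_endo :: "'a endo \<Rightarrow> 'a endo \<Rightarrow> 'a endo"
  where "times_endo f g = Endo (\<lambda>x. app f (app g x))"

lemma app_zero_endo: "app 0 x = (0 :: 'a)"
  by (simp add: zero_endo_def app_Endo)
lemma app_one_endo: "app 1 x = (x :: 'a)"
  by (simp add: one_endo_def app_Endo)
lemma app_plus_endo: "app (f + g) x = app f x + (app g x :: 'a)"
  by (simp add: plus_endo_def app_Endo app_add)
lemma app_minus_endo: "app (f - g) x = app f x - (app g x :: 'a)"
  by (simp add: minus_endo_def app_Endo app_add)
lemma app_uminus_endo: "app (- f) x = - (app f x :: 'a)"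
  by (simp add: uminus_endo_def app_Endo app_add)
lemma app_times_endo: "app (f * g) x = app f (app g x :: 'a)"
  by (simp add: times_endo_def app_Endo app_add)

lemmas app_simps [simp] = app_zero_endo app_one_endo app_plus_endo app_minus_endo
  app_uminus_endo app_times_endo

instance
proof
  show "(0 :: 'a endo) \<noteq> 1"
  proof
    assume "(0 :: 'a endo) = 1"
    then have "app 0 (1 :: 'a) = app 1 1" by simp
    then show False by (simp del: one_endo_def)
  qed
qed (auto intro!: endo_eqI simp: app_add)

end

definition mulop :: "'a::comm_ring_1 \<Rightarrow> 'a endo"
  where "mulop p = Endo (\<lambda>q. p * q)"

lemma app_mulop [simp]: "app (mulop p) q = p * q"
  by (simp add: mulop_def app_Endo algebra_simps)

lemma mulop_0 [simp]: "mulop 0 = 0"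
  and mulop_1 [simp]: "mulop 1 = 1"
  and mulop_add: "mulop (p + q) = mulop p + mulop q"
  and mulop_diff: "mulop (p - q) = mulop p - mulop q"
  and mulop_uminus: "mulop (- p) = - mulop p"
  and mulop_mult: "mulop (p * q) = mulop p * mulop q"
  by (auto intro!: endo_eqI simp: algebra_simps)

lemma mulop_commute: "mulop p * mulop q = mulop q * mulop p"
  by (simp add: mulop_mult[symmetric] mult.commute)

lemma mulop_inj: "mulop p = mulop q \<longleftrightarrow> p = q"
  by (metis app_mulop mult.right_neutral)

lemma mulop_numeral: "mulop (numeral n) = numeral n"
proof -
  have "mulop (of_nat k) = of_nat k" for k :: nat
    by (induct k) (simp_all add: mulop_add)
  from this[of "numeral n"] show ?thesis by simp
qed

section \<open>Derivations\<close>

definition derivation :: "('a::comm_ring_1 \<Rightarrow> 'a) \<Rightarrow> bool"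
  where "derivation \<delta> \<longleftrightarrow> (\<forall>x y. \<delta> (x + y) = \<delta> x + \<delta> y) \<and> (\<forall>x y. \<delta> (x * y) = \<delta> x * y + x * \<delta> y)"

lemma derivation_add: "derivation \<delta> \<Longrightarrow> \<delta> (x + y) = \<delta> x + \<delta> y"
  and derivation_mult: "derivation \<delta> \<Longrightarrow> \<delta> (x * y) = \<delta> x * y + x * \<delta> y"
  by (simp_all add: derivation_def)

lemma derivation_0 [simp]: assumes "derivation \<delta>" shows "\<delta> 0 = 0"
  using derivation_add[OF assms, of 0 0] by simp

lemma derivation_1 [simp]: assumes "derivation \<delta>" shows "\<delta> 1 = 0"
  using derivation_mult[OF assms, of 1 1] by simp

lemma derivation_minus: assumes "derivation \<delta>" shows "\<delta> (- x) = - \<delta> x"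
  using derivation_add[OF assms, of x "- x"] assms by (simp add: eq_neg_iff_add_eq_0 add.commute)

lemma derivation_diff: assumes "derivation \<delta>" shows "\<delta> (x - y) = \<delta> x - \<delta> y"
  using derivation_add[OF assms, of x "- y"] assms by (simp add: derivation_minus)

lemma derivation_of_nat [simp]: "derivation \<delta> \<Longrightarrow> \<delta> (of_nat n) = 0"
  by (induct n) (simp_all add: derivation_add)

lemma derivation_numeral [simp]: "derivation \<delta> \<Longrightarrow> \<delta> (numeral n) = 0"
  using derivation_of_nat[of \<delta> "numeral n"] by simp

lemma derivation_power:
  assumes "derivation \<delta>" shows "\<delta> (x ^ n) = of_nat n * x ^ (n - 1) * \<delta> x"
proof (induct n)
  case (Suc n)
  then show ?case
    by (cases n) (simp_all add: derivation_mult[OF assms] assms algebra_simps)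
qed (simp add: assms)

lemma derivation_bracket:
  "derivation \<delta> \<Longrightarrow> derivation \<epsilon> \<Longrightarrow> derivation (\<lambda>x. \<delta> (\<epsilon> x) - \<epsilon> (\<delta> x))"
  by (simp add: derivation_def algebra_simps)

lemma char3_add: "(3::'a::ring_1) = 0 \<Longrightarrow> x + x = - (x :: 'a)"
proof -
  assume "(3::'a) = 0"
  then have "(2 + 1) * x = 0" by simp
  then show ?thesis by (simp only: distrib_right mult_2 mult_1_left eq_neg_iff_add_eq_0)
qed

text \<open>The mixed terms in the Leibniz rule for a third power carry the binomial coefficient
  3.\<close>

lemma derivation_cube:
  assumes d: "derivation (\<delta> :: 'a::comm_ring_1 \<Rightarrow> 'a)" and c: "(3::'a) = 0"
  shows "derivation (\<lambda>x. \<delta> (\<delta> (\<delta> x)))"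
proof -
  have "\<delta> (\<delta> (\<delta> (x * y))) = \<delta> (\<delta> (\<delta> x)) * y + 3 * (\<delta> (\<delta> x) * \<delta> y + \<delta> x * \<delta> (\<delta> y)) + x * \<delta> (\<delta> (\<delta> y))" for x y
    by (simp add: derivation_add[OF d] derivation_mult[OF d] d algebra_simps)
  then show ?thesis
    using c by (simp add: derivation_def derivation_add[OF d])
qed

text \<open>For a derivation \<delta> of the coefficients, this is the derivation of the polynomial
  ring that extends \<delta> and sends the variable to \<open>t\<close>.\<close>

definition dext :: "('a::idom \<Rightarrow> 'a) \<Rightarrow> 'a poly \<Rightarrow> 'a poly \<Rightarrow> 'a poly"
  where "dext \<delta> t p = map_poly \<delta> p + pderiv p * t"

lemma map_poly_derivation:
  assumes d: "derivation \<delta>" shows "derivation (map_poly \<delta>)"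
proof -
  have add: "map_poly \<delta> (p + q) = map_poly \<delta> p + map_poly \<delta> q" for p q
    by (intro poly_eqI) (simp add: coeff_map_poly d derivation_add[OF d])
  have smult: "map_poly \<delta> (smult c q) = smult (\<delta> c) q + smult c (map_poly \<delta> q)" for c q
    by (intro poly_eqI) (simp add: coeff_map_poly d derivation_mult[OF d])
  have "map_poly \<delta> (p * q) = map_poly \<delta> p * q + p * map_poly \<delta> q" for p q
    by (induct p) (simp_all add: add smult map_poly_pCons d algebra_simps)
  with add show ?thesis by (simp add: derivation_def)
qed

lemma derivation_dext: assumes "derivation \<delta>" shows "derivation (dext \<delta> t)"
  using map_poly_derivation[OF assms]
  by (auto simp: derivation_def dext_def pderiv_add pderiv_mult algebra_simps)

lemma dext_const [simp]: "derivation \<delta> \<Longrightarrow> dext \<delta> t [:c:] = [:\<delta> c:]"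
  by (simp add: dext_def map_poly_pCons)

lemma dext_X [simp]: "derivation \<delta> \<Longrightarrow> dext \<delta> t [:0, 1:] = t"
  by (simp add: dext_def map_poly_pCons pderiv_pCons)

lemma derivation_poly_eqI:
  assumes d: "derivation \<delta>" and e: "derivation \<epsilon>"
    and c: "\<And>c. \<delta> [:c:] = \<epsilon> [:c:]" and X: "\<delta> [:0, 1:] = \<epsilon> [:0, 1:]"
  shows "\<delta> p = \<epsilon> p"
proof (induct p)
  case (pCons r p)
  have "pCons r p = [:r:] + [:0, 1:] * p" by simp
  then show ?case
    by (simp only: derivation_add[OF d] derivation_add[OF e] derivation_mult[OF d]
        derivation_mult[OF e] c X pCons)
qed (simp add: d e)

section \<open>Evaluation in noncommutative rings\<close>

text \<open>Normally ordered evaluation, the sum of the \<open>g c_i * t ^ i\<close> with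
  coefficients on the left. Since \<open>t\<close> may fail to commute with them, multiplicativity
  is a separate question.\<close>

definition pev :: "('a::zero \<Rightarrow> 'r::ring_1) \<Rightarrow> 'r \<Rightarrow> 'a poly \<Rightarrow> 'r"
  where "pev g t p = fold_coeffs (\<lambda>c r. g c + r * t) p 0"

lemma pev_0 [simp]: "pev g t 0 = 0"
  by (simp add: pev_def)

lemma pev_pCons: "g 0 = 0 \<Longrightarrow> pev g t (pCons c p) = g c + pev g t p * t"
  by (cases "p = 0 \<and> c = 0") (auto simp: pev_def)

definition additive_map :: "('a::ab_group_add \<Rightarrow> 'b::ab_group_add) \<Rightarrow> bool"
  where "additive_map g \<longleftrightarrow> (\<forall>x y. g (x + y) = g x + g y)"

lemma additive_map_add: "additive_map g \<Longrightarrow> g (x + y) = g x + g y"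
  by (simp add: additive_map_def)

lemma additive_map_0 [simp]: assumes "additive_map g" shows "g 0 = 0"
  using additive_map_add[OF assms, of 0 0] by simp

lemma additive_map_minus: assumes "additive_map g" shows "g (- x) = - g x"
  using additive_map_add[OF assms, of x "- x"] assms by (simp add: eq_neg_iff_add_eq_0 add.commute)

lemma additive_map_diff: assumes "additive_map g" shows "g (x - y) = g x - g y"
  using additive_map_add[OF assms, of x "- y"] assms by (simp add: additive_map_minus)

lemma pev_add:
  assumes "additive_map g" shows "pev g t (p + q) = pev g t p + pev g t q"
  by (induct p q rule: poly_induct2)
    (simp_all add: pev_pCons assms additive_map_add[OF assms] algebra_simps)

lemma additive_map_pev: "additive_map g \<Longrightarrow> additive_map (pev g t)"
  by (simp add: additive_map_def pev_add)

lemma pev_const [simp]: "additive_map g \<Longrightarrow> pev g t [:c:] = g c"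
  by (simp add: pev_pCons)

lemma pev_1: "additive_map g \<Longrightarrow> g 1 = 1 \<Longrightarrow> pev g t 1 = 1"
  using pev_const[of g t 1] by (simp add: one_pCons)

section \<open>Polynomials in characteristic three\<close>

lemma char3_poly: "(3::'a::comm_ring_1) = 0 \<Longrightarrow> (3::'a poly) = 0"
  by (simp add: numeral_poly)

lemma of_nat_eq_0_char3:
  assumes "(3::'a::ring_1) = 0"
  shows "(of_nat n :: 'a) = 0 \<longleftrightarrow> 3 dvd n"
proof -
  have two: "(2::'a) \<noteq> 0"
  proof
    assume "(2::'a) = 0"
    then have "(3::'a) - 2 = 0" using assms by simp
    then show False by simp
  qed
  have "(of_nat n :: 'a) = of_nat (3 * (n div 3) + n mod 3)" by simp
  also have "\<dots> = 3 * of_nat (n div 3) + of_nat (n mod 3)" by (simp only: of_nat_add of_nat_mult of_nat_numeral)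
  finally have eq: "(of_nat n :: 'a) = of_nat (n mod 3)" using assms by simp
  have "n mod 3 = 0 \<or> n mod 3 = 1 \<or> n mod 3 = 2" by auto
  then show ?thesis
    using eq two by (auto simp: dvd_eq_mod_eq_0)
qed

text \<open>The coefficient of exponent \<open>i\<close> is annihilated by \<open>i\<close>, which
  is nonzero in the domain unless 3 divides it. Only exponents divisible by 3 survive.\<close>

lemma pderiv_eq_0_char3:
  fixes p :: "'a::idom poly"
  assumes c: "(3::'a) = 0" and p: "pderiv p = 0"
  shows "\<exists>q. p = pcompose q (monom 1 3)"
proof -
  have mono: "pcompose (monom a k) (monom 1 3) = monom a (3 * k)" for a :: 'a and k
    by (induct k) (simp_all add: monom_Suc monom_0 pcompose_pCons mult_monom)
  have "\<exists>q. monom (coeff p i) i = pcompose q (monom 1 3)" for i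
  proof (cases "3 dvd i")
    case True
    then obtain k where "i = 3 * k" by auto
    then show ?thesis using mono by metis
  next
    case False
    then obtain j where j: "i = Suc j" by (cases i) auto
    have "of_nat (Suc j) * coeff p (Suc j) = 0"
      using p coeff_pderiv[of p j] by simp
    with False j have "coeff p i = 0"
      using of_nat_eq_0_char3[OF c, of "Suc j"] by (auto simp del: of_nat_Suc)
    then show ?thesis by (intro exI[of _ 0]) simp
  qed
  then obtain q where q: "\<And>i. monom (coeff p i) i = pcompose (q i) (monom 1 3)" by metis
  have "p = (\<Sum>i\<le>degree p. monom (coeff p i) i)" by (simp add: poly_as_sum_of_monoms)
  also have "\<dots> = (\<Sum>i\<le>degree p. pcompose (q i) (monom 1 3))" by (simp add: q)
  also have "\<dots> = pcompose (\<Sum>i\<le>degree p. q i) (monom 1 3)" by (simp add: pcompose_sum)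
  finally show ?thesis by blast
qed

abbreviation shift :: "'a::comm_ring_1 poly \<Rightarrow> 'a poly"
  where "shift p \<equiv> pcompose p [:1, 1:]"

text \<open>In the binomial expansion of \<open>p\<close> at Y + 1, exponent \<open>i\<close>
  receives contributions from degrees at least \<open>i\<close>; under the hypotheses only the
  degrees \<open>i\<close> and \<open>Suc i\<close> remain.\<close>

lemma coeff_shift:
  assumes "\<And>i. i > Suc n \<Longrightarrow> coeff p i = 0" and "i \<ge> n"
  shows "coeff (shift p) i = coeff p i + of_nat (Suc i) * coeff p (Suc i)"
  using assms
proof (induct p arbitrary: n i)
  case (pCons r p)
  have eq: "shift (pCons r p) = [:r:] + shift p + pCons 0 (shift p)"
    by (simp add: pcompose_pCons algebra_simps)
  have p: "coeff p k = 0" if "k > n" for k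
    using pCons(3)[of "Suc k"] that by simp
  show ?case
  proof (cases n)
    case 0
    then have "p = [:coeff p 0:]"
      using p by (intro poly_eqI) (simp add: coeff_pCons split: nat.splits)
    then obtain k where k: "p = [:k:]" by blast
    show ?thesis unfolding k by (cases i) (simp_all add: pcompose_pCons)
  next
    case (Suc m)
    then obtain j where j: "i = Suc j" using pCons(4) by (cases i) auto
    have "coeff (shift p) j = coeff p j + of_nat (Suc j) * coeff p (Suc j)"
      using pCons(2)[of m j] p Suc j pCons(4) by simp
    moreover have "coeff (shift p) (Suc j) = coeff p (Suc j) + of_nat (Suc (Suc j)) * coeff p (Suc (Suc j))"
      using pCons(2)[of m "Suc j"] p Suc j pCons(4) by simp
    moreover have "coeff p (Suc (Suc j)) = 0"
      using p Suc j pCons(4) by simp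
    ultimately show ?thesis
      unfolding eq j by (simp add: algebra_simps)
  qed
qed simp

lemma coeff_shift_degree: "coeff (shift p) (degree p) = coeff p (degree p)"
  using coeff_shift[of "degree p" p "degree p"] by (simp add: coeff_eq_0)

text \<open>Strong induction on an exclusive bound for the degree. Comparing the coefficients just
  below the top degree d gives d times the top coefficient equal to 0. So either that coefficient
  vanishes, or 3 divides d and a multiple of a power of the Artin-Schreier polynomial Y^3 - Y
  removes the top term.\<close>

lemma shift_invariant_char3:
  fixes p :: "'a::idom poly"
  assumes c: "(3::'a) = 0" and p: "shift p = p"
  shows "\<exists>q. p = pcompose q (monom 1 3 - [:0, 1:])"
proof -
  let ?t = "monom 1 3 - [:0, 1:] :: 'a poly"
  have t3: "[:1, 1:] ^ 3 = monom 1 3 + (1 :: 'a poly)"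
  proof -
    have "[:1, 1:] ^ 3 = [:1, 3, 3, 1:]" by (simp add: power3_eq_cube)
    also have "\<dots> = monom 1 3 + (1 :: 'a poly)"
      using c by (simp add: numeral_3_eq_3 monom_Suc monom_0 one_pCons)
    finally show ?thesis .
  qed
  have m3: "pcompose (monom 1 3) r = r ^ 3" for r :: "'a poly"
    by (simp add: numeral_3_eq_3 monom_Suc monom_0 pcompose_pCons)
  have t: "shift ?t = ?t"
    by (simp add: pcompose_diff m3 t3 pcompose_pCons one_pCons)
  have "\<exists>q. p = pcompose q ?t" if "\<And>i. i \<ge> n \<Longrightarrow> coeff p i = 0" "shift p = p" for n p
    using that
  proof (induct n arbitrary: p rule: less_induct)
    case (less n)
    show ?case
    proof (cases "n \<le> 1")
      case True
      then have "p = [:coeff p 0:]"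
        using less(2) by (intro poly_eqI) (simp add: coeff_pCons split: nat.splits)
      moreover have "pcompose [:coeff p 0:] ?t = [:coeff p 0:]" by simp
      ultimately have "p = pcompose [:coeff p 0:] ?t" by simp
      then show ?thesis by blast
    next
      case False
      then obtain m where m: "n = Suc (Suc m)" by (metis One_nat_def Suc_le_D not_less_eq_eq)
      have "coeff (shift p) m = coeff p m + of_nat (Suc m) * coeff p (Suc m)"
        by (rule coeff_shift[of m]) (use less(2) m in auto)
      then have "of_nat (Suc m) * coeff p (Suc m) = 0" using less(3) by simp
      then consider "coeff p (Suc m) = 0" | "3 dvd Suc m"
        using of_nat_eq_0_char3[OF c, of "Suc m"] by (auto simp del: of_nat_Suc)
      then show ?thesis
      proof cases
        case 1
        have "coeff p i = 0" if "i \<ge> Suc m" for i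
          using less(2)[of i] 1 that m by (cases "i = Suc m") auto
        then show ?thesis using less(1)[of "Suc m" p] less(3) m by simp
      next
        case 2
        then obtain k where k: "Suc m = 3 * k" by auto
        have dt: "degree ?t = 3"
          using degree_add_eq_left[of "- [:0, 1:]" "monom 1 3 :: 'a poly"]
          by (simp add: degree_monom_eq diff_conv_add_uminus del: add_uminus_conv_diff)
        have lt: "coeff ?t 3 = 1" by (simp add: numeral_3_eq_3)
        have "?t \<noteq> 0" using dt by auto
        then have dtk: "degree (?t ^ k) = Suc m" using dt k by (simp add: degree_power_eq)
        have ltk: "coeff (?t ^ k) (Suc m) = 1"
          using lead_coeff_power[of ?t k] dt lt dtk by simp
        \<comment> \<open>The power is monic of degree \<open>Suc m\<close> and invariant under the
          shift, so the difference loses its top term and stays invariant.\<close>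
        let ?q = "p - smult (coeff p (Suc m)) (?t ^ k)"
        have "coeff ?q i = 0" if "i \<ge> Suc m" for i
          using less(2)[of i] that m ltk dtk by (cases "i = Suc m") (auto simp: coeff_eq_0)
        moreover have "shift (?t ^ k) = ?t ^ k"
          using t by (induct k) (simp_all add: pcompose_mult pcompose_1)
        then have "shift ?q = ?q"
          using less(3) by (simp only: pcompose_diff pcompose_smult)
        ultimately obtain q where q: "?q = pcompose q ?t"
          using less(1)[of "Suc m" ?q] m by blast
        have "pcompose (monom a j) ?t = smult a (?t ^ j)" for a j
          by (induct j) (simp_all add: monom_0 monom_Suc pcompose_pCons)
        then have "pcompose (q + monom (coeff p (Suc m)) k) ?t = ?q + smult (coeff p (Suc m)) (?t ^ k)"
          by (simp only: pcompose_add q)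
        then have "p = pcompose (q + monom (coeff p (Suc m)) k) ?t" by (simp only: diff_add_cancel)
        then show ?thesis by blast
      qed
    qed
  qed
  from this[of "Suc (degree p)" p] show ?thesis using p by (simp add: coeff_eq_0)
qed

text \<open>The composite of Y^3 - Y with Y^3; it will become the central element y^9 - y^3.\<close>

definition zpoly :: "'a::comm_ring_1 poly"
  where "zpoly = [:0, 1:] ^ 9 - [:0, 1:] ^ 3"

text \<open>Vanishing derivative makes \<open>p\<close> a polynomial \<open>q\<close> in Y^3. Since
  (Y + 1)^3 = Y^3 + 1, the invariance passes to \<open>q\<close>, which is then a polynomial in Y^3
  - Y.\<close>

lemma shift_pderiv_invariant_char3:
  fixes p :: "'a::idom poly"
  assumes c: "(3::'a) = 0" and p: "shift p = p" and p': "pderiv p = 0"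
  shows "\<exists>q. p = pcompose q zpoly"
proof -
  let ?y = "monom 1 3 :: 'a poly"
  have m3: "pcompose (monom 1 3) r = r ^ 3" for r :: "'a poly"
    by (simp add: numeral_3_eq_3 monom_Suc monom_0 pcompose_pCons)
  obtain q where q: "p = pcompose q ?y" using pderiv_eq_0_char3[OF c p'] by blast
  have "shift ?y = ?y + 1"
  proof -
    have "[:1, 1:] ^ 3 = [:1, 3, 3, 1:: 'a:]" by (simp add: power3_eq_cube)
    also have "\<dots> = monom 1 3 + (1 :: 'a poly)"
      using c by (simp add: numeral_3_eq_3 monom_Suc monom_0 one_pCons)
    finally show ?thesis by (simp add: m3)
  qed
  also have "\<dots> = pcompose [:1, 1:] ?y" by (simp add: pcompose_pCons one_pCons)
  finally have "pcompose (shift q - q) ?y = 0"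
    using p unfolding q pcompose_diff by (simp add: pcompose_assoc[symmetric])
  \<comment> \<open>Composition with a polynomial of positive degree is injective.\<close>
  then have "shift q = q"
    using pcompose_eq_0[of "shift q - q" ?y] by (simp add: degree_monom_eq)
  then obtain r where "q = pcompose r (?y - [:0, 1:])"
    using shift_invariant_char3[OF c] by blast
  then have "p = pcompose r (pcompose (?y - [:0, 1:]) ?y)"
    using q by (simp add: pcompose_assoc)
  also have "pcompose (?y - [:0, 1:]) ?y = zpoly"
    by (simp add: pcompose_diff m3 pcompose_pCons zpoly_def)
      (simp add: monom_altdef power_mult[symmetric])
  finally show ?thesis by blast
qed

lemma degree_zpoly: "degree (zpoly :: 'a::idom poly) = 9"
proof -
  have "zpoly = monom 1 9 - (monom 1 3 :: 'a poly)"
    by (simp add: zpoly_def monom_altdef)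
  then show ?thesis
    using degree_add_eq_left[of "- monom 1 3 :: 'a poly" "monom 1 9"] by (simp add: degree_monom_eq)
qed

section \<open>The symmetric algebra of \<open>K\<close> and its derivations\<close>

text \<open>The three nested variables are, from the inside out, \<open>a\<close>, \<open>b\<close> and \<open>c\<close>.\<close>

type_synonym 'f sym = "'f poly poly poly"

definition va :: "'f::field sym" where "va = [:[:[:0, 1:]:]:]"
definition vb :: "'f::field sym" where "vb = [:[:0, 1:]:]"
definition vc :: "'f::field sym" where "vc = [:0, 1:]"
definition kS :: "'f::field \<Rightarrow> 'f sym" where "kS k = [:[:[:k:]:]:]"

lemma kS_add: "kS (j + k) = kS j + kS k"
  and kS_mult: "kS (j * k) = kS j * kS k"
  and kS_minus: "kS (- k) = - kS k"
  and kS_0 [simp]: "kS 0 = 0"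
  and kS_1 [simp]: "kS 1 = 1"
  and kS_inj: "kS j = kS k \<longleftrightarrow> j = k"
  by (simp_all add: kS_def one_pCons)

text \<open>Reduces identities between derivations or ring maps on S to the scalars and the three
  generators.\<close>

lemma sym_induct [case_names const a b c add mult]:
  assumes k: "\<And>k. P (kS k)" and abc: "P va" "P vb" "P vc"
    and add: "\<And>s t. P s \<Longrightarrow> P t \<Longrightarrow> P (s + t)"
    and mult: "\<And>s t. P s \<Longrightarrow> P t \<Longrightarrow> P (s * t)"
  shows "P (s :: 'f::field sym)"
proof -
  have 1: "P [:[:p:]:]" for p
  proof (induct p)
    case 0
    show ?case using k[of 0] by (simp add: kS_def)
  next
    case (pCons r p)
    have "[:[:pCons r p:]:] = kS r + va * [:[:p:]:]" by (simp add: kS_def va_def)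
    then show ?case using add[OF k mult[OF abc(1) pCons(2)]] by simp
  qed
  have 2: "P [:q:]" for q
  proof (induct q)
    case 0
    show ?case using 1[of 0] by simp
  next
    case (pCons r p)
    have "[:pCons r p:] = [:[:r:]:] + vb * [:p:]" by (simp add: vb_def)
    then show ?case using add[OF 1 mult[OF abc(2) pCons(2)]] by simp
  qed
  show ?thesis
  proof (induct s)
    case 0
    show ?case using 2[of 0] by simp
  next
    case (pCons r p)
    have "pCons r p = [:r:] + vc * p" by (simp add: vc_def)
    then show ?case using add[OF 2 mult[OF abc(3) pCons(2)]] by simp
  qed
qed

lemma derivation_sym_eqI:
  assumes d: "derivation \<delta>" and e: "derivation \<epsilon>"
    and "\<And>k. \<delta> (kS k) = \<epsilon> (kS k)" "\<delta> va = \<epsilon> va" "\<delta> vb = \<epsilon> vb" "\<delta> vc = \<epsilon> vc"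
  shows "\<delta> s = \<epsilon> (s :: 'f::field sym)"
  by (induct s rule: sym_induct) (simp_all add: assms derivation_add[OF d] derivation_add[OF e]
      derivation_mult[OF d] derivation_mult[OF e])

text \<open>The derivation ta d/da + tb d/db + tc d/dc; each \<open>map_poly\<close> goes one
  variable further in.\<close>

definition symder :: "'f::field sym \<Rightarrow> 'f sym \<Rightarrow> 'f sym \<Rightarrow> 'f sym \<Rightarrow> 'f sym"
  where "symder ta tb tc s =
    ta * map_poly (map_poly pderiv) s + tb * map_poly pderiv s + tc * pderiv s"

lemma derivation_pderiv: "derivation pderiv"
  by (simp add: derivation_def pderiv_add pderiv_mult algebra_simps)

lemma derivation_symder: "derivation (symder ta tb tc)"
proof -
  note d = map_poly_derivation[OF map_poly_derivation[OF derivation_pderiv]]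
    map_poly_derivation[OF derivation_pderiv] derivation_pderiv
  show ?thesis
    unfolding derivation_def[of "symder ta tb tc"]
    by (intro conjI allI)
      (simp_all add: symder_def d[THEN derivation_add] d[THEN derivation_mult] algebra_simps)
qed

lemma symder_gens [simp]:
  "symder ta tb tc (kS k) = 0" "symder ta tb tc va = ta"
  "symder ta tb tc vb = tb" "symder ta tb tc vc = tc"
  by (simp_all add: symder_def kS_def va_def vb_def vc_def map_poly_pCons pderiv_pCons
      one_pCons[symmetric] map_poly_1)

text \<open>\<open>Dy\<close> and \<open>Dx\<close> extend \<open>ad y\<close> and \<open>ad x\<close>.\<close>

definition Dy :: "'f::field sym \<Rightarrow> 'f sym" where "Dy = symder va (vb + va) (vc + vb)"
definition Dx :: "'f::field sym \<Rightarrow> 'f sym" where "Dx = symder vb (vb - vc) (- vc)"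
definition Dnil :: "'f::field sym \<Rightarrow> 'f sym" where "Dnil = symder 0 va vb"
definition Eul :: "'f::field sym \<Rightarrow> 'f sym" where "Eul = symder va vb vc"

lemma derivation_Dy: "derivation Dy" and derivation_Dx: "derivation Dx"
  and derivation_Dnil: "derivation Dnil" and derivation_Eul: "derivation Eul"
  by (simp_all add: Dy_def Dx_def Dnil_def Eul_def derivation_symder)

lemmas Dy_rules = derivation_add[OF derivation_Dy] derivation_mult[OF derivation_Dy]
  derivation_minus[OF derivation_Dy] derivation_diff[OF derivation_Dy]
lemmas Dx_rules = derivation_add[OF derivation_Dx] derivation_mult[OF derivation_Dx]
  derivation_minus[OF derivation_Dx] derivation_diff[OF derivation_Dx]
lemmas Dnil_rules = derivation_add[OF derivation_Dnil] derivation_mult[OF derivation_Dnil]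
lemmas Eul_rules = derivation_add[OF derivation_Eul] derivation_mult[OF derivation_Eul]

lemma gens [simp]:
  "Dy (kS k) = 0" "Dy va = va" "Dy vb = vb + va" "Dy vc = vc + vb"
  "Dx (kS k) = 0" "Dx va = vb" "Dx vb = vb - vc" "Dx vc = - vc"
  "Dnil (kS k) = 0" "Dnil va = 0" "Dnil vb = va" "Dnil vc = vb"
  "Eul (kS k) = 0" "Eul va = va" "Eul vb = vb" "Eul vc = vc"
  by (simp_all add: Dy_def Dx_def Dnil_def Eul_def)

lemma Dy_eq: "Dy s = Eul s + Dnil s"
  by (simp add: Dy_def Eul_def Dnil_def symder_def algebra_simps)

definition vq :: "'f::field sym" where "vq = vb\<^sup>2 + va * vc"

lemma Dnil_vq: assumes "(3::'f::field) = 0" shows "Dnil (vq :: 'f sym) = 0"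
proof -
  have "Dnil (vq :: 'f sym) = 3 * (va * vb)"
    by (simp add: vq_def power2_eq_square Dnil_rules algebra_simps)
  then show ?thesis using assms by (simp add: char3_poly)
qed

lemma Eul_vq [simp]: "Eul vq = 2 * vq"
  by (simp add: vq_def power2_eq_square Eul_rules algebra_simps)

section \<open>Cubes of the derivations and eigenvectors of \<open>Dy\<close>\<close>

context
  assumes char3: "(3::'f::field) = 0"
begin

lemma char3_sym: "(3::'f sym) = 0"
  using char3 by (simp add: char3_poly)

text \<open>Both sides are derivations, so the generators suffice. On their span \<open>Dy\<close>
  is 1 + N with N^3 = 0, and in characteristic three (1 + N)^3 = 1.\<close>

lemma Dy_cube: "Dy (Dy (Dy s)) = Eul (s :: 'f sym)"
proof (rule derivation_sym_eqI[where \<delta> = "\<lambda>s. Dy (Dy (Dy s))" and \<epsilon> = Eul])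
  show "derivation (\<lambda>s. Dy (Dy (Dy (s :: 'f sym))))"
    by (rule derivation_cube[OF derivation_Dy char3_sym])
  have "Dy (Dy (Dy vb)) = vb + 3 * (va :: 'f sym)" by (simp add: Dy_rules derivation_Dy)
  then show "Dy (Dy (Dy vb)) = Eul (vb :: 'f sym)" using char3_sym by simp
  have "Dy (Dy (Dy vc)) = vc + 3 * (vb + va :: 'f sym)" by (simp add: Dy_rules derivation_Dy)
  then show "Dy (Dy (Dy vc)) = Eul (vc :: 'f sym)" using char3_sym by simp
qed (simp_all add: derivation_Eul derivation_Dy)

text \<open>\<open>Eul\<close> multiplies the part of degree d by d, and d^3 = d in the prime field.
  Formally, both sides are derivations that agree on the generators.\<close>

lemma Eul_cube: "Eul (Eul (Eul s)) = Eul (s :: 'f sym)"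
proof (rule derivation_sym_eqI[where \<delta> = "\<lambda>s. Eul (Eul (Eul s))" and \<epsilon> = Eul])
  show "derivation (\<lambda>s. Eul (Eul (Eul (s :: 'f sym))))"
    by (rule derivation_cube[OF derivation_Eul char3_sym])
qed (simp_all add: derivation_Eul)

text \<open>The relation [x, y] = 2 y for the derivations. Both sides are derivations, and on a, b
  and c the defect is a multiple of 3.\<close>

lemma Dx_Dy: "Dx (Dy s) - Dy (Dx s) = 2 * Dy (s :: 'f sym)"
proof (rule derivation_sym_eqI[where \<delta> = "\<lambda>s. Dx (Dy s) - Dy (Dx s)" and \<epsilon> = "\<lambda>s. 2 * Dy s"])
  show "derivation (\<lambda>s. Dx (Dy s) - Dy (Dx s) :: 'f sym)"
    by (rule derivation_bracket[OF derivation_Dx derivation_Dy])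
  show "derivation (\<lambda>s. 2 * Dy s :: 'f sym)"
    by (simp add: derivation_def Dy_rules algebra_simps)
  have "Dx (Dy va) - Dy (Dx va) = 2 * Dy va - 3 * (va :: 'f sym)"
    by (simp add: Dx_rules Dy_rules)
  then show "Dx (Dy va) - Dy (Dx va) = 2 * Dy (va :: 'f sym)"
    using char3_sym by simp
  have "Dx (Dy vb) - Dy (Dx vb) = 2 * Dy vb - 3 * (va :: 'f sym)"
    by (simp add: Dx_rules Dy_rules)
  then show "Dx (Dy vb) - Dy (Dx vb) = 2 * Dy (vb :: 'f sym)"
    using char3_sym by simp
  have "Dx (Dy vc) - Dy (Dx vc) = 2 * Dy vc - 3 * (vc :: 'f sym)"
    by (simp add: Dx_rules Dy_rules)
  then show "Dx (Dy vc) - Dy (Dx vc) = 2 * Dy (vc :: 'f sym)"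
    using char3_sym by simp
qed (simp_all add: derivation_Dx derivation_Dy)

text \<open>For \<open>s\<close> nonzero, \<open>Dy_cube\<close> gives E s = k^3 s, and
  \<open>Eul_cube\<close> gives k^9 = k^3. Cubing is injective on a field of characteristic three,
  so k^3 = k; then D and E agree on \<open>s\<close>, and N is their difference.\<close>

lemma Dy_eigen:
  assumes s: "Dy s = kS k * (s :: 'f sym)"
  shows "Dnil s = 0 \<and> Eul s = kS k * s"
proof (cases "s = 0")
  case True
  then show ?thesis by (simp add: derivation_Dnil derivation_Eul)
next
  case False
  define m where "m = k ^ 3"
  have E: "Eul s = kS m * s"
    by (simp add: m_def Dy_cube[symmetric] s Dy_rules kS_mult power3_eq_cube)
  have "Eul (Eul (Eul s)) = kS (m ^ 3) * s"
    by (simp add: E Eul_rules kS_mult power3_eq_cube)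
  then have "kS (m ^ 3) * s = kS m * s" by (metis Eul_cube E)
  then have "(k ^ 3) ^ 3 = k ^ 3" using False m_def by (simp add: kS_inj)
  moreover have "(k ^ 3 - k) ^ 3 = (k ^ 3) ^ 3 - k ^ 3 + 3 * (k ^ 3 * k ^ 2 - (k ^ 3) ^ 2 * k)"
    by (simp add: power3_eq_cube power2_eq_square algebra_simps)
  ultimately have "(k ^ 3 - k) ^ 3 = 0" using char3 by simp
  then have "k ^ 3 = k" by simp
  then have "Eul s = kS k * s" using E m_def by simp
  then show ?thesis using s Dy_eq[of s] by simp
qed

end

section \<open>Explicit generators for the constants and eigenvectors of \<open>Dy\<close>\<close>

inductive_set const_alg :: "'f::field sym set" where
  const: "kS k \<in> const_alg"
| a: "va ^ 3 \<in> const_alg"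
| b: "vb ^ 3 \<in> const_alg"
| c: "vc ^ 3 \<in> const_alg"
| aq: "va * vq \<in> const_alg"
| add: "s \<in> const_alg \<Longrightarrow> t \<in> const_alg \<Longrightarrow> s + t \<in> const_alg"
| mult: "s \<in> const_alg \<Longrightarrow> t \<in> const_alg \<Longrightarrow> s * t \<in> const_alg"

text \<open>These are generators of \<open>F[a, q, b\<^sup>3, c\<^sup>3]\<close> as a module over \<open>const_alg\<close>: \<open>a q\<close>, \<open>a\<^sup>3\<close>
  and \<open>q\<^sup>3 = b\<^sup>6 + a\<^sup>3 c\<^sup>3\<close> all lie in \<open>const_alg\<close>.\<close>

definition semi_alg :: "'f::field sym set" where
  "semi_alg = {s0 + s1 * va + s2 * va\<^sup>2 + s3 * vq + s4 * vq\<^sup>2 | s0 s1 s2 s3 s4.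
    s0 \<in> const_alg \<and> s1 \<in> const_alg \<and> s2 \<in> const_alg \<and> s3 \<in> const_alg \<and> s4 \<in> const_alg}"

lemma const_alg_0: "0 \<in> const_alg" and const_alg_1: "1 \<in> const_alg"
  using const_alg.const[of 0] const_alg.const[of 1] by simp_all

lemma semi_algI:
  assumes "s0 \<in> const_alg" "s1 \<in> const_alg" "s2 \<in> const_alg" "s3 \<in> const_alg" "s4 \<in> const_alg"
    and "s = s0 + s1 * va + s2 * va\<^sup>2 + s3 * vq + s4 * vq\<^sup>2"
  shows "s \<in> semi_alg"
  using assms unfolding semi_alg_def by blast

lemma semi_algE:
  assumes "s \<in> semi_alg"
  obtains s0 s1 s2 s3 s4 where
    "s0 \<in> const_alg" "s1 \<in> const_alg" "s2 \<in> const_alg" "s3 \<in> const_alg" "s4 \<in> const_alg"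
    "s = s0 + s1 * va + s2 * va\<^sup>2 + s3 * vq + s4 * vq\<^sup>2"
  using assms unfolding semi_alg_def by blast

lemma semi_alg_add:
  assumes "s \<in> semi_alg" "t \<in> semi_alg" shows "s + t \<in> semi_alg"
  using assms(1)
proof (rule semi_algE)
  fix s0 s1 s2 s3 s4
  assume s: "s0 \<in> const_alg" "s1 \<in> const_alg" "s2 \<in> const_alg" "s3 \<in> const_alg" "s4 \<in> const_alg"
    "s = s0 + s1 * va + s2 * va\<^sup>2 + s3 * vq + s4 * vq\<^sup>2"
  show ?thesis using assms(2)
  proof (rule semi_algE)
    fix t0 t1 t2 t3 t4
    assume t: "t0 \<in> const_alg" "t1 \<in> const_alg" "t2 \<in> const_alg" "t3 \<in> const_alg" "t4 \<in> const_alg"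
      "t = t0 + t1 * va + t2 * va\<^sup>2 + t3 * vq + t4 * vq\<^sup>2"
    show ?thesis
      by (rule semi_algI[OF const_alg.add[OF s(1) t(1)] const_alg.add[OF s(2) t(2)]
          const_alg.add[OF s(3) t(3)] const_alg.add[OF s(4) t(4)] const_alg.add[OF s(5) t(5)]])
        (simp add: s(6) t(6) distrib_right)
  qed
qed

lemma semi_alg_mult_const:
  assumes "s \<in> semi_alg" and k: "k \<in> const_alg" shows "k * s \<in> semi_alg"
  using assms(1)
proof (rule semi_algE)
  fix s0 s1 s2 s3 s4
  assume s: "s0 \<in> const_alg" "s1 \<in> const_alg" "s2 \<in> const_alg" "s3 \<in> const_alg" "s4 \<in> const_alg"
    "s = s0 + s1 * va + s2 * va\<^sup>2 + s3 * vq + s4 * vq\<^sup>2"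
  show ?thesis
    by (rule semi_algI[OF s(1-5)[THEN const_alg.mult[OF k]]])
      (simp add: s(6) distrib_left mult.assoc)
qed

text \<open>Multiplication by a moves the generators 1, a, a^2, q, q^2 to a, a^2, a^3, a q, (a q) q,
  and both a^3 and a q are coefficients from \<open>const_alg\<close>.\<close>

lemma semi_alg_mult_va:
  assumes "s \<in> semi_alg" shows "va * s \<in> semi_alg"
  using assms
proof (rule semi_algE)
  fix s0 s1 s2 s3 s4
  assume s: "s0 \<in> const_alg" "s1 \<in> const_alg" "s2 \<in> const_alg" "s3 \<in> const_alg" "s4 \<in> const_alg"
    "s = s0 + s1 * va + s2 * va\<^sup>2 + s3 * vq + s4 * vq\<^sup>2"
  show ?thesis
    by (rule semi_algI[OF const_alg.add[OF const_alg.mult[OF s(3) const_alg.a]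
        const_alg.mult[OF s(4) const_alg.aq]] s(1,2) const_alg.mult[OF s(5) const_alg.aq] const_alg_0])
      (simp add: s(6) algebra_simps power2_eq_square power3_eq_cube)
qed

text \<open>Multiplication by q moves the generators 1, a, a^2, q, q^2 to q, a q, (a q) a, q^2, q^3;
  the cube q^3 = b^6 + a^3 c^3 is again a coefficient.\<close>

lemma semi_alg_mult_vq:
  assumes c: "(3::'f) = 0" and s: "s \<in> semi_alg" shows "vq * s \<in> (semi_alg :: 'f::field sym set)"
proof -
  have "vq ^ 3 = (vb ^ 3) * (vb ^ 3) + (va ^ 3) * (vc ^ 3)
    + 3 * (vb\<^sup>2 * vb\<^sup>2 * va * vc + vb\<^sup>2 * va\<^sup>2 * vc\<^sup>2 :: 'f sym)"
    by (simp add: vq_def power2_eq_square power3_eq_cube algebra_simps)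
  then have "vq ^ 3 = (vb ^ 3) * (vb ^ 3) + (va ^ 3) * (vc ^ 3 :: 'f sym)"
    using c by (simp add: char3_poly)
  then have q3: "vq ^ 3 \<in> (const_alg :: 'f sym set)"
    using const_alg.add[OF const_alg.mult[OF const_alg.b const_alg.b]
        const_alg.mult[OF const_alg.a const_alg.c]] by metis
  show ?thesis
    using s
  proof (rule semi_algE)
    fix s0 s1 s2 s3 s4 :: "'f sym"
    assume s: "s0 \<in> const_alg" "s1 \<in> const_alg" "s2 \<in> const_alg" "s3 \<in> const_alg" "s4 \<in> const_alg"
      "s = s0 + s1 * va + s2 * va\<^sup>2 + s3 * vq + s4 * vq\<^sup>2"
    show ?thesis
      by (rule semi_algI[OF const_alg.add[OF const_alg.mult[OF s(2) const_alg.aq]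
          const_alg.mult[OF s(5) q3]] const_alg.mult[OF s(3) const_alg.aq] const_alg_0 s(1,4)])
        (simp add: s(6) algebra_simps power2_eq_square power3_eq_cube)
  qed
qed


text \<open>Induction on the degree in \<open>c\<close>.  If \<open>n = 3 m + k\<close> with \<open>k < 3\<close>, the top three coefficients of
  \<open>N s = 0\<close> show that the leading coefficient is \<open>a\<^sup>k g\<close> with \<open>\<partial>\<^sub>b g = 0\<close>; this is also the
  leading coefficient of \<open>g q\<^sup>k c\<^bsup>3m\<^esup>\<close>, which lies in the kernel of \<open>N\<close>.\<close>

lemma semi_alg_ker_Dnil:
  assumes c: "(3::'f) = 0" and s: "Dnil s = 0" shows "s \<in> (semi_alg :: 'f::field sym set)"
proof -
  \<comment> \<open>The multipliers of \<open>semi_alg\<close> are closed under sums and products,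
    so membership of polynomial expressions reduces to single factors.\<close>
  let ?M = "{t :: 'f sym. \<forall>s\<in>semi_alg. t * s \<in> semi_alg}"
  have M_const: "t \<in> ?M" if "t \<in> const_alg" for t
    using semi_alg_mult_const that by blast
  have M_add: "t + u \<in> ?M" and M_mult: "t * u \<in> ?M" if "t \<in> ?M" "u \<in> ?M" for t u
    using that by (auto simp: semi_alg_add distrib_right mult.assoc)
  have M_pow: "t ^ n \<in> ?M" if "t \<in> ?M" for t n
    using M_mult[OF that] by (induct n) auto
  have M_semi: "t \<in> semi_alg" if "t \<in> ?M" for t
  proof -
    have "1 \<in> (semi_alg :: 'f sym set)"
      by (rule semi_algI[OF const_alg_1 const_alg_0 const_alg_0 const_alg_0 const_alg_0]) simp
    then show ?thesis using that by force
  qed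
  have M_a: "[:[:p:]:] \<in> ?M" for p
  proof (induct p)
    case 0
    show ?case using M_const[OF const_alg_0] by simp
  next
    case (pCons k p)
    have "[:[:pCons k p:]:] = kS k + va * [:[:p:]:]" by (simp add: kS_def va_def)
    moreover have "va \<in> ?M" using semi_alg_mult_va by blast
    ultimately show ?case using M_add[OF M_const[OF const_alg.const[of k]] M_mult[OF _ pCons(2)]] by simp
  qed
  \<comment> \<open>A polynomial in a and b with zero b-derivative is a polynomial in b^3 over
    F[a].\<close>
  have M_ab: "[:r:] \<in> ?M" if r: "pderiv r = 0" for r
  proof -
    obtain q where q: "r = pcompose q (monom 1 3)"
      using pderiv_eq_0_char3[OF char3_poly[OF c] r] by blast
    have "[:pcompose q (monom 1 3):] \<in> ?M"
    proof (induct q)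
      case 0
      show ?case using M_const[OF const_alg_0] by simp
    next
      case (pCons k q)
      have "[:monom 1 3:] = (vb ^ 3 :: 'f sym)"
        by (simp add: vb_def monom_altdef poly_const_pow)
      moreover have "[:pcompose (pCons k q) (monom 1 3):] = [:[:k:]:] + [:monom 1 3:] * [:pcompose q (monom 1 3):]"
        by (simp add: pcompose_pCons)
      ultimately have "[:pcompose (pCons k q) (monom 1 3):] = [:[:k:]:] + vb ^ 3 * [:pcompose q (monom 1 3):]"
        by simp
      then show ?case
        using M_add[OF M_a M_mult[OF M_const[OF const_alg.b] pCons(2)]] by simp
    qed
    then show ?thesis using q by simp
  qed
  have M_q: "vq \<in> ?M" using semi_alg_mult_vq[OF c] by blast
  let ?A = "[:0, 1:] :: 'f poly"
  \<comment> \<open>The coefficient of c^l in N s, from N = a d/db + b d/dc.\<close>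
  have coeff_Dnil: "coeff (Dnil s) l = smult ?A (pderiv (coeff s l)) + of_nat (Suc l) * ([:0, 1:] * coeff s (Suc l))" for s l
  proof -
    have "Dnil s = smult [:?A:] (map_poly pderiv s) + smult [:0, 1:] (pderiv s)"
      by (simp add: Dnil_def symder_def va_def vb_def)
    then show ?thesis by (simp add: coeff_map_poly coeff_pderiv algebra_simps)
  qed
  \<comment> \<open>Multiplication by b shifts the coefficients, and \<open>n\<close> is invertible
    in the field, so divisibility of n b r by a passes to every coefficient of
    \<open>r\<close>.\<close>
  have dvd: "\<exists>g. r = smult ?A g" if "smult ?A p = of_nat n * ([:0, 1:] * r)" "\<not> 3 dvd n" for p r n
  proof -
    have "[:?A:] dvd smult ?A p" by (rule dvdI[of _ _ p]) simp
    then have "[:?A:] dvd smult (of_nat n) (pCons 0 r)"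
      unfolding that(1) by (simp add: of_nat_poly[where 'a = "'f poly"])
    then have "?A dvd of_nat n * coeff r k" for k
      unfolding const_poly_dvd_iff by (auto dest: spec[of _ "Suc k"])
    moreover have "is_unit (of_nat n :: 'f poly)"
    proof -
      have "is_unit [:of_nat n :: 'f:]"
        using of_nat_eq_0_char3[OF c, of n] that(2)
        by (simp add: is_unit_const_poly_iff dvd_field_iff del: of_nat_poly)
      then show ?thesis by (simp only: of_nat_poly)
    qed
    ultimately have "?A dvd coeff r k" for k
      by (simp add: dvd_mult_unit_iff')
    then have "[:?A:] dvd r" by (simp add: const_poly_dvd_iff)
    then show ?thesis by (auto simp: dvd_def)
  qed
  have "s \<in> semi_alg" if "\<And>i. i \<ge> n \<Longrightarrow> coeff s i = 0" "Dnil s = 0" for n and s :: "'f sym"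
    using that
  proof (induct n arbitrary: s)
    case 0
    then have "s = 0" by (simp add: poly_eq_iff)
    then show ?case using M_semi[OF M_const[OF const_alg_0]] by simp
  next
    case (Suc n)
    define r where "r = coeff s n"
    have N: "smult ?A (pderiv (coeff s l)) + of_nat (Suc l) * ([:0, 1:] * coeff s (Suc l)) = 0" for l
      using coeff_Dnil[of s l] Suc(3) by simp
    \<comment> \<open>At l = n the next coefficient of \<open>s\<close> is zero, and a can be
      cancelled.\<close>
    have r': "pderiv r = 0"
      using N[of n] Suc(2)[of "Suc n"] by (simp add: r_def)
    have "\<exists>g k m. n = 3 * m + k \<and> k < 3 \<and> pderiv g = 0 \<and> r = smult (?A ^ k) g"
    proof -
      have "\<exists>m. n = 3 * m \<or> n = 3 * m + 1 \<or> n = 3 * m + 2" by presburger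
      then consider m where "n = 3 * m" | m where "n = 3 * m + 1" | m where "n = 3 * m + 2" by blast
      then show ?thesis
      proof cases
        case (1 m)
        then show ?thesis
          using r' by (intro exI[of _ r] exI[of _ 0] exI[of _ m]) simp
      next
        case (2 m)
        have "smult ?A (pderiv (- coeff s (3 * m))) = of_nat n * ([:0, 1:] * r)"
          using N[of "3 * m"] 2 by (simp add: r_def pderiv_minus neg_eq_iff_add_eq_0)
        moreover have nd: "\<not> 3 dvd n" using 2 by presburger
        ultimately obtain g where g: "r = smult ?A g"
          using dvd by blast
        then have "pderiv g = 0" using r' by (simp add: pderiv_smult)
        then show ?thesis
          using 2 g by (intro exI[of _ g] exI[of _ 1] exI[of _ m]) simp
      next
        case (3 m)
        let ?s1 = "coeff s (3 * m + 1)" and ?s0 = "coeff s (3 * m)"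
        have eq: "smult ?A (pderiv (- ?s1)) = of_nat n * ([:0, 1:] * r)"
          using N[of "3 * m + 1"] 3 by (simp add: r_def pderiv_minus neg_eq_iff_add_eq_0)
        moreover have nd: "\<not> 3 dvd n" using 3 by presburger
        ultimately obtain g where g: "r = smult ?A g"
          using dvd by blast
        have "smult ?A (pderiv (- ?s1)) = smult ?A (of_nat n * ([:0, 1:] * g))"
          using eq g by simp
        then have s1': "pderiv (- ?s1) = of_nat n * ([:0, 1:] * g)"
          by (metis smult_cancel one_neq_zero pCons_eq_0_iff)
        \<comment> \<open>The equation one degree lower makes a divide \<open>?s1\<close> as well.
          Inserted into the relation for \<open>g\<close>, this produces the second factor a of the
          leading coefficient.\<close>
        have "smult ?A (pderiv (- ?s0)) = of_nat (3 * m + 1) * ([:0, 1:] * ?s1)"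
          using N[of "3 * m"] by (simp add: r_def pderiv_minus neg_eq_iff_add_eq_0)
        moreover have "\<not> 3 dvd 3 * m + 1" by presburger
        ultimately obtain h where h: "?s1 = smult ?A h"
          using dvd by blast
        have "smult ?A (pderiv (- h)) = of_nat n * ([:0, 1:] * g)"
          using s1' h by (simp add: pderiv_minus pderiv_smult)
        then obtain k where k: "g = smult ?A k"
          using dvd nd by blast
        have "pderiv k = 0" using r' g k by (simp add: pderiv_smult)
        then show ?thesis
          using 3 g k by (intro exI[of _ k] exI[of _ 2] exI[of _ m]) (simp add: power2_eq_square)
      qed
    qed
    then obtain g k m where n: "n = 3 * m + k" and k: "k < 3" and g: "pderiv g = 0"
      and r: "r = smult (?A ^ k) g" by blast
    define t where "t = [:g:] * vq ^ k * vc ^ (3 * m)"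
    have tM: "t \<in> semi_alg"
      unfolding t_def power_mult
      by (intro M_semi M_mult M_ab[OF g] M_pow M_q M_const const_alg.c)
    have "Dnil ([:g:] :: 'f sym) = 0"
      using g by (simp add: Dnil_def symder_def map_poly_pCons pderiv_pCons)
    moreover have "Dnil (vq ^ k :: 'f sym) = 0"
      by (simp add: derivation_power[OF derivation_Dnil] Dnil_vq[OF c])
    moreover have "Dnil (vc ^ (3 * m) :: 'f sym) = 0"
      using c by (simp add: derivation_power[OF derivation_Dnil] char3_poly)
    ultimately have tN: "Dnil t = 0"
      by (simp only: t_def Dnil_rules mult_zero_left mult_zero_right add_0_left)
    \<comment> \<open>As a polynomial in c, q is linear with leading coefficient a, so q^k has
      leading coefficient a^k.\<close>
    have vq: "vq = [:[:0, 0, 1:], [:[:0, 1:]:] :: 'f poly poly:]"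
      by (simp add: vq_def va_def vb_def vc_def power2_eq_square)
    have t_eq: "t = monom 1 (3 * m) * smult g (vq ^ k)"
      by (simp add: t_def vc_def monom_altdef mult.commute)
    have vqk: "coeff (vq ^ k) k = ([:?A ^ k:] :: 'f poly poly)" "degree (vq ^ k :: 'f sym) \<le> k"
    proof -
      show "coeff (vq ^ k) k = ([:?A ^ k:] :: 'f poly poly)"
        unfolding vq by (subst coeff_linear_poly_power) (simp_all add: poly_const_pow)
      show "degree (vq ^ k :: 'f sym) \<le> k"
        using degree_power_le[of "vq :: 'f sym" k] unfolding vq by (simp split: if_splits)
    qed
    have "coeff t n = r"
      unfolding t_eq n r by (simp add: coeff_monom_mult vqk)
    moreover have "coeff t i = 0" if "i > n" for i
      using vqk(2) that unfolding t_eq n by (auto simp: coeff_monom_mult coeff_eq_0)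
    ultimately have "coeff (s - t) i = 0" if "i \<ge> n" for i
      using Suc(2)[of i] that by (cases "i = n") (simp_all add: r_def)
    moreover have "Dnil (s - t) = 0"
      using Suc(3) tN by (simp add: derivation_diff[OF derivation_Dnil])
    ultimately have "s - t \<in> semi_alg" using Suc(1) by blast
    then show ?case using semi_alg_add[OF _ tM, of "s - t"] by simp
  qed
  from this[of "Suc (degree s)" s] s show ?thesis by (simp add: coeff_eq_0)
qed

lemma Dy_eigen_semi_alg:
  assumes "(3::'f) = 0" and "Dy s = kS k * s" shows "s \<in> (semi_alg :: 'f::field sym set)"
  using semi_alg_ker_Dnil[OF assms(1)] Dy_eigen[OF assms] by blast

text \<open>On the five summands of an element of \<open>semi_alg\<close>, E has eigenvalues 0, 1,
  2, 2, 1, because it kills \<open>const_alg\<close> and q has degree 2. As E s = 0, only the first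
  summand survives.\<close>

lemma Dy_const_alg:
  assumes c: "(3::'f) = 0" and s: "Dy s = 0" shows "s \<in> (const_alg :: 'f::field sym set)"
proof -
  have c': "(3 :: 'f sym) = 0" using c by (simp add: char3_poly)
  have "Dy s = kS 0 * s" using s by simp
  then have E: "Eul s = 0" and "s \<in> semi_alg"
    using Dy_eigen[OF c] Dy_eigen_semi_alg[OF c] by (metis kS_0 mult_zero_left)+
  then obtain s0 s1 s2 s3 s4 where
    si: "s0 \<in> const_alg" "s1 \<in> const_alg" "s2 \<in> const_alg" "s3 \<in> const_alg" "s4 \<in> const_alg"
    and eq: "s = s0 + s1 * va + s2 * va\<^sup>2 + s3 * vq + s4 * vq\<^sup>2"
    by (elim semi_algE)
  have E0: "Eul t = 0" if "t \<in> const_alg" for t :: "'f sym"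
    using that
  proof induct
    case aq
    have "Eul (va * vq) = 3 * (va * vq :: 'f sym)" by (simp add: Eul_rules)
    then show ?case using c' by simp
  qed (simp_all add: Eul_rules derivation_power[OF derivation_Eul] c')
  define p where "p = s1 * va + s4 * vq\<^sup>2"
  define q where "q = s2 * va\<^sup>2 + s3 * vq"
  have Ep: "Eul p = p"
  proof -
    have "Eul p = p + 3 * (s4 * vq\<^sup>2)"
      by (simp add: p_def Eul_rules E0 si power2_eq_square algebra_simps)
    then show ?thesis using c' by simp
  qed
  have Eq: "Eul q = 2 * q"
    by (simp add: q_def Eul_rules E0 si power2_eq_square algebra_simps)
  have "s = s0 + p + q" by (simp add: eq p_def q_def algebra_simps)
  then have "p + 2 * q = 0" using E by (simp add: Eul_rules E0 si Ep Eq)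
  \<comment> \<open>Applying E once more separates the eigenvalues 1 and 2: the two relations differ
    by 2 q, and q = 3 q - 2 q.\<close>
  moreover from this have "Eul (p + 2 * q) = 0" by (simp add: derivation_Eul)
  then have "p + 4 * q = 0" by (simp add: Eul_rules Ep Eq derivation_Eul)
  moreover have "q = 3 * q - ((p + 4 * q) - (p + 2 * q))" by simp
  ultimately have "q = 0" using c' by simp
  then have "p = 0" using \<open>p + 2 * q = 0\<close> by simp
  with \<open>q = 0\<close> si(1) show ?thesis by (simp add: eq p_def q_def algebra_simps)
qed

section \<open>The operators on \<open>S[Y]\<close>\<close>

definition MS :: "'f::field sym \<Rightarrow> 'f sym poly endo" where "MS s = mulop [:s:]"
definition DY :: "'f::field sym poly \<Rightarrow> 'f sym poly" where "DY = dext Dy 0"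
definition DX :: "'f::field sym poly \<Rightarrow> 'f sym poly" where "DX = dext Dx (2 * [:0, 1:])"
definition Th :: "'f::field sym poly endo" where "Th = mulop [:0, 1:] + Endo DY"
definition Xi :: "'f::field sym poly endo" where "Xi = Endo DX"
text \<open>The operator of a normally ordered element of U(H): coefficients from S on the left,
  powers of y on the right.\<close>

definition act :: "'f::field sym poly \<Rightarrow> 'f sym poly endo" where "act = pev MS Th"

lemma derivation_DY: "derivation DY" and derivation_DX: "derivation DX"
  by (simp_all add: DY_def DX_def derivation_dext derivation_Dy derivation_Dx)

lemma DY_gens [simp]: "DY [:s:] = [:Dy s:]" "DY [:0, 1:] = 0"
  and DX_gens [simp]: "DX [:s:] = [:Dx s:]" "DX [:0, 1:] = 2 * [:0, 1:]"
  by (simp_all only: DY_def DX_def dext_const dext_X derivation_Dy derivation_Dx)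

lemma Endo_derivation_mulop:
  "derivation d \<Longrightarrow> Endo d * mulop p = mulop p * Endo d + mulop (d p)"
  by (rule endo_eqI) (simp add: app_Endo derivation_add derivation_mult)

lemma MS_0 [simp]: "MS 0 = 0" and MS_1 [simp]: "MS 1 = 1"
  and MS_add: "MS (s + t) = MS s + MS t" and MS_mult: "MS (s * t) = MS s * MS t"
  and MS_minus: "MS (- s) = - MS s" and MS_diff: "MS (s - t) = MS s - MS t"
  by (simp_all add: MS_def mulop_add[symmetric] mulop_mult[symmetric] mulop_uminus[symmetric]
      mulop_diff[symmetric] one_pCons[symmetric] mult.commute)

lemma MS_power: "MS (s ^ n) = MS s ^ n"
  by (induct n) (simp_all add: MS_mult)

lemma additive_map_MS: "additive_map MS"
  by (simp add: additive_map_def MS_add)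

lemma MS_commute: "MS s * MS t = MS t * MS s"
  by (simp add: MS_mult[symmetric] mult.commute)

lemma MS_inj: "MS s = MS t \<longleftrightarrow> s = t"
  by (simp add: MS_def mulop_inj)

lemma Th_MS: "Th * MS s = MS s * Th + MS (Dy s)"
proof -
  have "Endo DY * MS s = MS s * Endo DY + MS (Dy s)"
    unfolding MS_def Endo_derivation_mulop[OF derivation_DY] by simp
  moreover have "mulop [:0, 1:] * MS s = MS s * mulop [:0, 1:]"
    unfolding MS_def by (rule mulop_commute)
  ultimately show ?thesis by (simp add: Th_def algebra_simps)
qed

lemma Xi_MS: "Xi * MS s = MS s * Xi + MS (Dx s)"
  unfolding MS_def Xi_def Endo_derivation_mulop[OF derivation_DX] by simp

lemma Th_MS_kS: "Th * MS (kS k) = MS (kS k) * Th"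
  and Xi_MS_kS: "Xi * MS (kS k) = MS (kS k) * Xi"
  by (simp_all add: Th_MS Xi_MS)

text \<open>The two summands of \<open>Th\<close> are treated separately: [DX, DY] = 2 DY is an
  identity of derivations, checked on S and on Y, and the multiplication by Y contributes DX Y = 2
  Y.\<close>

lemma Xi_Th:
  assumes c: "(3::'f::field) = 0" shows "Xi * Th - Th * Xi = (2 * Th :: 'f sym poly endo)"
proof -
  have "DX (DY p) - DY (DX p) = 2 * DY p" for p :: "'f sym poly"
  proof (rule derivation_poly_eqI[where \<delta> = "\<lambda>p. DX (DY p) - DY (DX p)" and \<epsilon> = "\<lambda>p. 2 * DY p"])
    show "derivation (\<lambda>p. DX (DY p) - DY (DX p) :: 'f sym poly)"
      by (rule derivation_bracket[OF derivation_DX derivation_DY])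
    show "derivation (\<lambda>p. 2 * DY p :: 'f sym poly)"
      by (simp add: derivation_def derivation_add[OF derivation_DY] derivation_mult[OF derivation_DY]
          algebra_simps)
    show "DX (DY [:s:]) - DY (DX [:s:]) = 2 * DY [:s :: 'f sym:]" for s
      using Dx_Dy[OF c, of s] by (simp add: numeral_poly)
    show "DX (DY [:0, 1:]) - DY (DX [:0, 1:]) = 2 * DY [:0, 1 :: 'f sym:]"
      by (simp only: DY_gens DX_gens derivation_mult[OF derivation_DY] derivation_0[OF derivation_DX]
          derivation_numeral[OF derivation_DY]) simp
  qed
  then have "Endo DX * Endo DY - Endo DY * Endo DX = (Endo DY + Endo DY :: 'f sym poly endo)"
    by (intro endo_eqI) (simp add: app_Endo derivation_add[OF derivation_DX]
        derivation_add[OF derivation_DY])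
  moreover have "Endo DX * mulop [:0, 1:] = mulop [:0, 1:] * Endo DX + (mulop [:0, 1:] + mulop [:0, 1:] :: 'f sym poly endo)"
    by (simp only: Endo_derivation_mulop[OF derivation_DX] DX_gens mulop_add mult_2)
  ultimately show ?thesis
    unfolding mult_2 by (simp add: Th_def Xi_def distrib_left distrib_right algebra_simps)
qed

section \<open>Normally ordered operators: faithfulness and commutation rules\<close>

lemma act_0 [simp]: "act 0 = 0"
  and act_pCons: "act (pCons r p) = MS r + act p * Th"
  and act_const [simp]: "act [:r:] = MS r"
  and act_add: "act (p + q) = act p + act q"
  and act_minus: "act (- p) = - act p"
  and act_diff: "act (p - q) = act p - act q"
  by (simp_all add: act_def pev_pCons additive_map_MS pev_add
      additive_map_minus[OF additive_map_pev[OF additive_map_MS]]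
      additive_map_diff[OF additive_map_pev[OF additive_map_MS]])

lemma Th_power_Y: "app Th ([:0, 1:] ^ k) = [:0, 1:] ^ Suc k"
  by (simp add: Th_def app_Endo derivation_add[OF derivation_DY] derivation_power[OF derivation_DY]
      del: power_Suc) simp

text \<open>\<open>Th\<close> raises the exponent of Y by one, because DY kills Y; the general
  \<open>k\<close> makes the induction work. The case k = 0 recovers \<open>p\<close> from its
  operator.\<close>

lemma app_act_power: "app (act p) ([:0, 1:] ^ k) = p * [:0, 1:] ^ k"
proof (induct p arbitrary: k)
  case (pCons r p)
  show ?case
    by (simp only: act_pCons app_simps Th_power_Y pCons(2)) (simp add: MS_def algebra_simps)
qed simp

lemma app_act_1: "app (act p) 1 = p"
  using app_act_power[of p 0] by simp

lemma act_inj: "act p = act q \<longleftrightarrow> p = q"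
  by (metis app_act_1)

lemma act_eq_0: "act p = 0 \<longleftrightarrow> p = 0"
  using act_inj[of p 0] by simp

lemma act_smult: "act (smult s p) = MS s * act p"
  by (induct p) (simp_all add: act_pCons MS_mult distrib_left mult.assoc)

lemma act_Th_power: "act (p * [:0, 1:] ^ k) = act p * Th ^ k"
proof (induct k)
  case (Suc k)
  have "p * [:0, 1:] ^ Suc k = pCons 0 (p * [:0, 1:] ^ k)" by simp
  then show ?case using Suc by (simp only: act_pCons power_Suc2) (simp add: mult.assoc)
qed simp

text \<open>\<open>Th\<close> commutes with its own powers, so the commutator differentiates the
  coefficients only.\<close>

lemma Th_act: "Th * act p - act p * Th = act (map_poly Dy p)"
proof (induct p)
  case (pCons r p)
  have "Th * (act p * Th) = (act (map_poly Dy p) + act p * Th) * Th"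
    using pCons(2) by (simp add: mult.assoc[symmetric] diff_eq_eq)
  then show ?case
    by (simp add: act_pCons map_poly_pCons derivation_Dy Th_MS distrib_left distrib_right)
qed simp

text \<open>From y a = a (y + 1).\<close>

lemma act_va: "act p * MS va = MS va * act (shift p)"
proof (induct p)
  case (pCons r p)
  have "act (pCons r p) * MS va = MS r * MS va + (act p * MS va) * (Th + 1)"
    by (simp add: act_pCons mult.assoc Th_MS distrib_left distrib_right)
  also have "\<dots> = MS va * (MS r + (act (shift p) * Th + act (shift p)))"
    by (simp only: pCons(2) MS_commute[of r va] distrib_left mult.assoc mult_1_right add.assoc)
  also have "MS r + (act (shift p) * Th + act (shift p)) = act (shift (pCons r p))"
    by (simp add: pcompose_pCons act_add act_pCons)
  finally show ?case .
qed simp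

text \<open>From y b = b (y + 1) + a, each occurrence of y contributes one correction term; together
  they form the derivative.\<close>

lemma act_vb: "act p * MS vb = MS vb * act (shift p) + MS va * act (shift (pderiv p))"
proof (induct p)
  case (pCons r p)
  have sh: "act (shift (pCons r p)) = MS r + (act (shift p) * Th + act (shift p))" for r and p :: "'a sym poly"
    by (simp add: pcompose_pCons act_add act_pCons)
  have "act (pCons r p) * MS vb = MS r * MS vb + (act p * MS vb) * (Th + 1) + act p * MS va"
    by (simp add: act_pCons mult.assoc Th_MS MS_add distrib_left distrib_right)
  also have "\<dots> = MS vb * act (shift (pCons r p)) +
     MS va * (act (shift p) + act (shift (pCons 0 (pderiv p))))"
    by (simp only: pCons(2) MS_commute[of r vb] act_va sh MS_0) (simp add: algebra_simps)
  also have "act (shift p) + act (shift (pCons 0 (pderiv p))) = act (shift (pderiv (pCons r p)))"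
    by (simp add: pderiv_pCons pcompose_add act_add)
  finally show ?case .
qed simp

text \<open>Right multiplication by a power of Y corresponds to right multiplication by the same
  power of \<open>Th\<close>, which is enough for the Horner scheme.\<close>

lemma act_pcompose_zpoly: "act (pcompose h zpoly) = pev MS (Th ^ 9 - Th ^ 3) h"
proof (induct h)
  case (pCons r h)
  have "pcompose (pCons r h) zpoly =
      [:r:] + (pcompose h zpoly * [:0, 1:] ^ 9 - pcompose h zpoly * [:0, 1:] ^ 3)"
    by (simp only: pcompose_pCons zpoly_def) (simp only: algebra_simps)
  then show ?case
    by (simp only: act_add act_diff act_Th_power act_const pCons(2) pev_pCons MS_0)
      (simp add: right_diff_distrib)
qed simp

lemma endo_char3: "(3::'f::field) = 0 \<Longrightarrow> (3 :: 'f sym poly endo) = 0"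
proof -
  assume "(3::'f) = 0"
  then have "(3 :: 'f sym poly) = 0" by (simp add: char3_poly)
  then show ?thesis using mulop_numeral[where 'a = "'f sym poly", of "num.Bit1 num.One"] by simp
qed

text \<open>In characteristic three the cube of \<open>ad t\<close> is \<open>ad (t ^ 3)\<close>;
  here it is followed along one chain of commutators.\<close>

lemma ad_cube_char3:
  fixes t :: "'a::ring_1"
  assumes c: "(3::'a) = 0" and "t * m = m * t + m1" "t * m1 = m1 * t + m2" "t * m2 = m2 * t + m3"
  shows "t ^ 3 * m = m * t ^ 3 + m3"
proof -
  have "t ^ 3 * m = t * (t * (t * m))" by (simp add: power3_eq_cube mult.assoc)
  also have "\<dots> = t * (t * (m * t + m1))" by (simp only: assms)
  also have "\<dots> = t * ((t * m) * t + t * m1)" by (simp only: distrib_left mult.assoc)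
  also have "\<dots> = t * ((m * t + m1) * t + (m1 * t + m2))" by (simp only: assms)
  also have "\<dots> = (t * m) * t * t + (t * m1) * t + (t * m1) * t + t * m2"
    by (simp only: distrib_left distrib_right mult.assoc add.assoc)
  also have "\<dots> = (m * t + m1) * t * t + (m1 * t + m2) * t + (m1 * t + m2) * t + (m2 * t + m3)"
    by (simp only: assms)
  also have "\<dots> = m * t ^ 3 + m3 + 3 * (m1 * t * t + m2 * t)"
  proof -
    have three: "3 * w = w + w + w" for w :: 'a
      using distrib_right[of 2 1 w] by (simp add: mult_2)
    show ?thesis by (simp add: three power3_eq_cube algebra_simps)
  qed
  finally show ?thesis using c by simp
qed

text \<open>The cube of \<open>Th\<close> acts on S by D^3 = E, and its ninth power by E^3 = E, so
  the two commutators cancel.\<close>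

lemma Th_central:
  assumes c: "(3::'f::field) = 0"
  shows "(Th ^ 9 - Th ^ 3) * MS s = MS (s :: 'f sym) * (Th ^ 9 - Th ^ 3)"
proof -
  have 3: "Th ^ 3 * MS s = MS s * Th ^ 3 + MS (Eul s)" for s :: "'f sym"
    using ad_cube_char3[OF endo_char3[OF c] Th_MS Th_MS Th_MS] by (simp add: Dy_cube[OF c])
  have "(Th ^ 3) ^ 3 * MS s = MS s * (Th ^ 3) ^ 3 + MS (Eul s)"
    using ad_cube_char3[OF endo_char3[OF c] 3 3 3] by (simp add: Eul_cube[OF c])
  then show ?thesis using 3[of s] by (simp add: algebra_simps)
qed

lemma commute_act:
  assumes k: "\<And>k. w * MS (kS k) = MS (kS k) * w"
    and a: "w * MS va = MS va * w" and b: "w * MS vb = MS vb * w" and c: "w * MS vc = MS vc * w"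
    and T: "w * Th = Th * w"
  shows "w * act p = act p * w"
proof -
  have S: "w * MS s = MS s * w" for s
    by (induct s rule: sym_induct)
      (simp_all only: k a b c MS_add MS_mult distrib_left distrib_right, metis mult.assoc)
  show ?thesis
  proof (induct p)
    case (pCons r p)
    have "w * (act p * Th) = act p * Th * w"
      by (metis pCons(2) T mult.assoc)
    then show ?case by (simp add: act_pCons S distrib_left distrib_right)
  qed simp
qed

section \<open>Normal form of weight vectors\<close>

lemma semi_invariant_normal_form:
  assumes c: "(3::'f::field) = 0"
    and a: "MS va * act p - act p * MS va = MS (kS \<alpha>) * act p"
    and b: "MS vb * act p - act p * MS vb = MS (kS \<beta>) * act p"
    and y: "Th * act p - act p * Th = MS (kS \<gamma>) * act p"
  obtains h :: "'f::field sym poly" where "p = pcompose h zpoly" "\<And>i. Dy (coeff h i) = kS \<gamma> * coeff h i"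
proof (cases "p = 0")
  case True
  then show ?thesis using that[of 0] derivation_0[OF derivation_Dy] by simp
next
  case False
  have va: "va \<noteq> (0 :: 'f sym)" by (simp add: va_def)
  have "act (smult va p - smult va (shift p)) = act (smult (kS \<alpha>) p)"
    using a by (simp only: act_diff act_smult act_va)
  then have a': "smult va p - smult va (shift p) = smult (kS \<alpha>) p"
    by (simp only: act_inj)
  \<comment> \<open>A shift preserves the leading coefficient, so the left side vanishes in this
    degree.\<close>
  then have "coeff (smult va p - smult va (shift p)) (degree p) = coeff (smult (kS \<alpha>) p) (degree p)"
    by simp
  then have "kS \<alpha> = 0" using False by (simp add: coeff_shift_degree)
  then have "smult va p = smult va (shift p)" using a' by simp
  then have sh: "shift p = p" using va by (metis smult_cancel)
  have "act (smult vb p - (smult vb (shift p) + smult va (shift (pderiv p)))) = act (smult (kS \<beta>) p)"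
    using b by (simp only: act_diff act_add act_smult act_vb)
  then have b': "- smult va (shift (pderiv p)) = smult (kS \<beta>) p"
    by (simp only: act_inj sh) simp
  \<comment> \<open>The shifted derivative has no term in the degree of \<open>p\<close>, which
    forces the weight at b to vanish.\<close>
  have "coeff (shift (pderiv p)) (degree p) = 0"
    by (subst coeff_shift[of "degree p"]) (simp_all add: coeff_pderiv coeff_eq_0)
  then have "coeff (smult (kS \<beta>) p) (degree p) = 0" unfolding b'[symmetric] by simp
  then have "kS \<beta> = 0" using False by simp
  then have "shift (pderiv p) = 0" using b' va by simp
  then have "pderiv p = 0" by (simp add: pcompose_eq_0)
  then obtain h where h: "p = pcompose h zpoly"
    using shift_pderiv_invariant_char3[OF char3_sym[OF c] sh] by blast
  have DYz: "DY zpoly = 0"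
    by (simp add: zpoly_def derivation_diff[OF derivation_DY] derivation_power[OF derivation_DY]
        del: power_Suc)
  have DY: "map_poly Dy q = DY q" for q :: "'f sym poly" by (simp add: DY_def dext_def)
  \<comment> \<open>As DY kills \<open>zpoly\<close>, it commutes with this composition. Since
    composition with \<open>zpoly\<close> is injective, the eigenvalue equation descends from
    \<open>p\<close> to the coefficients of \<open>h\<close>.\<close>
  have "DY (pcompose q zpoly) = pcompose (DY q) zpoly" for q :: "'f sym poly"
  proof (induct q)
    case (pCons r q)
    have "DY (pCons r q) = [:Dy r:] + pCons 0 (DY q)"
      by (simp add: DY[symmetric] map_poly_pCons derivation_Dy)
    then show ?case
      by (simp add: pcompose_pCons derivation_add[OF derivation_DY] derivation_mult[OF derivation_DY] DYz pCons)
  qed (simp add: derivation_DY)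
  moreover have "DY p = smult (kS \<gamma>) p"
    using y by (simp only: Th_act act_smult[symmetric] act_inj DY)
  ultimately have "pcompose (DY h - smult (kS \<gamma>) h) zpoly = 0"
    by (simp add: h pcompose_diff pcompose_smult)
  then have "DY h = smult (kS \<gamma>) h"
    using pcompose_eq_0[of "DY h - smult (kS \<gamma>) h" zpoly] by (simp add: degree_zpoly)
  then have "coeff (map_poly Dy h) i = coeff (smult (kS \<gamma>) h) i" for i by (simp add: DY)
  then show ?thesis using that[OF h] by (simp add: coeff_map_poly derivation_Dy)
qed

section \<open>Homomorphisms out of enveloping algebras\<close>

text \<open>Presents a type class ring as a record, so that it can be the target of homomorphisms
  from the rings \<open>free_algebra\<close> and \<open>uea\<close>.\<close>

definition type_ring :: "'r::ring_1 ring"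
  where "type_ring = \<lparr>carrier = UNIV, monoid.mult = (*), one = 1, ring.zero = 0, add = (+)\<rparr>"

lemma type_ring_simps [simp]:
  "carrier (type_ring :: 'r::ring_1 ring) = UNIV" "monoid.mult (type_ring :: 'r ring) = (*)"
  "one (type_ring :: 'r ring) = 1" "ring.zero (type_ring :: 'r ring) = 0"
  "add (type_ring :: 'r ring) = (+)"
  by (simp_all add: type_ring_def)

lemma ring_type_ring: "ring (type_ring :: 'r::ring_1 ring)"
proof (rule ringI)
  show "abelian_group (type_ring :: 'r ring)"
  proof (rule abelian_groupI)
    fix x :: 'r assume "x \<in> carrier type_ring"
    show "\<exists>y\<in>carrier type_ring. y \<oplus>\<^bsub>type_ring\<^esub> x = \<zero>\<^bsub>type_ring\<^esub>"
      by (intro bexI[of _ "- x"]) simp_all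
  qed (simp_all add: algebra_simps)
  show "monoid (type_ring :: 'r ring)"
    by (rule monoidI) (simp_all add: algebra_simps)
qed (simp_all add: algebra_simps)

lemma type_ring_a_inv: "\<ominus>\<^bsub>type_ring\<^esub> p = - (p :: 'r::ring_1)"
proof (rule abelian_group.minus_equality[OF ring.is_abelian_group[OF ring_type_ring]])
  show "- p \<oplus>\<^bsub>type_ring\<^esub> p = \<zero>\<^bsub>type_ring\<^esub>" by simp
qed simp_all

lemma free_algebra_simps [simp]:
  "monoid.mult (free_algebra G) = (*)" "one (free_algebra G) = 1"
  "ring.zero (free_algebra G) = 0" "add (free_algebra G) = (+)"
  by (simp_all add: free_algebra_def)

lemma mem_free_algebra:
  "p \<in> carrier (free_algebra G) \<longleftrightarrow> (\<forall>w\<in>Poly_Mapping.keys p. set (letters w) \<subseteq> G)"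
  by (simp add: free_algebra_def)

lemma free_algebra_closed:
  fixes p q :: "('l, 'f::field) falg"
  shows "(0 :: ('l, 'f) falg) \<in> carrier (free_algebra G)"
    and "(1 :: ('l, 'f) falg) \<in> carrier (free_algebra G)"
    and "p \<in> carrier (free_algebra G) \<Longrightarrow> - p \<in> carrier (free_algebra G)"
    and "p \<in> carrier (free_algebra G) \<Longrightarrow> q \<in> carrier (free_algebra G) \<Longrightarrow> p + q \<in> carrier (free_algebra G)"
    and "p \<in> carrier (free_algebra G) \<Longrightarrow> q \<in> carrier (free_algebra G) \<Longrightarrow> p - q \<in> carrier (free_algebra G)"
    and "p \<in> carrier (free_algebra G) \<Longrightarrow> q \<in> carrier (free_algebra G) \<Longrightarrow> p * q \<in> carrier (free_algebra G)"
    and "falg_const c \<in> carrier (free_algebra G)"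
    and "a \<in> G \<Longrightarrow> (falg_gen a :: ('l, 'f) falg) \<in> carrier (free_algebra G)"
proof -
  show "p - q \<in> carrier (free_algebra G)"
    if "p \<in> carrier (free_algebra G)" "q \<in> carrier (free_algebra G)"
    using that keys_diff[of p q] by (auto simp: mem_free_algebra)
  show "p + q \<in> carrier (free_algebra G)"
    if "p \<in> carrier (free_algebra G)" "q \<in> carrier (free_algebra G)"
    using that Poly_Mapping.keys_add[of p q] by (auto simp: mem_free_algebra)
  show "p * q \<in> carrier (free_algebra G)"
    if "p \<in> carrier (free_algebra G)" "q \<in> carrier (free_algebra G)"
    using that keys_mult[of p q] by (fastforce simp: mem_free_algebra plus_fmon_def)
  show "(1 :: ('l, 'f) falg) \<in> carrier (free_algebra G)"
    by (simp add: mem_free_algebra zero_fmon_def)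
qed (auto simp: mem_free_algebra falg_const_def falg_gen_def zero_fmon_def)

lemma ring_free_algebra: "ring (free_algebra G :: ('l, 'f::field) falg ring)"
proof (rule ringI)
  show "abelian_group (free_algebra G :: ('l, 'f) falg ring)"
  proof (rule abelian_groupI)
    fix x :: "('l, 'f) falg" assume "x \<in> carrier (free_algebra G)"
    then show "\<exists>y\<in>carrier (free_algebra G). y \<oplus>\<^bsub>free_algebra G\<^esub> x = \<zero>\<^bsub>free_algebra G\<^esub>"
      by (intro bexI[of _ "- x"]) (simp_all add: free_algebra_closed)
  qed (simp_all add: free_algebra_closed algebra_simps)
  show "monoid (free_algebra G :: ('l, 'f) falg ring)"
    by (rule monoidI) (simp_all add: free_algebra_closed algebra_simps)
qed (simp_all add: algebra_simps)

lemma falg_const_1 [simp]: "falg_const 1 = 1"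
  and falg_const_0 [simp]: "falg_const 0 = 0"
  and falg_const_add: "falg_const (a + b) = falg_const a + falg_const b"
  and falg_const_mult: "falg_const (a * b) = falg_const a * falg_const b"
  by (simp_all add: falg_const_def single_add mult_single)

lemma falg_single_decomp:
  "Poly_Mapping.single w c = falg_const c * Poly_Mapping.single w 1"
  by (simp add: falg_const_def mult_single)

lemma falg_single_Cons:
  "Poly_Mapping.single (FMon (a # l)) 1 = falg_gen a * Poly_Mapping.single (FMon l) 1"
  by (simp add: falg_gen_def mult_single plus_fmon_def)

lemma falg_single_Nil: "Poly_Mapping.single (FMon []) 1 = (1 :: ('l, 'f::field) falg)"
  by (simp add: zero_fmon_def[symmetric])

lemma falg_sum_singles:
  "p = (\<Sum>w\<in>Poly_Mapping.keys p. Poly_Mapping.single w (Poly_Mapping.lookup p w))"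
  by (rule poly_mapping_eqI) (auto simp: lookup_sum lookup_single when_def in_keys_iff sum.delta' if_distrib)

lemma falg_const_central: "falg_const c * p = p * falg_const (c :: 'f::field)"
  for p :: "('l, 'f::field) falg"
proof -
  have 1: "falg_const c * Poly_Mapping.single w d = Poly_Mapping.single w d * falg_const c" for w :: "'l fmon" and d
    by (simp add: falg_const_def mult_single mult.commute)
  then have "falg_const c * (\<Sum>w\<in>A. Poly_Mapping.single w (f w)) =
      (\<Sum>w\<in>A. Poly_Mapping.single w (f w)) * falg_const c" for A and f :: "'l fmon \<Rightarrow> 'f"
    by (simp only: sum_distrib_left sum_distrib_right)
  from this[where A = "Poly_Mapping.keys p" and f = "Poly_Mapping.lookup p"]
  show ?thesis by (simp only: falg_sum_singles[symmetric])
qed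

text \<open>Words grow by prepending letters, so only left multiplication by a letter has to be
  treated.\<close>

lemma free_algebra_induct [consumes 1, case_names const gen add mult]:
  fixes p :: "('l, 'f::field) falg"
  assumes p: "p \<in> carrier (free_algebra G)"
    and const: "\<And>c. P (falg_const c)"
    and gen: "\<And>a q. a \<in> G \<Longrightarrow> q \<in> carrier (free_algebra G) \<Longrightarrow> P q \<Longrightarrow> P (falg_gen a * q)"
    and add: "\<And>q r. q \<in> carrier (free_algebra G) \<Longrightarrow> r \<in> carrier (free_algebra G)
      \<Longrightarrow> P q \<Longrightarrow> P r \<Longrightarrow> P (q + r)"
    and mult: "\<And>c q. q \<in> carrier (free_algebra G) \<Longrightarrow> P q \<Longrightarrow> P (falg_const c * q)"
  shows "P p"
proof -
  have word: "(Poly_Mapping.single (FMon l) 1 :: ('l, 'f) falg) \<in> carrier (free_algebra G) \<and> P (Poly_Mapping.single (FMon l) 1)"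
    if "set l \<subseteq> G" for l
    using that
  proof (induct l)
    case Nil
    show ?case
      using const[of 1] by (simp only: falg_single_Nil falg_const_1 free_algebra_closed simp_thms)
  next
    case (Cons a l)
    then have l: "(Poly_Mapping.single (FMon l) 1 :: ('l, 'f) falg) \<in> carrier (free_algebra G)"
      "P (Poly_Mapping.single (FMon l) 1)" and a: "a \<in> G" by simp_all
    show ?case
      using gen[OF a l] l(1) a by (simp add: falg_single_Cons free_algebra_closed)
  qed
  have "(\<Sum>w\<in>A. Poly_Mapping.single w (Poly_Mapping.lookup p w)) \<in> carrier (free_algebra G)
    \<and> P (\<Sum>w\<in>A. Poly_Mapping.single w (Poly_Mapping.lookup p w))"
    if "finite A" "A \<subseteq> Poly_Mapping.keys p" for A
    using that
  proof induct
    case empty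
    show ?case using const[of 0] by (simp add: free_algebra_closed)
  next
    case (insert w A)
    have "set (letters w) \<subseteq> G" using p insert(4) by (auto simp: mem_free_algebra)
    then have "(Poly_Mapping.single w 1 :: ('l, 'f) falg) \<in> carrier (free_algebra G)" "P (Poly_Mapping.single w 1)"
      using word[of "letters w"] by simp_all
    then have "Poly_Mapping.single w (Poly_Mapping.lookup p w) \<in> carrier (free_algebra G)"
      "P (Poly_Mapping.single w (Poly_Mapping.lookup p w))"
      by (simp_all only: falg_single_decomp[of w "Poly_Mapping.lookup p w"] free_algebra_closed mult)
    with insert show ?case by (simp add: free_algebra_closed add)
  qed
  from this[of "Poly_Mapping.keys p"] show ?thesis
    using falg_sum_singles[of p] by simp
qed

definition falg_eval :: "('f::field \<Rightarrow> 'r::ring_1) \<Rightarrow> ('l \<Rightarrow> 'r) \<Rightarrow> ('l, 'f) falg \<Rightarrow> 'r"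
  where "falg_eval k g p =
    (\<Sum>w\<in>Poly_Mapping.keys p. k (Poly_Mapping.lookup p w) * prod_list (map g (letters w)))"

text \<open>Data for the universal property of the free algebra. The scalars are mapped by
  \<open>k\<close>; their commuting with the images of the letters makes the extension
  multiplicative.\<close>

locale falg_hom =
  fixes k :: "'f::field \<Rightarrow> 'r::ring_1" and g :: "'l \<Rightarrow> 'r"
  assumes k_add: "k (c + d) = k c + k d" and k_mult: "k (c * d) = k c * k d" and k_1: "k 1 = 1"
    and k_central: "k c * g a = g a * k c"
begin

abbreviation ev :: "('l, 'f) falg \<Rightarrow> 'r" where "ev \<equiv> falg_eval k g"

lemma k_0 [simp]: "k 0 = 0"
  using k_add[of 0 0] by simp

lemma ev_superset:
  assumes "finite A" "Poly_Mapping.keys p \<subseteq> A"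
  shows "ev p = (\<Sum>w\<in>A. k (Poly_Mapping.lookup p w) * prod_list (map g (letters w)))"
  unfolding falg_eval_def
  by (rule sum.mono_neutral_left) (use assms in \<open>auto simp: in_keys_iff\<close>)

lemma ev_add: "ev (p + q) = ev p + ev q"
proof -
  let ?A = "Poly_Mapping.keys p \<union> Poly_Mapping.keys q"
  have "finite ?A" by simp
  moreover have "Poly_Mapping.keys (p + q) \<subseteq> ?A" by (rule Poly_Mapping.keys_add)
  ultimately show ?thesis
    using ev_superset[of ?A p] ev_superset[of ?A q] ev_superset[of ?A "p + q"]
    by (simp add: lookup_add k_add distrib_right sum.distrib)
qed

lemma ev_0 [simp]: "ev 0 = 0"
  by (simp add: falg_eval_def)

lemma ev_minus: "ev (- p) = - ev p"
  using ev_add[of p "- p"] by (simp add: eq_neg_iff_add_eq_0 add.commute)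

lemma ev_diff: "ev (p - q) = ev p - ev q"
  using ev_add[of p "- q"] by (simp add: ev_minus)

lemma ev_sum: "ev (\<Sum>i\<in>A. f i) = (\<Sum>i\<in>A. ev (f i))"
  by (induct A rule: infinite_finite_induct) (simp_all add: ev_add)

lemma ev_single: "ev (Poly_Mapping.single w c) = k c * prod_list (map g (letters w))"
  by (simp add: falg_eval_def)

lemma ev_const [simp]: "ev (falg_const c) = k c"
  by (simp add: falg_const_def ev_single zero_fmon_def)

lemma ev_gen [simp]: "ev (falg_gen a) = g a"
  by (simp add: falg_gen_def ev_single k_1)

lemma ev_1 [simp]: "ev 1 = 1"
  using ev_const[of 1] k_1 by simp

lemma ev_mult: "ev (p * q) = ev p * ev q"
proof -
  have c: "k c * prod_list (map g l) = prod_list (map g l) * k c" for c l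
    by (induct l) (simp, metis k_central mult.assoc list.simps(9) prod_list.Cons)
  have "ev (Poly_Mapping.single v c * Poly_Mapping.single w d) =
      ev (Poly_Mapping.single v c) * ev (Poly_Mapping.single w d)" for v w c d
  proof -
    have "ev (Poly_Mapping.single v c * Poly_Mapping.single w d) =
        k c * ((k d * prod_list (map g (letters v))) * prod_list (map g (letters w)))"
      by (simp add: mult_single ev_single plus_fmon_def k_mult mult.assoc)
    then show ?thesis by (simp only: c[of d] ev_single mult.assoc)
  qed
  then have "ev ((\<Sum>v\<in>A. Poly_Mapping.single v (f v)) * (\<Sum>w\<in>B. Poly_Mapping.single w (h w))) =
      ev (\<Sum>v\<in>A. Poly_Mapping.single v (f v)) * ev (\<Sum>w\<in>B. Poly_Mapping.single w (h w))"
    for A B f h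
    by (simp only: sum_product ev_sum)
  from this[where A = "Poly_Mapping.keys p" and f = "Poly_Mapping.lookup p"
      and B = "Poly_Mapping.keys q" and h = "Poly_Mapping.lookup q"]
  show ?thesis by (simp only: falg_sum_singles[symmetric])
qed

lemma ev_pev: "ev (pev h t p) = pev (\<lambda>c. ev (h c)) (ev t) p" if "h 0 = 0"
  using that by (induct p) (simp_all add: pev_pCons ev_add ev_mult)

lemma ring_hom_ev: "ring_hom_ring (free_algebra G) type_ring ev"
  by (rule ring_hom_ringI[OF ring_free_algebra ring_type_ring]) (simp_all add: ev_add ev_mult)

end

text \<open>As \<open>I\<close> lies in the kernel, \<open>h\<close> is constant on every coset, and
  \<open>the_elem\<close> reads off the common value.\<close>

lemma quotient_induced_hom:
  fixes R (structure)
  assumes I: "ideal I R" and h: "ring_hom_ring R S h" and k: "I \<subseteq> a_kernel R S h"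
  shows "(\<lambda>X. the_elem (h ` X)) \<in> ring_hom (R Quot I) S"
    and "p \<in> carrier R \<Longrightarrow> the_elem (h ` (I +> p)) = h p"
proof -
  interpret I: ideal I R by fact
  interpret h: ring_hom_ring R S h by fact
  have coset: "the_elem (h ` (I +> p)) = h p" if p: "p \<in> carrier R" for p
  proof -
    have "h q = h p" if q: "q \<in> I +> p" for q
    proof -
      obtain i where i: "i \<in> I" "q = i \<oplus> p" using q by (auto simp: a_r_coset_def')
      have "i \<in> {r \<in> carrier R. h r = \<zero>\<^bsub>S\<^esub>}"
        using i(1) k unfolding a_kernel_def' by (rule rev_subsetD)
      then have i': "h i = \<zero>\<^bsub>S\<^esub>" "i \<in> carrier R" by blast+
      have "h q = h i \<oplus>\<^bsub>S\<^esub> h p" unfolding i(2) using i'(2) p by (rule h.hom_add)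
      then show ?thesis using p by (simp add: i'(1))
    qed
    moreover have "p \<in> I +> p" using p I.a_rcos_self by blast
    ultimately have "h ` (I +> p) = {h p}" by blast
    then show ?thesis by simp
  qed
  then show "p \<in> carrier R \<Longrightarrow> the_elem (h ` (I +> p)) = h p" .
  have mem: "\<exists>p\<in>carrier R. X = I +> p" if "X \<in> carrier (R Quot I)" for X
    using that by (auto simp: FactRing_def A_RCOSETS_def')
  note rh = ring_hom_memE[OF I.rcos_ring_hom]
  show "(\<lambda>X. the_elem (h ` X)) \<in> ring_hom (R Quot I) S"
  proof (rule ring_hom_memI)
    fix X Y assume "X \<in> carrier (R Quot I)" "Y \<in> carrier (R Quot I)"
    then obtain p q where p: "p \<in> carrier R" "X = I +> p" and q: "q \<in> carrier R" "Y = I +> q"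
      using mem by metis
    show "the_elem (h ` (X \<otimes>\<^bsub>R Quot I\<^esub> Y)) = the_elem (h ` X) \<otimes>\<^bsub>S\<^esub> the_elem (h ` Y)"
      using p q coset by (simp add: rh(2)[symmetric])
    show "the_elem (h ` (X \<oplus>\<^bsub>R Quot I\<^esub> Y)) = the_elem (h ` X) \<oplus>\<^bsub>S\<^esub> the_elem (h ` Y)"
      using p q coset by (simp add: rh(3)[symmetric])
  next
    show "the_elem (h ` \<one>\<^bsub>R Quot I\<^esub>) = \<one>\<^bsub>S\<^esub>"
      using coset[OF I.one_closed] by (simp add: FactRing_def)
  qed (use mem coset in force)
qed

section \<open>Normal forms modulo an ideal\<close>

text \<open>A two-sided ideal of a subring, stated with the type class operations so that
  congruences can be chained as calculations.\<close>

locale ring_cong =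
  fixes A I :: "'r::ring_1 set"
  assumes A_1: "1 \<in> A" and A_diff: "p \<in> A \<Longrightarrow> q \<in> A \<Longrightarrow> p - q \<in> A"
    and A_mult: "p \<in> A \<Longrightarrow> q \<in> A \<Longrightarrow> p * q \<in> A"
    and I_A: "I \<subseteq> A" and I_0: "0 \<in> I" and I_diff: "i \<in> I \<Longrightarrow> j \<in> I \<Longrightarrow> i - j \<in> I"
    and I_l: "p \<in> A \<Longrightarrow> i \<in> I \<Longrightarrow> p * i \<in> I" and I_r: "i \<in> I \<Longrightarrow> p \<in> A \<Longrightarrow> i * p \<in> I"
begin

definition cg :: "'r \<Rightarrow> 'r \<Rightarrow> bool" (infix "\<approx>" 50)
  where "p \<approx> q \<longleftrightarrow> p \<in> A \<and> q \<in> A \<and> p - q \<in> I"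

lemma A_0: "0 \<in> A" using A_diff[OF A_1 A_1] by simp
lemma A_minus: "p \<in> A \<Longrightarrow> - p \<in> A" using A_diff[OF A_0] by force
lemma A_add: "p \<in> A \<Longrightarrow> q \<in> A \<Longrightarrow> p + q \<in> A" using A_diff[OF _ A_minus] by force
lemma I_minus: "p \<in> I \<Longrightarrow> - p \<in> I" using I_diff[OF I_0] by force
lemma I_add: "p \<in> I \<Longrightarrow> q \<in> I \<Longrightarrow> p + q \<in> I" using I_diff[OF _ I_minus] by force

lemma cg_refl: "p \<in> A \<Longrightarrow> p \<approx> p"
  by (simp add: cg_def I_0)

lemma cg_sym: "p \<approx> q \<Longrightarrow> q \<approx> p"
  using I_minus[of "p - q"] by (simp add: cg_def)

lemma cg_trans [trans]: "p \<approx> q \<Longrightarrow> q \<approx> r \<Longrightarrow> p \<approx> r"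
  using I_add[of "p - q" "q - r"] by (simp add: cg_def)

lemma cg_add: "p \<approx> q \<Longrightarrow> p' \<approx> q' \<Longrightarrow> p + p' \<approx> q + q'"
  using I_add[of "p - q" "p' - q'"] by (simp add: cg_def A_add algebra_simps)

lemma cg_mult: "p \<approx> q \<Longrightarrow> p' \<approx> q' \<Longrightarrow> p * p' \<approx> q * q'"
  using I_add[OF I_r[of "p - q" p'] I_l[of q "p' - q'"]] by (simp add: cg_def A_mult algebra_simps)

lemma cg_mult_left: "p \<in> A \<Longrightarrow> q \<approx> r \<Longrightarrow> p * q \<approx> p * r"
  by (simp add: cg_mult cg_refl)

lemma cg_mult_right: "q \<approx> r \<Longrightarrow> p \<in> A \<Longrightarrow> q * p \<approx> r * p"
  by (simp add: cg_mult cg_refl)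

lemma pev_closed:
  assumes "additive_map g" "\<And>c. g c \<in> A" "t \<in> A" shows "pev g t p \<in> A"
  by (induct p) (simp_all add: pev_pCons assms A_0 A_add A_mult)

lemma pev_commute:
  assumes g: "additive_map g" "\<And>c. g c * w \<approx> w * g c" and gA: "\<And>c. g c \<in> A"
    and t: "t * w \<approx> w * t" and tA: "t \<in> A" and wA: "w \<in> A"
  shows "pev g t p * w \<approx> w * pev g t p"
proof (induct p)
  case 0
  show ?case using cg_refl[OF A_0] by simp
next
  case (pCons c p)
  note P = pev_closed[OF g(1) gA tA, of p]
  have "pev g t p * (t * w) \<approx> pev g t p * (w * t)"
    by (rule cg_mult_left[OF P t])
  also have "pev g t p * (w * t) = (pev g t p * w) * t" by (simp add: mult.assoc)
  also have "\<dots> \<approx> (w * pev g t p) * t" by (rule cg_mult_right[OF pCons(2) tA])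
  finally have "g c * w + pev g t p * (t * w) \<approx> w * g c + w * pev g t p * t"
    by (rule cg_add[OF g(2)])
  then show ?case by (simp add: pev_pCons g(1) algebra_simps)
qed

text \<open>Coefficients stay on the left of \<open>t\<close>, so this covers the letter y, which
  does not commute with them.\<close>

lemma pev_smult:
  assumes g: "additive_map g" "\<And>r s. g (r * s) \<approx> g r * g s" and gA: "\<And>c. g c \<in> A" and tA: "t \<in> A"
  shows "pev g t (smult r p) \<approx> g r * pev g t p"
proof (induct p)
  case 0
  show ?case using cg_refl[OF A_0] by simp
next
  case (pCons c p)
  have "g (r * c) + pev g t (smult r p) * t \<approx> g r * g c + (g r * pev g t p) * t"
    by (rule cg_add[OF g(2) cg_mult_right[OF pCons(2) tA]])
  then show ?case by (simp add: pev_pCons g(1) algebra_simps)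
qed

text \<open>Once \<open>t\<close> commutes with the coefficients modulo the ideal, evaluation is
  multiplicative. This serves the commuting letters a, b and c in turn.\<close>

lemma pev_mult:
  assumes g: "additive_map g" "\<And>r s. g (r * s) \<approx> g r * g s" and gA: "\<And>c. g c \<in> A" and tA: "t \<in> A"
    and c: "\<And>r. g r * t \<approx> t * g r"
  shows "pev g t (p * q) \<approx> pev g t p * pev g t q"
proof (induct p)
  case 0
  show ?case using cg_refl[OF A_0] by simp
next
  case (pCons r p)
  note P = pev_closed[OF g(1) gA tA]
  have "pev g t (p * q) * t \<approx> (pev g t p * pev g t q) * t"
    by (rule cg_mult_right[OF pCons(2) tA])
  also have "(pev g t p * pev g t q) * t = pev g t p * (pev g t q * t)" by (simp add: mult.assoc)
  also have "\<dots> \<approx> pev g t p * (t * pev g t q)"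
    by (rule cg_mult_left[OF P pev_commute[OF g(1) c gA cg_refl[OF A_mult[OF tA tA]] tA tA]])
  finally have "pev g t (smult r q) + pev g t (p * q) * t \<approx>
      g r * pev g t q + pev g t p * (t * pev g t q)"
    by (rule cg_add[OF pev_smult[OF g gA tA]])
  then show ?case by (simp add: pev_add[OF g(1)] pev_pCons g(1) algebra_simps)
qed

end

section \<open>The Lie algebra \<open>L\<close> and its action on \<open>S[Y]\<close>\<close>

abbreviation Cst :: "'f::field \<Rightarrow> 'f sym poly endo" where "Cst k \<equiv> MS (kS k)"

locale lie_ext = lie_algebra s br
  for s :: "'f::field \<Rightarrow> 'l::ab_group_add \<Rightarrow> 'l" and br +
  fixes x y e1 e2 e3 :: 'l
  assumes char3: "(3::'f) = 0"
    and dist: "distinct [x, y, e1, e2, e3]"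
    and indep: "independent {x, y, e1, e2, e3}"
    and span_UNIV: "span {x, y, e1, e2, e3} = UNIV"
    and br_x: "br x e1 = 0" "br x e2 = e2" "br x e3 = s 2 e3"
    and br_y: "br y e1 = e3" "br y e2 = e1" "br y e3 = e2"
    and br_xy: "br x y = s 2 y"
    and br_e: "br e1 e2 = 0" "br e1 e3 = 0" "br e2 e3 = 0"
begin

lemma br_0 [simp]: "br 0 a = 0" "br a 0 = 0"
  using br_add_left[of 0 0 a] br_add_right[of a 0 0] by simp_all

lemma br_anti: "br b a = - br a b"
  using br_self[of "a + b"] unfolding br_add_left br_add_right
  by (simp add: br_self[of a] br_self[of b] eq_neg_iff_add_eq_0 add.commute)

lemma br_minus: "br (- a) b = - br a b" "br a (- b) = - br a b"
  using br_add_left[of a "- a" b] br_add_right[of a b "- b"]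
  by (simp_all add: eq_neg_iff_add_eq_0 add.commute)

text \<open>Linear extension from the basis. Solving a = e1 + e2 + e3, b = e2 + 2 e3, c = e3 in
  characteristic three gives e2 = b + c and e1 = a - b + c.\<close>

lemma ex_op:
  "\<exists>f :: 'l \<Rightarrow> 'f sym poly endo. (\<forall>a b. f (a + b) = f a + f b) \<and> (\<forall>k a. f (s k a) = Cst k * f a) \<and>
    f x = Xi \<and> f y = Th \<and> f e1 = MS (va - vb + vc) \<and> f e2 = MS (vb + vc) \<and> f e3 = MS vc"
proof -
  interpret V: vector_space_pair s "\<lambda>k w. Cst k * (w :: 'f sym poly endo)"
    by (intro vector_space_pair.intro vector_space_axioms, unfold_locales)
      (simp_all add: kS_add MS_add kS_mult MS_mult algebra_simps)
  define b where "b v = (if v = x then Xi else if v = y then Th else if v = e1 then MS (va - vb + vc)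
    else if v = e2 then MS (vb + vc) else MS (vc :: 'f sym))" for v
  obtain f where f: "Vector_Spaces.linear s (\<lambda>k w. Cst k * w) f"
    and fb: "\<And>v. v \<in> {x, y, e1, e2, e3} \<Longrightarrow> f v = b v"
    using V.linear_independent_extend[OF indep] by metis
  interpret f: Vector_Spaces.linear s "\<lambda>k w. Cst k * w" f by fact
  show ?thesis
    using fb dist by (intro exI[of _ f]) (auto simp: f.add f.scale b_def)
qed

definition op :: "'l \<Rightarrow> 'f sym poly endo"
  where "op = (SOME f. (\<forall>a b. f (a + b) = f a + f b) \<and> (\<forall>k a. f (s k a) = Cst k * f a) \<and>
    f x = Xi \<and> f y = Th \<and> f e1 = MS (va - vb + vc) \<and> f e2 = MS (vb + vc) \<and> f e3 = MS vc)"

lemma op_add: "op (a + b) = op a + op b" and op_scale: "op (s k a) = Cst k * op a"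
  and op_basis: "op x = Xi" "op y = Th" "op e1 = MS (va - vb + vc)" "op e2 = MS (vb + vc)" "op e3 = MS vc"
  using someI_ex[OF ex_op] unfolding op_def[symmetric] by blast+

lemma op_0 [simp]: "op 0 = 0"
  using op_add[of 0 0] by simp

lemma op_minus: "op (- a) = - op a"
  using op_add[of a "- a"] by (simp add: eq_neg_iff_add_eq_0 add.commute)

lemma op_central: "Cst k * op a = op a * Cst k"
proof -
  have "a \<in> span {x, y, e1, e2, e3}" using span_UNIV by simp
  then show ?thesis
  proof (induct rule: span_induct_alt)
    case (step c v w)
    have "Cst k * op v = op v * Cst k"
      using step(1) by (auto simp: op_basis MS_commute Th_MS_kS Xi_MS_kS)
    then have "Cst k * (Cst c * op v) = Cst c * op v * Cst k"
      by (metis MS_commute mult.assoc)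
    with step(2) show ?case by (simp add: op_add op_scale distrib_left distrib_right)
  qed simp
qed

text \<open>The defect \<open>F\<close> is bilinear and alternating, so it suffices that it vanishes
  on pairs of basis vectors; there the rules for \<open>Th\<close>, \<open>Xi\<close> and
  \<open>MS\<close> apply.\<close>

lemma op_br: "op (br a b) = op a * op b - op b * op a"
proof -
  let ?B = "{x, y, e1, e2, e3}"
  define F where "F a b = op (br a b) - (op a * op b - op b * op a)" for a b
  have F_anti: "F b a = - F a b" for a b
    by (simp add: F_def br_anti[of a b] op_minus)
  have F_self: "F a a = 0" for a
    by (simp add: F_def br_self)
  have F_add: "F (a + a') b = F a b + F a' b" for a a' b
    by (simp add: F_def br_add_left op_add algebra_simps)
  have F_scale: "F (s k a) b = Cst k * F a b" for k a b
  proof -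
    have "op b * (Cst k * op a) = Cst k * (op b * op a)"
      by (simp only: mult.assoc[symmetric] op_central[of k b])
    then show ?thesis by (simp add: F_def br_scale_left op_scale right_diff_distrib mult.assoc)
  qed
  have F_0: "F 0 b = 0" for b by (simp add: F_def)
  have span: "F a b = 0" if "\<And>v. v \<in> ?B \<Longrightarrow> F v b = 0" for a b
  proof -
    have "a \<in> span ?B" using span_UNIV by simp
    then show ?thesis
      by (induct rule: span_induct_alt) (simp_all only: F_0 F_add F_scale that mult_zero_right add_0)
  qed
  have three: "(3::'f sym) = 0" by (rule char3_sym[OF char3])
  have c2: "Cst 2 * w = w + w" for w :: "'f sym poly endo"
  proof -
    have "Cst (2::'f) = Cst (1 + 1)" by simp
    also have "\<dots> = 1 + 1" by (simp only: kS_add MS_add kS_1 MS_1)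
    finally show ?thesis by (simp only: distrib_right mult_1_left)
  qed
  have z3: "w + w + w = 0" for w :: "'f sym"
    using char3_add[OF three, of w] by simp
  have xy: "F x y = 0"
    using Xi_Th[OF char3] by (simp add: F_def br_xy op_scale op_basis c2 mult_2)
  have e: "F e1 e2 = 0" "F e1 e3 = 0" "F e2 e3 = 0"
    by (simp_all add: F_def br_e op_basis MS_commute)
  have yF: "F y v = op (br y v) - MS (Dy w)" if "op v = MS w" for v w
    by (simp add: F_def op_basis that Th_MS)
  have xF: "F x v = op (br x v) - MS (Dx w)" if "op v = MS w" for v w
    by (simp add: F_def op_basis that Xi_MS)
  have ye: "F y e1 = 0" "F y e2 = 0" "F y e3 = 0"
  proof -
    show "F y e1 = 0"
      unfolding yF[OF op_basis(3)] by (simp add: br_y op_basis Dy_rules)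
    have "Dy (vb + vc) = va - vb + (vc :: 'f sym) + (vb + vb + vb)"
      by (simp add: Dy_rules)
    then show "F y e2 = 0"
      unfolding yF[OF op_basis(4)] z3 by (simp add: br_y op_basis)
    show "F y e3 = 0"
      unfolding yF[OF op_basis(5)] by (simp add: br_y op_basis Dy_rules add.commute)
  qed
  have xe: "F x e1 = 0" "F x e2 = 0" "F x e3 = 0"
  proof -
    show "F x e1 = 0"
      unfolding xF[OF op_basis(3)] by (simp add: br_x op_basis Dx_rules)
    have "Dx (vb + vc) = vb + vc - (vc + vc + vc :: 'f sym)"
      by (simp add: Dx_rules)
    then show "F x e2 = 0"
      unfolding xF[OF op_basis(4)] z3 by (simp add: br_x op_basis)
    have Dc: "Dx vc = vc + (vc :: 'f sym)" by (simp add: char3_add[OF three])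
    show "F x e3 = 0"
      unfolding xF[OF op_basis(5)] Dc by (simp only: br_x op_scale op_basis c2 MS_add diff_self)
  qed
  have "F a b = 0" if a: "a \<in> ?B" and b: "b \<in> ?B" for a b
    using a b xy e ye xe F_self F_anti[of x y] F_anti[of e1 e2] F_anti[of e1 e3] F_anti[of e2 e3]
      F_anti[of y e1] F_anti[of y e2] F_anti[of y e3] F_anti[of x e1] F_anti[of x e2] F_anti[of x e3]
    by auto
  \<comment> \<open>Antisymmetry exchanges the arguments, so \<open>span\<close> extends the second
    argument first and then the other one.\<close>
  then have "F a b = 0" if "a \<in> ?B" for a b
    using span[of a b] F_anti span[of b a] that by (metis neg_0_equal_iff_equal)
  then have "F a b = 0" using span by blast
  then show ?thesis by (simp add: F_def)
qed

end

sublocale lie_ext \<subseteq> ev: falg_hom Cst op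
  by unfold_locales (simp_all add: kS_add MS_add kS_mult MS_mult op_central)

context lie_ext
begin

section \<open>The representation of the enveloping algebras on S[Y]\<close>

abbreviation rho :: "('l, 'f) falg \<Rightarrow> 'f sym poly endo" where "rho \<equiv> falg_eval Cst op"

text \<open>Treats U(H) and U(L) uniformly; it is applied to \<open>H\<close> and to
  \<open>UNIV\<close>.\<close>

definition subalgebra :: "'l set \<Rightarrow> bool"
  where "subalgebra G \<longleftrightarrow> subspace G \<and> (\<forall>a\<in>G. \<forall>b\<in>G. br a b \<in> G)"

lemma relations_closed:
  assumes "subalgebra G" shows "uea_relations s br G \<subseteq> carrier (free_algebra G)"
  using assms unfolding uea_relations_def subalgebra_def
  by (auto intro!: free_algebra_closed subspace_add subspace_scale)

lemma ideal_uea_ideal: "subalgebra G \<Longrightarrow> ideal (uea_ideal s br G) (free_algebra G)"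
  unfolding uea_ideal_def by (rule ring.genideal_ideal[OF ring_free_algebra relations_closed])

lemma relations_uea_ideal: "subalgebra G \<Longrightarrow> uea_relations s br G \<subseteq> uea_ideal s br G"
  unfolding uea_ideal_def by (rule ring.genideal_self[OF ring_free_algebra relations_closed])

lemma uea_ideal_minimal:
  assumes "ideal J (free_algebra G)" "uea_relations s br G \<subseteq> J" shows "uea_ideal s br G \<subseteq> J"
  unfolding uea_ideal_def using ring.genideal_minimal[OF ring_free_algebra] assms by blast

lemma ring_uea: "subalgebra G \<Longrightarrow> ring (uea s br G)"
  unfolding uea_def by (rule ideal.quotient_is_ring[OF ideal_uea_ideal])

lemma rho_relations: "p \<in> uea_relations s br G \<Longrightarrow> rho p = 0"
  by (auto simp: uea_relations_def ev.ev_diff ev.ev_add ev.ev_mult op_add op_scale op_br)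

lemma uea_ideal_ker:
  assumes "subalgebra G"
  shows "uea_ideal s br G \<subseteq> a_kernel (free_algebra G) type_ring rho"
proof (rule uea_ideal_minimal)
  interpret ring_hom_ring "free_algebra G" type_ring rho by (rule ev.ring_hom_ev)
  show "ideal (a_kernel (free_algebra G) type_ring rho) (free_algebra G)"
    by (rule kernel_is_ideal)
  show "uea_relations s br G \<subseteq> a_kernel (free_algebra G) type_ring rho"
    using relations_closed[OF assms] rho_relations unfolding a_kernel_def' by auto
qed

text \<open>The value is well defined because \<open>rho\<close> is constant on each coset of the defining ideal.\<close>

definition Phi :: "('l, 'f) falg set \<Rightarrow> 'f sym poly endo"
  where "Phi X = the_elem (rho ` X)"

abbreviation cls :: "'l set \<Rightarrow> ('l, 'f) falg \<Rightarrow> ('l, 'f) falg set"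
  where "cls G p \<equiv> uea_ideal s br G +>\<^bsub>free_algebra G\<^esub> p"

lemma Phi_hom: "subalgebra G \<Longrightarrow> Phi \<in> ring_hom (uea s br G) type_ring"
  unfolding uea_def Phi_def[abs_def]
  by (rule quotient_induced_hom(1)[OF ideal_uea_ideal ev.ring_hom_ev uea_ideal_ker])

lemma Phi_cls: "subalgebra G \<Longrightarrow> p \<in> carrier (free_algebra G) \<Longrightarrow> Phi (cls G p) = rho p"
  unfolding Phi_def
  by (rule quotient_induced_hom(2)[OF ideal_uea_ideal ev.ring_hom_ev uea_ideal_ker])

lemma uea_carrier:
  "X \<in> carrier (uea s br G) \<longleftrightarrow> (\<exists>p\<in>carrier (free_algebra G). X = cls G p)"
  by (auto simp: uea_def FactRing_def A_RCOSETS_def')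

definition K :: "'l set" where "K = span {e1, e2, e3}"
definition H :: "'l set" where "H = span {y, e1, e2, e3}"

lemma scale_2: "s 2 v = - v"
proof -
  have "s 3 v = 0" by (simp add: char3)
  moreover have "s 3 v = s 2 v + v" using scale_left_distrib[of 2 1 v] by simp
  ultimately show ?thesis by (simp add: eq_neg_iff_add_eq_0)
qed

lemma add_self: "v + v = - (v :: 'l)"
  using scale_left_distrib[of 1 1 v] scale_2[of v] by simp

lemma br_span_closed:
  assumes "\<And>a v. a \<in> B \<Longrightarrow> v \<in> V \<Longrightarrow> br a v \<in> span W" and "a \<in> span B" and "v \<in> span V"
  shows "br a v \<in> span W"
proof -
  have 1: "br a v \<in> span W" if "v \<in> V" for v
    using assms(2)
  proof (induct rule: span_induct_alt)
    case (step c b w)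
    then show ?case using assms(1)[OF step(1) that]
      by (simp add: br_add_left br_scale_left span_add span_scale)
  qed (simp add: span_zero)
  show ?thesis
    using assms(3)
  proof (induct rule: span_induct_alt)
    case (step c b w)
    then show ?case using 1 by (simp add: br_add_right br_scale_right span_add span_scale)
  qed (simp add: span_zero)
qed

lemma br_basis:
  "br e2 e1 = 0" "br e3 e1 = 0" "br e3 e2 = 0" "br e1 y = - e3" "br e2 y = - e1" "br e3 y = - e2"
  using br_anti[of e2 e1] br_anti[of e3 e1] br_anti[of e3 e2]
    br_anti[of e1 y] br_anti[of e2 y] br_anti[of e3 y] br_anti[of e1 e2] br_anti[of e1 e3] br_anti[of e2 e3]
    br_anti[of y e1] br_anti[of y e2] br_anti[of y e3] by (simp_all only: br_e br_y minus_zero)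

lemma lie_ideal_K: "lie_ideal s br K"
proof -
  have "br a v \<in> K" if "v \<in> K" for a v
    unfolding K_def
  proof (rule br_span_closed)
    show "a \<in> span {x, y, e1, e2, e3}" by (simp add: span_UNIV)
    show "v \<in> span {e1, e2, e3}" using that by (simp add: K_def)
    have "0 \<in> span {e1, e2, e3}" "e1 \<in> span {e1, e2, e3}" "e2 \<in> span {e1, e2, e3}" "e3 \<in> span {e1, e2, e3}"
      "s 2 e3 \<in> span {e1, e2, e3}"
      by (intro span_zero span_base span_scale; simp)+
    then show "br a v \<in> span {e1, e2, e3}" if "a \<in> {x, y, e1, e2, e3}" "v \<in> {e1, e2, e3}" for a v
      using that by (auto simp: br_x br_y br_e br_basis br_self)
  qed
  then show ?thesis by (simp add: lie_ideal_def K_def)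
qed

lemma lie_ideal_H: "lie_ideal s br H"
proof -
  have "br a v \<in> H" if "v \<in> H" for a v
    unfolding H_def
  proof (rule br_span_closed)
    show "a \<in> span {x, y, e1, e2, e3}" by (simp add: span_UNIV)
    show "v \<in> span {y, e1, e2, e3}" using that by (simp add: H_def)
    have "0 \<in> span {y, e1, e2, e3}" "e1 \<in> span {y, e1, e2, e3}" "e2 \<in> span {y, e1, e2, e3}"
      "e3 \<in> span {y, e1, e2, e3}" "s 2 e3 \<in> span {y, e1, e2, e3}" "s 2 y \<in> span {y, e1, e2, e3}"
      "- e1 \<in> span {y, e1, e2, e3}" "- e2 \<in> span {y, e1, e2, e3}" "- e3 \<in> span {y, e1, e2, e3}"
      by (intro span_zero span_base span_scale span_neg; simp)+
    then show "br a v \<in> span {y, e1, e2, e3}" if "a \<in> {x, y, e1, e2, e3}" "v \<in> {y, e1, e2, e3}" for a v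
      using that
      by (auto simp: br_x br_y br_xy br_e br_basis br_self)
  qed
  then show ?thesis by (simp add: lie_ideal_def H_def)
qed

lemma subalgebra_H: "subalgebra H" and subalgebra_UNIV: "subalgebra UNIV"
  using lie_ideal_H by (simp_all add: subalgebra_def lie_ideal_def subspace_UNIV)

lemma mem_H: "y \<in> H" "e1 \<in> H" "e2 \<in> H" "e3 \<in> H"
  by (simp_all add: H_def span_base)

lemma H_closed: "a \<in> H \<Longrightarrow> b \<in> H \<Longrightarrow> a + b \<in> H" "a \<in> H \<Longrightarrow> s c a \<in> H" "0 \<in> H"
  "a \<in> H \<Longrightarrow> b \<in> H \<Longrightarrow> br a b \<in> H"
  using lie_ideal_H by (simp_all add: H_def span_add span_scale span_zero lie_ideal_def)

end

sublocale lie_ext \<subseteq> rc: ring_cong "carrier (free_algebra H)" "uea_ideal s br H"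
proof
  interpret I: ideal "uea_ideal s br H" "free_algebra H" by (rule ideal_uea_ideal[OF subalgebra_H])
  let ?A = "carrier (free_algebra H) :: ('l, 'f) falg set" and ?I = "uea_ideal s br H"
  show "1 \<in> ?A" "?I \<subseteq> ?A"
    using I.a_subset by (simp_all add: free_algebra_closed)
  show "p - q \<in> ?A" "p * q \<in> ?A" if "p \<in> ?A" "q \<in> ?A" for p q
    using that by (simp_all add: free_algebra_closed)
  show "0 \<in> ?I" using additive_subgroup.zero_closed[OF I.is_additive_subgroup] by simp
  show l: "p * i \<in> ?I" "i * p \<in> ?I" if "p \<in> ?A" "i \<in> ?I" for p i
    using I.I_l_closed[OF that(2,1)] I.I_r_closed[OF that(2,1)] by simp_all
  show "i - j \<in> ?I" if "i \<in> ?I" "j \<in> ?I" for i j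
  proof -
    have "- 1 * j \<in> ?I" by (rule l(1)[OF _ that(2)]) (simp add: free_algebra_closed)
    then show ?thesis using additive_subgroup.a_closed[OF I.is_additive_subgroup that(1), of "- j"] by simp
  qed
qed

context lie_ext
begin

notation rc.cg (infix "\<approx>" 50)

section \<open>Ordered normal forms and faithfulness for U(H)\<close>

abbreviation "aL \<equiv> e1 + e2 + e3"
abbreviation "bL \<equiv> e2 + s 2 e3"

lemma mem_H': "aL \<in> H" "bL \<in> H"
  by (simp_all add: H_closed mem_H)

lemmas H_mem = mem_H mem_H' H_closed

lemma gen_add: "a \<in> H \<Longrightarrow> b \<in> H \<Longrightarrow> falg_gen (a + b) \<approx> (falg_gen a + falg_gen b :: ('l, 'f) falg)"
  unfolding rc.cg_def
  by (intro conjI subsetD[OF relations_uea_ideal[OF subalgebra_H]])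
    (simp_all add: free_algebra_closed H_closed, auto simp: uea_relations_def)

lemma gen_scale: "a \<in> H \<Longrightarrow> falg_gen (s c a) \<approx> (falg_const c * falg_gen a :: ('l, 'f) falg)"
  unfolding rc.cg_def
  by (intro conjI subsetD[OF relations_uea_ideal[OF subalgebra_H]])
    (simp_all add: free_algebra_closed H_closed, auto simp: uea_relations_def)

lemma gen_br:
  assumes "a \<in> H" "b \<in> H"
  shows "falg_gen a * falg_gen b \<approx> (falg_gen b * falg_gen a + falg_gen (br a b) :: ('l, 'f) falg)"
proof -
  have "falg_gen a * falg_gen b - falg_gen b * falg_gen a - falg_gen (br a b)
      \<in> (uea_relations s br H :: ('l, 'f) falg set)"
    using assms unfolding uea_relations_def by blast
  then show ?thesis
    using assms relations_uea_ideal[OF subalgebra_H]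
    by (auto simp: rc.cg_def free_algebra_closed H_closed diff_diff_eq)
qed

lemma gen_0: "falg_gen 0 \<approx> (0 :: ('l, 'f) falg)"
  using gen_scale[of 0 0] by (simp add: H_closed)

lemma gen_commute:
  assumes "a \<in> H" "b \<in> H" "br a b = 0"
  shows "falg_gen a * falg_gen b \<approx> (falg_gen b * falg_gen a :: ('l, 'f) falg)"
proof -
  note gen_br[OF assms(1,2)]
  also have "falg_gen b * falg_gen a + falg_gen (br a b) \<approx> (falg_gen b * falg_gen a + 0 :: ('l, 'f) falg)"
    unfolding assms(3) by (intro rc.cg_add rc.cg_refl gen_0 free_algebra_closed assms)
  finally show ?thesis by simp
qed

abbreviation (input) "ga \<equiv> falg_gen aL :: ('l, 'f) falg"
abbreviation (input) "gb \<equiv> falg_gen bL :: ('l, 'f) falg"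
abbreviation (input) "gc \<equiv> falg_gen e3 :: ('l, 'f) falg"
abbreviation (input) "gy \<equiv> falg_gen y :: ('l, 'f) falg"

text \<open>\<open>sigma\<close> lifts a polynomial to its ordered normal form in the free algebra, with letters \<open>a\<close>,
  \<open>b\<close>, \<open>c\<close>, \<open>y\<close> in this order.\<close>

definition tau1 :: "'f poly \<Rightarrow> ('l, 'f) falg" where "tau1 = pev falg_const ga"
definition tau2 :: "'f poly poly \<Rightarrow> ('l, 'f) falg" where "tau2 = pev tau1 gb"
definition tau :: "'f sym \<Rightarrow> ('l, 'f) falg" where "tau = pev tau2 gc"
definition sigma :: "'f sym poly \<Rightarrow> ('l, 'f) falg" where "sigma = pev tau gy"

lemma additive_falg_const: "additive_map falg_const"
  by (simp add: additive_map_def falg_const_add)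

lemma tau_additive: "additive_map tau1" "additive_map tau2" "additive_map tau" "additive_map sigma"
  by (simp_all add: tau1_def tau2_def tau_def sigma_def additive_map_pev additive_falg_const)

lemma gens_closed: "ga \<in> carrier (free_algebra H)" "gb \<in> carrier (free_algebra H)"
  "gc \<in> carrier (free_algebra H)" "gy \<in> carrier (free_algebra H)"
  by (simp_all add: free_algebra_closed H_mem)

lemma tau1_closed: "tau1 p \<in> carrier (free_algebra H)"
  unfolding tau1_def by (rule rc.pev_closed[OF additive_falg_const free_algebra_closed(7) gens_closed(1)])
lemma tau2_closed: "tau2 p \<in> carrier (free_algebra H)"
  unfolding tau2_def by (rule rc.pev_closed[OF tau_additive(1) tau1_closed gens_closed(2)])
lemma tau_closed: "tau p \<in> carrier (free_algebra H)"
  unfolding tau_def by (rule rc.pev_closed[OF tau_additive(2) tau2_closed gens_closed(3)])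
lemma sigma_closed: "sigma p \<in> carrier (free_algebra H)"
  unfolding sigma_def by (rule rc.pev_closed[OF tau_additive(3) tau_closed gens_closed(4)])

lemma const_commute: "p \<in> carrier (free_algebra H) \<Longrightarrow> falg_const c * p \<approx> p * falg_const c"
  by (simp add: falg_const_central rc.cg_refl free_algebra_closed)

lemma ab_commute: "ga * gb \<approx> gb * ga" and ac_commute: "ga * gc \<approx> gc * ga" and bc_commute: "gb * gc \<approx> gc * gb"
  by (rule gen_commute; simp add: H_mem br_add_left br_add_right br_scale_left br_scale_right br_e br_basis br_self)+

lemma tau1_b: "tau1 p * gb \<approx> gb * tau1 p"
  unfolding tau1_def
  by (rule rc.pev_commute[OF additive_falg_const const_commute free_algebra_closed(7) ab_commute])
    (simp_all add: gens_closed)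

lemma tau1_c: "tau1 p * gc \<approx> gc * tau1 p"
  unfolding tau1_def
  by (rule rc.pev_commute[OF additive_falg_const const_commute free_algebra_closed(7) ac_commute])
    (simp_all add: gens_closed)

lemma tau2_c: "tau2 p * gc \<approx> gc * tau2 p"
  unfolding tau2_def
  by (rule rc.pev_commute[OF tau_additive(1) tau1_c tau1_closed bc_commute]) (simp_all add: gens_closed)

lemma const_mult: "falg_const (c * d) \<approx> (falg_const c * falg_const d :: ('l, 'f) falg)"
  by (simp add: falg_const_mult rc.cg_refl free_algebra_closed)

lemma tau1_mult: "tau1 (p * q) \<approx> tau1 p * tau1 q"
  unfolding tau1_def
  by (rule rc.pev_mult[OF additive_falg_const const_mult free_algebra_closed(7) gens_closed(1)
        const_commute[OF gens_closed(1)]])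

lemma tau2_mult: "tau2 (p * q) \<approx> tau2 p * tau2 q"
  unfolding tau2_def
  by (rule rc.pev_mult[OF tau_additive(1) tau1_mult tau1_closed gens_closed(2) tau1_b])

lemma tau_mult: "tau (p * q) \<approx> tau p * tau q"
  unfolding tau_def
  by (rule rc.pev_mult[OF tau_additive(2) tau2_mult tau2_closed gens_closed(3) tau2_c])

lemma sigma_smult: "sigma (smult r p) \<approx> tau r * sigma p"
  unfolding sigma_def by (rule rc.pev_smult[OF tau_additive(3) tau_mult tau_closed gens_closed(4)])

lemma tau_gens: "tau (kS k) = falg_const k" "tau va = ga" "tau vb = gb" "tau vc = gc"
  by (simp_all add: tau_def kS_def va_def vb_def vc_def pev_pCons tau_additive additive_falg_const)
    (simp_all add: tau2_def tau1_def pev_pCons pev_1 additive_map_pev additive_falg_const)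

text \<open>Modulo the ideal, \<open>ad y\<close> is a derivation, so it is compared with
  \<open>Dy\<close> on the generators; the product case is the Leibniz rule.\<close>

lemma y_tau: "gy * tau r \<approx> tau r * gy + tau (Dy r)"
proof (induct r rule: sym_induct)
  case (const k)
  show ?case using rc.cg_sym[OF const_commute[OF gens_closed(4), of k]] tau_additive(3)
    by (simp add: tau_gens)
next
  case a
  have "br y aL = aL" by (simp add: br_add_right br_y)
  then show ?case using gen_br[of y aL] by (simp add: tau_gens H_mem)
next
  case b
  \<comment> \<open>The bracket of y with e2 + 2 e3 is e1 + 2 e2, which equals a + b because the e3
    terms cancel in characteristic three.\<close>
  have "bL + aL = e1 + (e2 + e2)" by (simp add: scale_2)
  then have eq: "br y bL = bL + aL"
    by (simp only: br_add_right br_scale_right br_y scale_2 br_minus add_self)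
  have "gy * gb \<approx> gb * gy + falg_gen (bL + aL)"
    using gen_br[of y bL] unfolding eq by (simp add: H_mem)
  also have "\<dots> \<approx> gb * gy + (gb + ga)"
    by (intro rc.cg_add rc.cg_refl gen_add free_algebra_closed H_mem)
  finally show ?case by (simp add: tau_gens additive_map_add[OF tau_additive(3)])
next
  case c
  have eq: "br y e3 = e3 + bL" by (simp add: br_y scale_2)
  have "gy * gc \<approx> gc * gy + falg_gen (e3 + bL)"
    using gen_br[of y e3] unfolding eq by (simp add: H_mem)
  also have "\<dots> \<approx> gc * gy + (gc + gb)"
    by (intro rc.cg_add rc.cg_refl gen_add free_algebra_closed H_mem)
  finally show ?case by (simp add: tau_gens additive_map_add[OF tau_additive(3)])
next
  case (add r t)
  then show ?case
    using rc.cg_add[OF add] by (simp add: Dy_rules additive_map_add[OF tau_additive(3)] algebra_simps)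
next
  case (mult r t)
  note cl = tau_closed gens_closed(4) rc.A_mult rc.A_add
  have "gy * tau (r * t) \<approx> gy * (tau r * tau t)"
    by (intro rc.cg_mult_left tau_mult cl)
  also have "gy * (tau r * tau t) = (gy * tau r) * tau t" by (simp add: mult.assoc)
  also have "\<dots> \<approx> (tau r * gy + tau (Dy r)) * tau t"
    by (intro rc.cg_mult_right mult cl)
  also have "\<dots> = tau r * (gy * tau t) + tau (Dy r) * tau t" by (simp add: algebra_simps)
  also have "\<dots> \<approx> tau r * (tau t * gy + tau (Dy t)) + tau (Dy r) * tau t"
    by (intro rc.cg_add rc.cg_mult_left rc.cg_refl mult cl)
  also have "\<dots> = (tau r * tau t) * gy + (tau r * tau (Dy t) + tau (Dy r) * tau t)"
    by (simp add: algebra_simps)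
  also have "\<dots> \<approx> tau (r * t) * gy + (tau (r * Dy t) + tau (Dy r * t))"
    by (intro rc.cg_add rc.cg_mult_right rc.cg_sym[OF tau_mult] cl)
  finally show ?case
    by (simp add: Dy_rules additive_map_add[OF tau_additive(3)] add.commute)
qed

lemma y_sigma: "gy * sigma p \<approx> sigma (pCons 0 p + map_poly Dy p)"
proof (induct p)
  case 0
  show ?case using rc.cg_refl[OF rc.A_0] tau_additive(4) by simp
next
  case (pCons r p)
  note cl = sigma_closed tau_closed gens_closed(4) rc.A_mult rc.A_add
  have step: "sigma (pCons r p) = tau r + sigma p * gy" for r p
    using tau_additive by (simp add: sigma_def pev_pCons)
  have "gy * sigma (pCons r p) = gy * tau r + (gy * sigma p) * gy"
    by (simp add: step algebra_simps)
  also have "\<dots> \<approx> (tau r * gy + tau (Dy r)) + sigma (pCons 0 p + map_poly Dy p) * gy"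
    by (intro rc.cg_add rc.cg_mult_right y_tau pCons(2) cl)
  also have "\<dots> = sigma (pCons 0 (pCons r p) + map_poly Dy (pCons r p))"
    using tau_additive
    by (simp add: step map_poly_pCons derivation_Dy additive_map_add[OF tau_additive(3)]
        additive_map_add[OF tau_additive(4)] algebra_simps)
  finally show ?case .
qed

text \<open>The vectors whose left multiplication preserves normal forms modulo the ideal form a
  subspace. It contains y, a, b and c, and e2 and e1 are recovered from these.\<close>

lemma gen_sigma: "h \<in> H \<Longrightarrow> \<exists>q. falg_gen h * sigma p \<approx> sigma q"
proof -
  let ?W = "{h \<in> H. \<forall>p. \<exists>q. falg_gen h * sigma p \<approx> sigma q}"
  have sub: "subspace ?W"
  proof (rule subspaceI)
    have "falg_gen 0 * sigma p \<approx> sigma 0" for p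
      using rc.cg_mult_right[OF gen_0 sigma_closed] tau_additive(4) by simp
    then show "0 \<in> ?W" using H_closed by blast
  next
    fix g h assume gh: "g \<in> ?W" "h \<in> ?W"
    have "\<exists>q. falg_gen (g + h) * sigma p \<approx> sigma q" for p
    proof -
      obtain q r where qr: "falg_gen g * sigma p \<approx> sigma q" "falg_gen h * sigma p \<approx> sigma r"
        using gh by blast
      have "falg_gen (g + h) * sigma p \<approx> (falg_gen g + falg_gen h) * sigma p"
        using gh by (intro rc.cg_mult_right gen_add sigma_closed) auto
      also have "\<dots> = falg_gen g * sigma p + falg_gen h * sigma p" by (simp add: distrib_right)
      also have "\<dots> \<approx> sigma q + sigma r" by (rule rc.cg_add[OF qr])
      finally show ?thesis using additive_map_add[OF tau_additive(4)] by metis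
    qed
    then show "g + h \<in> ?W" using gh H_closed by auto
  next
    fix c h assume h: "h \<in> ?W"
    have "\<exists>q. falg_gen (s c h) * sigma p \<approx> sigma q" for p
    proof -
      obtain q where q: "falg_gen h * sigma p \<approx> sigma q"
        using h by blast
      have "falg_gen (s c h) * sigma p \<approx> falg_const c * falg_gen h * sigma p"
        using h by (intro rc.cg_mult_right gen_scale sigma_closed) auto
      also have "\<dots> = falg_const c * (falg_gen h * sigma p)" by (simp add: mult.assoc)
      also have "\<dots> \<approx> falg_const c * sigma q"
        by (intro rc.cg_mult_left q free_algebra_closed)
      also have "\<dots> \<approx> sigma (smult (kS c) q)"
        using rc.cg_sym[OF sigma_smult] by (simp add: tau_gens[symmetric])
      finally show ?thesis by blast
    qed
    then show "s c h \<in> ?W" using h H_closed by auto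
  qed
  have y: "y \<in> ?W" using y_sigma H_mem by blast
  have abc: "aL \<in> ?W" "bL \<in> ?W" "e3 \<in> ?W"
    using rc.cg_sym[OF sigma_smult[of va]] rc.cg_sym[OF sigma_smult[of vb]]
      rc.cg_sym[OF sigma_smult[of vc]] H_mem
    unfolding tau_gens by blast+
  have "bL - s 2 e3 \<in> ?W" by (rule subspace_diff[OF sub abc(2) subspace_scale[OF sub abc(3)]])
  then have e2: "e2 \<in> ?W" by simp
  have "aL - e3 - e2 \<in> ?W" by (rule subspace_diff[OF sub subspace_diff[OF sub abc(1,3)] e2])
  then have e1: "e1 \<in> ?W" by simp
  have "H \<subseteq> ?W"
    unfolding H_def by (rule span_minimal[OF _ sub[unfolded H_def]]) (use y abc e1 e2 in \<open>auto simp: H_def\<close>)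
  then show "h \<in> H \<Longrightarrow> \<exists>q. falg_gen h * sigma p \<approx> sigma q" by blast
qed

text \<open>The spanning half of the Poincare-Birkhoff-Witt theorem for H.\<close>

lemma sigma_surj: "p \<in> carrier (free_algebra H) \<Longrightarrow> \<exists>q. p \<approx> sigma q"
proof (induct rule: free_algebra_induct)
  case (const c)
  have "sigma [:kS c:] = falg_const c" using tau_additive by (simp add: sigma_def tau_gens)
  then show ?case using rc.cg_refl[OF sigma_closed] by metis
next
  case (gen a q)
  then obtain r where "q \<approx> sigma r" by blast
  then have "falg_gen a * q \<approx> falg_gen a * sigma r"
    using gen by (intro rc.cg_mult_left free_algebra_closed)
  then show ?case using gen_sigma[OF gen(1)] rc.cg_trans by blast
next
  case (add q r)
  then show ?case using rc.cg_add additive_map_add[OF tau_additive(4)] by metis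
next
  case (mult c q)
  then obtain r where "q \<approx> sigma r" by blast
  then have "falg_const c * q \<approx> tau (kS c) * sigma r"
    unfolding tau_gens by (intro rc.cg_mult_left free_algebra_closed)
  then show ?case using rc.cg_sym[OF sigma_smult] rc.cg_trans by blast
qed

lemma op_abc: "op aL = MS va" "op bL = MS vb"
proof -
  have three: "vc + vc + vc = (0 :: 'f sym)" using char3_add[OF char3_sym[OF char3], of vc] by simp
  have "va - vb + vc + (vb + vc) + vc = va + (vc + vc + vc :: 'f sym)" by simp
  then show "op aL = MS va" unfolding three
    by (simp only: op_add op_basis MS_add[symmetric]) simp
  show "op bL = MS vb"
    by (simp only: op_add scale_2 op_minus op_basis MS_add) simp
qed

text \<open>With injectivity of \<open>act\<close>, this gives the linear independence of the normal
  forms. The proof passes through the variables a, b, c, y one at a time.\<close>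

lemma rho_sigma: "rho (sigma p) = act p"
proof -
  note 0 = additive_map_0[OF tau_additive(1)] additive_map_0[OF tau_additive(2)]
    additive_map_0[OF tau_additive(3)] additive_map_0[OF additive_falg_const]
  have 1: "rho (tau1 q) = MS [:[:q:]:]" for q
    unfolding tau1_def ev.ev_pev[of falg_const, OF 0(4)]
  proof (induct q)
    case (pCons k q)
    have eq: "[:[:pCons k q:]:] = kS k + [:[:q:]:] * va" by (simp add: kS_def va_def)
    show ?case
      unfolding eq by (simp only: MS_add MS_mult pCons(2)[symmetric]) (simp add: pev_pCons op_abc)
  qed simp
  have 2: "rho (tau2 q) = MS [:q:]" for q
    unfolding tau2_def ev.ev_pev[of tau1, OF 0(1)]
  proof (induct q)
    case (pCons k q)
    have eq: "[:pCons k q:] = [:[:k:]:] + [:q:] * vb" by (simp add: vb_def)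
    show ?case
      unfolding eq by (simp only: MS_add MS_mult pCons(2)[symmetric]) (simp add: pev_pCons op_abc 1)
  qed simp
  have "rho (tau r) = MS r" for r
    unfolding tau_def ev.ev_pev[of tau2, OF 0(2)]
  proof (induct r)
    case (pCons k q)
    have "pCons k q = [:k:] + q * vc" by (simp add: vc_def)
    then have eq: "MS (pCons k q) = MS [:k:] + MS q * MS vc" by (simp only: MS_add MS_mult)
    show ?case
      unfolding eq by (simp only: pCons(2)[symmetric]) (simp add: pev_pCons op_basis 2)
  qed simp
  then show ?thesis
    unfolding sigma_def ev.ev_pev[of tau, OF 0(3)] act_def by (simp add: op_basis)
qed

lemma rho_cong: "p \<approx> q \<Longrightarrow> rho p = rho q"
  using uea_ideal_ker[OF subalgebra_H] by (auto simp: rc.cg_def a_kernel_def' ev.ev_diff)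

lemma rho_range: "p \<in> carrier (free_algebra H) \<Longrightarrow> \<exists>q. rho p = act q"
  using sigma_surj rho_cong rho_sigma by metis

lemma rho_inj:
  assumes "p \<in> carrier (free_algebra H)" "rho p = 0" shows "p \<in> uea_ideal s br H"
proof -
  obtain q where q: "p \<approx> sigma q" using sigma_surj[OF assms(1)] by blast
  then have "act q = 0" using rho_cong rho_sigma assms(2) by metis
  then have "q = 0" by (simp add: act_eq_0)
  then show ?thesis using q tau_additive(4) by (simp add: rc.cg_def)
qed

text \<open>The Poincare-Birkhoff-Witt theorem for \<open>H\<close>: \<open>rho\<close> is faithful on \<open>U(H)\<close>.\<close>

lemma uea_ideal_H: "uea_ideal s br H = a_kernel (free_algebra H) type_ring rho"
  using uea_ideal_ker[OF subalgebra_H] rho_inj unfolding a_kernel_def' by auto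

lemma Phi_inj:
  assumes "X \<in> carrier (uea s br H)" "Y \<in> carrier (uea s br H)" "Phi X = Phi Y" shows "X = Y"
  using ring_hom_ring.the_elem_inj[OF ev.ring_hom_ev[of H]] assms
  unfolding Phi_def uea_def uea_ideal_H by blast

text \<open>Together with \<open>Phi_inj\<close> this identifies U(H) with the operators in
  \<open>range act\<close>.\<close>

lemma Phi_range: "Phi ` carrier (uea s br H) = range act"
proof -
  have "act q \<in> Phi ` carrier (uea s br H)" for q
  proof -
    have "Phi (cls H (sigma q)) = act q"
      by (simp add: Phi_cls[OF subalgebra_H sigma_closed] rho_sigma)
    moreover have "cls H (sigma q) \<in> carrier (uea s br H)"
      using uea_carrier sigma_closed by blast
    ultimately show ?thesis by (metis image_eqI)
  qed
  moreover have "Phi X \<in> range act" if "X \<in> carrier (uea s br H)" for X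
    using that rho_range Phi_cls[OF subalgebra_H] unfolding uea_carrier by force
  ultimately show ?thesis by blast
qed

section \<open>The enveloping algebras as algebras of operators\<close>

lemma ring_hom_Phi: "subalgebra G \<Longrightarrow> ring_hom_ring (uea s br G) type_ring Phi"
  using ring_hom_ringI2[OF ring_uea ring_type_ring Phi_hom] .

lemma Phi_ops:
  assumes G: "subalgebra G"
  shows "X \<in> carrier (uea s br G) \<Longrightarrow> Y \<in> carrier (uea s br G) \<Longrightarrow> Phi (X \<oplus>\<^bsub>uea s br G\<^esub> Y) = Phi X + Phi Y"
    "X \<in> carrier (uea s br G) \<Longrightarrow> Y \<in> carrier (uea s br G) \<Longrightarrow> Phi (X \<otimes>\<^bsub>uea s br G\<^esub> Y) = Phi X * Phi Y"
    "X \<in> carrier (uea s br G) \<Longrightarrow> Phi (\<ominus>\<^bsub>uea s br G\<^esub> X) = - Phi X"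
    "X \<in> carrier (uea s br G) \<Longrightarrow> Y \<in> carrier (uea s br G) \<Longrightarrow> Phi (X \<ominus>\<^bsub>uea s br G\<^esub> Y) = Phi X - Phi Y"
    "X \<in> carrier (uea s br G) \<Longrightarrow> Phi (X [^]\<^bsub>uea s br G\<^esub> (n::nat)) = Phi X ^ n"
    "Phi \<one>\<^bsub>uea s br G\<^esub> = 1"
proof -
  interpret ring_hom_ring "uea s br G" type_ring Phi by (rule ring_hom_Phi[OF G])
  show "X \<in> carrier (uea s br G) \<Longrightarrow> Y \<in> carrier (uea s br G) \<Longrightarrow> Phi (X \<oplus>\<^bsub>uea s br G\<^esub> Y) = Phi X + Phi Y"
    "X \<in> carrier (uea s br G) \<Longrightarrow> Y \<in> carrier (uea s br G) \<Longrightarrow> Phi (X \<otimes>\<^bsub>uea s br G\<^esub> Y) = Phi X * Phi Y"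
    "Phi \<one>\<^bsub>uea s br G\<^esub> = 1"
    by simp_all
  show "X \<in> carrier (uea s br G) \<Longrightarrow> Phi (\<ominus>\<^bsub>uea s br G\<^esub> X) = - Phi X"
    "X \<in> carrier (uea s br G) \<Longrightarrow> Y \<in> carrier (uea s br G) \<Longrightarrow> Phi (X \<ominus>\<^bsub>uea s br G\<^esub> Y) = Phi X - Phi Y"
    using hom_a_inv by (simp_all add: a_minus_def type_ring_a_inv)
  show "X \<in> carrier (uea s br G) \<Longrightarrow> Phi (X [^]\<^bsub>uea s br G\<^esub> (n::nat)) = Phi X ^ n"
    by (induct n) (simp_all add: power_Suc2 del: power_Suc)
qed

lemma uea_closed:
  assumes G: "subalgebra G"
  shows "X \<in> carrier (uea s br G) \<Longrightarrow> Y \<in> carrier (uea s br G) \<Longrightarrow> X \<oplus>\<^bsub>uea s br G\<^esub> Y \<in> carrier (uea s br G)"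
    "X \<in> carrier (uea s br G) \<Longrightarrow> Y \<in> carrier (uea s br G) \<Longrightarrow> X \<otimes>\<^bsub>uea s br G\<^esub> Y \<in> carrier (uea s br G)"
    "X \<in> carrier (uea s br G) \<Longrightarrow> \<ominus>\<^bsub>uea s br G\<^esub> X \<in> carrier (uea s br G)"
    "X \<in> carrier (uea s br G) \<Longrightarrow> Y \<in> carrier (uea s br G) \<Longrightarrow> X \<ominus>\<^bsub>uea s br G\<^esub> Y \<in> carrier (uea s br G)"
    "X \<in> carrier (uea s br G) \<Longrightarrow> X [^]\<^bsub>uea s br G\<^esub> (n::nat) \<in> carrier (uea s br G)"
    "\<one>\<^bsub>uea s br G\<^esub> \<in> carrier (uea s br G)"
proof -
  interpret ring "uea s br G" by (rule ring_uea[OF G])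
  show "X \<in> carrier (uea s br G) \<Longrightarrow> Y \<in> carrier (uea s br G) \<Longrightarrow> X \<oplus>\<^bsub>uea s br G\<^esub> Y \<in> carrier (uea s br G)"
    "X \<in> carrier (uea s br G) \<Longrightarrow> Y \<in> carrier (uea s br G) \<Longrightarrow> X \<otimes>\<^bsub>uea s br G\<^esub> Y \<in> carrier (uea s br G)"
    "X \<in> carrier (uea s br G) \<Longrightarrow> \<ominus>\<^bsub>uea s br G\<^esub> X \<in> carrier (uea s br G)"
    "X \<in> carrier (uea s br G) \<Longrightarrow> Y \<in> carrier (uea s br G) \<Longrightarrow> X \<ominus>\<^bsub>uea s br G\<^esub> Y \<in> carrier (uea s br G)"
    "X \<in> carrier (uea s br G) \<Longrightarrow> X [^]\<^bsub>uea s br G\<^esub> (n::nat) \<in> carrier (uea s br G)"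
    "\<one>\<^bsub>uea s br G\<^esub> \<in> carrier (uea s br G)"
    by simp_all
qed

lemma emb_closed: "g \<in> G \<Longrightarrow> (uea_emb s br G g :: ('l, 'f) falg set) \<in> carrier (uea s br G)"
  unfolding uea_emb_def uea_carrier by (rule bexI[of _ "falg_gen g"]) (simp_all add: free_algebra_closed)

lemma const_closed: "(uea_const s br G c :: ('l, 'f) falg set) \<in> carrier (uea s br G)"
  unfolding uea_const_def uea_carrier by (rule bexI[of _ "falg_const c"]) (simp_all add: free_algebra_closed)

lemma Phi_emb: "subalgebra G \<Longrightarrow> g \<in> G \<Longrightarrow> Phi (uea_emb s br G g) = op g"
  and Phi_const: "subalgebra G \<Longrightarrow> Phi (uea_const s br G c) = Cst c"
  by (simp_all add: uea_emb_def uea_const_def Phi_cls free_algebra_closed)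

lemma scale_closed:
  "subalgebra G \<Longrightarrow> X \<in> carrier (uea s br G) \<Longrightarrow> uea_scale s br G c X \<in> carrier (uea s br G)"
  by (simp add: uea_scale_def uea_closed const_closed)

lemma Phi_scale:
  "subalgebra G \<Longrightarrow> X \<in> carrier (uea s br G) \<Longrightarrow> Phi (uea_scale s br G c X) = Cst c * Phi X"
  by (simp add: uea_scale_def Phi_ops Phi_const const_closed)

lemma commutator_closed:
  "subalgebra G \<Longrightarrow> X \<in> carrier (uea s br G) \<Longrightarrow> Y \<in> carrier (uea s br G) \<Longrightarrow>
    ring_commutator (uea s br G) X Y \<in> carrier (uea s br G)"
  by (simp add: ring_commutator_def uea_closed)

lemma Phi_commutator:
  "subalgebra G \<Longrightarrow> X \<in> carrier (uea s br G) \<Longrightarrow> Y \<in> carrier (uea s br G) \<Longrightarrow>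
    Phi (ring_commutator (uea s br G) X Y) = Phi X * Phi Y - Phi Y * Phi X"
  by (simp add: ring_commutator_def Phi_ops uea_closed)

lemma weight_space_Phi:
  assumes "subalgebra G" "X \<in> weight_space s br G \<mu>" "g \<in> G"
  shows "op g * Phi X - Phi X * op g = Cst (\<mu> g) * Phi X"
proof -
  have X: "X \<in> carrier (uea s br G)"
    and eq: "ring_commutator (uea s br G) (uea_emb s br G g) X = uea_scale s br G (\<mu> g) X"
    using assms by (auto simp: weight_space_def)
  show ?thesis
    using arg_cong[OF eq, of Phi] X assms
    by (simp add: Phi_commutator Phi_scale Phi_emb emb_closed)
qed

text \<open>On U(H) the operator equation is also sufficient, because \<open>Phi\<close> is
  injective there.\<close>

lemma weight_space_H_iff:
  assumes X: "X \<in> carrier (uea s br H)"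
  shows "X \<in> weight_space s br H \<mu> \<longleftrightarrow>
    (\<forall>g\<in>H. op g * Phi X - Phi X * op g = Cst (\<mu> g) * Phi X)"
proof
  assume "\<forall>g\<in>H. op g * Phi X - Phi X * op g = Cst (\<mu> g) * Phi X"
  then have "ring_commutator (uea s br H) (uea_emb s br H g) X = uea_scale s br H (\<mu> g) X" if "g \<in> H" for g
    using that X
    by (intro Phi_inj) (simp_all add: Phi_commutator Phi_scale Phi_emb emb_closed commutator_closed
        scale_closed subalgebra_H)
  then show "X \<in> weight_space s br H \<mu>" using X by (simp add: weight_space_def)
qed (use weight_space_Phi[OF subalgebra_H] in blast)

section \<open>Weight vectors of \<open>U(H)\<close>\<close>

text \<open>The image in the operators on \<open>S[Y]\<close> of the weight space for \<open>y \<mapsto> \<gamma>\<close>, \<open>K \<mapsto> 0\<close>.\<close>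

definition V :: "'f \<Rightarrow> 'f sym poly endo set"
  where "V \<gamma> = {w \<in> range act. (\<forall>t. MS t * w = w * MS t) \<and> Th * w - w * Th = Cst \<gamma> * w}"

lemma V_range:
  assumes "w \<in> V \<gamma>" obtains X where "X \<in> carrier (uea s br H)" "Phi X = w"
proof -
  have "w \<in> Phi ` carrier (uea s br H)" using assms unfolding Phi_range V_def by blast
  then show ?thesis using that by blast
qed

lemma range_act_closed:
  assumes "w \<in> range act" "w' \<in> range (act :: 'f sym poly \<Rightarrow> _)"
  shows "w + w' \<in> range act" "w * w' \<in> range act"
proof -
  obtain p q where w: "w = act p" "w' = act q" using assms by blast
  show "w + w' \<in> range act"
    unfolding w using act_add[of p q] by (metis rangeI)
  obtain X Y where XY: "X \<in> carrier (uea s br H)" "w = Phi X" "Y \<in> carrier (uea s br H)" "w' = Phi Y"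
    using assms unfolding Phi_range[symmetric] by blast
  \<comment> \<open>Closure under products is inherited from U(H).\<close>
  have "w * w' = Phi (X \<otimes>\<^bsub>uea s br H\<^esub> Y)"
    using XY by (simp add: Phi_ops subalgebra_H)
  then show "w * w' \<in> range act"
    unfolding Phi_range[symmetric] using uea_closed(2)[OF subalgebra_H XY(1,3)] by blast
qed

lemma V_add: "w \<in> V \<gamma> \<Longrightarrow> w' \<in> V \<gamma> \<Longrightarrow> w + w' \<in> V \<gamma>"
  by (simp add: V_def range_act_closed distrib_left distrib_right) (simp add: algebra_simps)

lemma V_minus: assumes "w \<in> V \<gamma>" shows "- w \<in> V \<gamma>"
proof -
  obtain p where "w = act p" using assms by (auto simp: V_def)
  then have "- w = act (- p)" by (simp add: act_minus)
  then have "- w \<in> range act" by blast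
  moreover have "Th * - w - - w * Th = - (Th * w - w * Th)" by simp
  moreover have "Th * w - w * Th = Cst \<gamma> * w" "\<And>t. MS t * w = w * MS t"
    using assms by (simp_all add: V_def)
  ultimately show ?thesis unfolding V_def by (auto simp only: mem_Collect_eq mult_minus_right mult_minus_left)
qed

text \<open>The commutator with \<open>Th\<close> is a derivation, and the scalars pass through
  \<open>w\<close>; hence weights add.\<close>

lemma V_mult:
  assumes "w \<in> V \<gamma>" "w' \<in> V \<delta>" shows "w * w' \<in> V (\<gamma> + \<delta>)"
proof -
  have w: "Th * w = w * Th + Cst \<gamma> * w" "Th * w' = w' * Th + Cst \<delta> * w'"
    using assms by (auto simp: V_def diff_eq_eq add.commute)
  have c: "MS t * w = w * MS t" "MS t * w' = w' * MS t" for t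
    using assms by (auto simp: V_def)
  have "Th * (w * w') = (Th * w) * w'" by (simp only: mult.assoc)
  also have "\<dots> = w * (Th * w') + Cst \<gamma> * (w * w')"
    by (simp only: w(1) distrib_right mult.assoc)
  also have "\<dots> = w * (w' * Th) + ((w * Cst \<delta>) * w' + Cst \<gamma> * (w * w'))"
    by (simp only: w(2) distrib_left mult.assoc add.assoc)
  also have "\<dots> = w * w' * Th + (Cst \<delta> + Cst \<gamma>) * (w * w')"
    by (simp only: c(1)[symmetric] distrib_right mult.assoc)
  finally have "Th * (w * w') - w * w' * Th = Cst (\<gamma> + \<delta>) * (w * w')"
    by (simp add: kS_add MS_add add.commute)
  moreover have "MS t * (w * w') = w * w' * MS t" for t
  proof -
    have "MS t * (w * w') = (MS t * w) * w'" by (simp only: mult.assoc)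
    also have "\<dots> = w * (MS t * w')" by (simp only: c(1) mult.assoc)
    finally show ?thesis by (simp only: c(2) mult.assoc)
  qed
  moreover have "w * w' \<in> range act" using assms by (intro range_act_closed) (auto simp: V_def)
  ultimately show ?thesis by (simp add: V_def)
qed

lemma V_MS: "Dy t = kS \<gamma> * t \<Longrightarrow> MS t \<in> V \<gamma>"
proof -
  assume "Dy t = kS \<gamma> * t"
  moreover have "MS t \<in> range act" using act_const[of t] by (metis rangeI)
  ultimately show ?thesis by (simp add: V_def Th_MS MS_mult MS_commute)
qed

lemma V_0: "0 \<in> V \<gamma>"
  using V_MS[of 0 \<gamma>] derivation_0[OF derivation_Dy] by simp

lemma V_Z: "Th ^ 9 - Th ^ 3 \<in> V 0"
proof -
  have "Th ^ 9 - Th ^ 3 = (act zpoly :: 'f sym poly endo)"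
  proof -
    have "act 1 = (1 :: 'f sym poly endo)" using act_const[of 1] by (simp only: one_pCons[symmetric] MS_1)
    then show ?thesis
      using act_Th_power[of "1 :: 'f sym poly" 9] act_Th_power[of "1 :: 'f sym poly" 3] by (simp add: zpoly_def act_diff del: power_Suc)
  qed
  then have "Th ^ 9 - Th ^ 3 \<in> range (act :: 'f sym poly \<Rightarrow> _)" by simp
  then show ?thesis
    using Th_central[OF char3] by (simp add: V_def algebra_simps power_commutes)
qed

lemma H_decomp: "H = {s a y + k | a k. k \<in> K}"
proof -
  have "v \<in> H \<longleftrightarrow> (\<exists>a. v - s a y \<in> K)" for v
    by (simp add: H_def K_def span_insert)
  moreover have "v = s a y + k \<longleftrightarrow> k = v - s a y" for v a k by auto
  ultimately show ?thesis by auto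
qed

lemma K_subset_H: "K \<subseteq> H"
  unfolding K_def H_def by (rule span_mono) auto

lemma op_K: "k \<in> K \<Longrightarrow> \<exists>t. op k = MS t"
  unfolding K_def
proof (induct rule: span_induct_alt)
  case base
  show ?case using MS_0 by (metis op_0)
next
  case (step c v w)
  then obtain t where "op w = MS t" by blast
  moreover obtain r where "op v = MS r" using step(1) op_basis by blast
  ultimately have "op (s c v + w) = MS (kS c * r + t)"
    by (simp add: op_add op_scale MS_add MS_mult)
  then show ?case by blast
qed

lemma commute_MS:
  assumes w: "w \<in> range act" and e: "\<And>v. v \<in> {e1, e2, e3} \<Longrightarrow> op v * w = w * op v"
  shows "MS t * w = w * MS t"
proof -
  obtain X where "X \<in> carrier (uea s br H)" "w = Phi X" using w Phi_range by (metis imageE)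
  then obtain p where "w = rho p" using uea_carrier Phi_cls[OF subalgebra_H] by metis
  \<comment> \<open>Scalars are central in the free algebra, and \<open>w\<close> is the image of
    one of its elements.\<close>
  then have k: "Cst k * w = w * Cst k" for k
    using falg_const_central[of k p] ev.ev_mult ev.ev_const by metis
  have E: "MS vc * w = w * MS vc" "MS (vb + vc) * w = w * MS (vb + vc)"
    "MS (va - vb + vc) * w = w * MS (va - vb + vc)"
    using e[of e3] e[of e2] e[of e1] by (simp_all add: op_basis)
  have b: "MS vb * w = w * MS vb"
    using E(1,2) by (simp add: MS_add algebra_simps)
  have a: "MS va * w = w * MS va"
    using E(1,3) b by (simp add: MS_add MS_diff algebra_simps)
  show ?thesis
  proof (induct t rule: sym_induct)
    case (mult r t)
    then show ?case by (metis MS_mult mult.assoc)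
  next
    case (add r t)
    then show ?case by (simp add: MS_add distrib_left distrib_right)
  qed (fact k a b E(1))+
qed

text \<open>On K the condition says that the operator commutes with e1, e2 and e3, hence with all of
  S. Conversely, an element of H is a multiple of y plus an element acting through S.\<close>

lemma weight_space_V:
  assumes X: "X \<in> carrier (uea s br H)" and \<mu>: "linear_form_on s H \<mu>"
    and y: "\<mu> y = \<gamma>" and K: "\<And>k. k \<in> K \<Longrightarrow> \<mu> k = 0"
  shows "X \<in> weight_space s br H \<mu> \<longleftrightarrow> Phi X \<in> V \<gamma>"
proof -
  have w: "Phi X \<in> range act" using X Phi_range by blast
  show ?thesis
    unfolding weight_space_H_iff[OF X]
  proof
    assume *: "\<forall>g\<in>H. op g * Phi X - Phi X * op g = Cst (\<mu> g) * Phi X"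
    have "op v * Phi X = Phi X * op v" if "v \<in> {e1, e2, e3}" for v
    proof -
      have v: "v \<in> K" using that by (auto simp: K_def intro: span_base)
      then have "op v * Phi X - Phi X * op v = Cst (\<mu> v) * Phi X" using * K_subset_H by blast
      then show ?thesis by (simp add: K[OF v])
    qed
    then have "MS t * Phi X = Phi X * MS t" for t using commute_MS[OF w] by blast
    moreover have "Th * Phi X - Phi X * Th = Cst \<gamma> * Phi X"
      using * mem_H(1) y op_basis(2) by metis
    ultimately show "Phi X \<in> V \<gamma>" using w by (simp add: V_def)
  next
    assume V: "Phi X \<in> V \<gamma>"
    show "\<forall>g\<in>H. op g * Phi X - Phi X * op g = Cst (\<mu> g) * Phi X"
    proof
      fix g assume "g \<in> H"
      then obtain a k where g: "g = s a y + k" and k: "k \<in> K" using H_decomp by blast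
      obtain t where t: "op k = MS t" using op_K[OF k] by blast
      have "\<mu> g = a * \<gamma>"
        using \<mu> K[OF k] y mem_H(1) K_subset_H k H_closed(2)[of y a]
        by (auto simp: g linear_form_on_def)
      moreover have "op g * Phi X - Phi X * op g = Cst a * (Th * Phi X - Phi X * Th)"
      proof -
        have c: "Cst a * Phi X = Phi X * Cst a" "MS t * Phi X = Phi X * MS t"
          using V by (simp_all add: V_def)
        have "op g * Phi X = Cst a * (Th * Phi X) + MS t * Phi X"
          by (simp only: g op_add op_scale op_basis t distrib_right mult.assoc)
        moreover have "Phi X * op g = Cst a * (Phi X * Th) + MS t * Phi X"
          by (simp only: g op_add op_scale op_basis t distrib_left c mult.assoc[symmetric])
        ultimately show ?thesis by (simp add: right_diff_distrib)
      qed
      ultimately show "op g * Phi X - Phi X * op g = Cst (\<mu> g) * Phi X"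
        using V by (simp add: V_def kS_mult MS_mult mult.assoc)
    qed
  qed
qed

text \<open>Commuting with S and \<open>Th\<close> implies commuting with every normally ordered
  operator, and faithfulness carries this back to U(H).\<close>

lemma center_V:
  "X \<in> ring_center (uea s br H) \<longleftrightarrow> X \<in> carrier (uea s br H) \<and> Phi X \<in> V 0"
proof (cases "X \<in> carrier (uea s br H)")
  case X: True
  have w: "Phi X \<in> range act" using X Phi_range by blast
  show ?thesis
  proof
    assume c: "X \<in> ring_center (uea s br H)"
    have c: "Phi X * op g = op g * Phi X" if "g \<in> H" for g
    proof -
      have "X \<otimes>\<^bsub>uea s br H\<^esub> uea_emb s br H g = uea_emb s br H g \<otimes>\<^bsub>uea s br H\<^esub> X"
        using c emb_closed[OF that] by (simp add: ring_center_def)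
      from arg_cong[OF this, of Phi] show ?thesis
        using X that by (simp add: Phi_ops emb_closed Phi_emb subalgebra_H)
    qed
    have "op v * Phi X = Phi X * op v" if "v \<in> {e1, e2, e3}" for v
      using c[of v] mem_H that by auto
    then have "MS t * Phi X = Phi X * MS t" for t
      using commute_MS[OF w] by blast
    moreover have "Th * Phi X = Phi X * Th" using c[OF mem_H(1)] by (simp add: op_basis)
    ultimately show "X \<in> carrier (uea s br H) \<and> Phi X \<in> V 0"
      using X w by (simp add: V_def)
  next
    assume "X \<in> carrier (uea s br H) \<and> Phi X \<in> V 0"
    then have V: "Phi X * MS t = MS t * Phi X" "Phi X * Th = Th * Phi X" for t
      by (simp_all add: V_def)
    have "X \<otimes>\<^bsub>uea s br H\<^esub> Y = Y \<otimes>\<^bsub>uea s br H\<^esub> X" if Y: "Y \<in> carrier (uea s br H)" for Y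
    proof (rule Phi_inj)
      obtain q where "Phi Y = act q" using Y Phi_range by blast
      then show "Phi (X \<otimes>\<^bsub>uea s br H\<^esub> Y) = Phi (Y \<otimes>\<^bsub>uea s br H\<^esub> X)"
        using commute_act[OF V(1) V(1) V(1) V(1) V(2)] X Y by (simp add: Phi_ops subalgebra_H)
    qed (simp_all add: X Y uea_closed subalgebra_H)
    then show "X \<in> ring_center (uea s br H)" using X by (simp add: ring_center_def)
  qed
qed (simp add: ring_center_def)

section \<open>Generators\<close>

definition subalg :: "'f sym poly endo set \<Rightarrow> bool"
  where "subalg B \<longleftrightarrow> (\<forall>k. Cst k \<in> B) \<and> (\<forall>v\<in>B. \<forall>w\<in>B. v + w \<in> B \<and> v * w \<in> B)"

text \<open>Moves generated subalgebras to the operator side; by faithfulness, membership may be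
  tested on images.\<close>

lemma subalg_adjoin:
  assumes S: "S \<subseteq> carrier (uea s br H)"
  shows "uea_adjoin s br H S \<subseteq> carrier (uea s br H)"
    and "subalg (Phi ` uea_adjoin s br H S)" and "S \<subseteq> uea_adjoin s br H S"
    and "X \<in> carrier (uea s br H) \<Longrightarrow> Phi X \<in> Phi ` uea_adjoin s br H S \<Longrightarrow> X \<in> uea_adjoin s br H S"
proof -
  interpret ring "uea s br H" by (rule ring_uea[OF subalgebra_H])
  let ?T = "uea_adjoin s br H S"
  have "range (uea_const s br H) \<union> S \<subseteq> carrier (uea s br H)"
    using S const_closed by blast
  then show T: "?T \<subseteq> carrier (uea s br H)"
    unfolding uea_adjoin_def by (rule generate_ring_incl)
  show "S \<subseteq> ?T" unfolding uea_adjoin_def by (auto intro: generate_ring.incl)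
  show "X \<in> ?T" if X: "X \<in> carrier (uea s br H)" "Phi X \<in> Phi ` ?T"
  proof -
    obtain Y where Y: "Y \<in> ?T" "Phi X = Phi Y" using X(2) by blast
    then have "X = Y" using Phi_inj[OF X(1)] T by blast
    then show ?thesis using Y by simp
  qed
  show "subalg (Phi ` ?T)"
    unfolding subalg_def
  proof (intro conjI allI ballI)
    fix k
    have "uea_const s br H k \<in> ?T" unfolding uea_adjoin_def by (auto intro: generate_ring.incl)
    then show "Cst k \<in> Phi ` ?T" by (rule rev_image_eqI) (simp add: Phi_const[OF subalgebra_H])
  next
    fix v w assume "v \<in> Phi ` ?T" "w \<in> Phi ` ?T"
    then obtain X Y where XY: "X \<in> ?T" "v = Phi X" "Y \<in> ?T" "w = Phi Y" by blast
    then have c: "X \<in> carrier (uea s br H)" "Y \<in> carrier (uea s br H)" using T by blast+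
    have "X \<oplus>\<^bsub>uea s br H\<^esub> Y \<in> ?T"
      using XY unfolding uea_adjoin_def by (auto intro: generate_ring.eng_add)
    then show "v + w \<in> Phi ` ?T"
      by (rule rev_image_eqI) (simp add: XY Phi_ops(1)[OF subalgebra_H c])
    have "X \<otimes>\<^bsub>uea s br H\<^esub> Y \<in> ?T"
      using XY unfolding uea_adjoin_def by (auto intro: generate_ring.eng_mult)
    then show "v * w \<in> Phi ` ?T"
      by (rule rev_image_eqI) (simp add: XY Phi_ops(2)[OF subalgebra_H c])
  qed
qed

lemma subalg_minus:
  assumes "subalg B" "w \<in> B" shows "- w \<in> B"
proof -
  have "Cst (- 1) * w \<in> B" using assms by (simp add: subalg_def)
  then show ?thesis by (simp add: kS_minus MS_minus)
qed

lemma subalg_const_alg: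
  assumes B: "subalg B" and "MS (va ^ 3) \<in> B" "MS (vb ^ 3) \<in> B" "MS (vc ^ 3) \<in> B" "MS (va * vq) \<in> B"
    and "r \<in> const_alg"
  shows "MS r \<in> B"
  using assms(6) by induct (use assms in \<open>auto simp: subalg_def MS_add MS_mult[of _ "_ :: 'f sym"]\<close>)

lemma subalg_pev:
  assumes B: "subalg B" and Z: "Z \<in> B" and h: "\<And>i. MS (coeff h i) \<in> B"
  shows "pev MS Z h \<in> B"
  using h
proof (induct h)
  case 0
  have "Cst 0 \<in> B" using B unfolding subalg_def by blast
  then show ?case by simp
next
  case (pCons r h)
  have "MS r \<in> B" using pCons(3)[of 0] by simp
  moreover have "pev MS Z h \<in> B" using pCons(2) pCons(3)[of "Suc _"] by simp
  ultimately show ?case using B Z by (simp add: pev_pCons subalg_def)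
qed

lemma const_alg_V: "r \<in> const_alg \<Longrightarrow> MS r \<in> V 0"
proof -
  have three: "(3 :: 'f sym) = 0" by (rule char3_sym[OF char3])
  assume "r \<in> const_alg"
  then have "Dy r = 0"
  proof induct
    case aq
    have "Dy (va * vq) = 3 * (va * vq :: 'f sym)"
      by (simp add: Dy_rules Dy_eq[of vq] Dnil_vq[OF char3])
    then show ?case using three by simp
  qed (simp_all add: Dy_rules derivation_power[OF derivation_Dy] three)
  then show ?thesis using V_MS[of r 0] by simp
qed

text \<open>All three weights in \<open>semi_invariant_normal_form\<close> are 0, so the
  coefficients are constants of \<open>Dy\<close> and lie in \<open>const_alg\<close>.\<close>

lemma V_0_generated:
  assumes B: "subalg B" and "MS (va ^ 3) \<in> B" "MS (vb ^ 3) \<in> B" "MS (vc ^ 3) \<in> B" "MS (va * vq) \<in> B"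
    and Z: "Th ^ 9 - Th ^ 3 \<in> B" and w: "w \<in> V 0"
  shows "w \<in> B"
proof -
  obtain p where p: "w = act p" using w by (auto simp: V_def)
  have "MS va * act p - act p * MS va = Cst 0 * act p" "MS vb * act p - act p * MS vb = Cst 0 * act p"
    "Th * act p - act p * Th = Cst 0 * act p"
    using w unfolding p V_def by simp_all
  then obtain h where h: "p = pcompose h zpoly" "\<And>i. Dy (coeff h i) = kS 0 * coeff h i"
    by (rule semi_invariant_normal_form[OF char3]) blast
  have "MS (coeff h i) \<in> B" for i
    using subalg_const_alg[OF assms(1-5) Dy_const_alg[OF char3]] h(2)[of i] by simp
  then show ?thesis unfolding p h(1) act_pcompose_zpoly by (rule subalg_pev[OF B Z])
qed

text \<open>The normal form has coefficients that are eigenvectors of \<open>Dy\<close>. These lie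
  in \<open>semi_alg\<close>, which a and q generate over \<open>const_alg\<close>.\<close>

lemma weight_vector_generated:
  assumes B: "subalg B" and V0: "V 0 \<subseteq> B" and "MS va \<in> B" "MS vq \<in> B"
    and X: "X \<in> weight_space s br H \<mu>"
  shows "Phi X \<in> B"
proof -
  have "X \<in> carrier (uea s br H)" using X by (simp add: weight_space_def)
  then obtain p where p: "Phi X = act p" using Phi_range by blast
  note w = weight_space_Phi[OF subalgebra_H X]
  obtain h where h: "p = pcompose h zpoly" "\<And>i. Dy (coeff h i) = kS (\<mu> y) * coeff h i"
    by (rule semi_invariant_normal_form[OF char3 w[OF mem_H'(1), unfolded p op_abc]
        w[OF mem_H'(2), unfolded p op_abc] w[OF mem_H(1), unfolded p op_basis]]) blast
  have "MS r \<in> B" if r: "r \<in> semi_alg" for r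
  proof -
    obtain s0 s1 s2 s3 s4 where
      si: "s0 \<in> const_alg" "s1 \<in> const_alg" "s2 \<in> const_alg" "s3 \<in> const_alg" "s4 \<in> const_alg"
      and eq: "r = s0 + s1 * va + s2 * va\<^sup>2 + s3 * vq + s4 * vq\<^sup>2"
      using r by (elim semi_algE)
    have "MS s0 \<in> B" "MS s1 \<in> B" "MS s2 \<in> B" "MS s3 \<in> B" "MS s4 \<in> B"
      using si const_alg_V V0 by blast+
    then show ?thesis
      using B assms(3,4) by (simp only: eq subalg_def MS_add MS_mult power2_eq_square)
  qed
  then have "MS (coeff h i) \<in> B" for i
    using Dy_eigen_semi_alg[OF char3 h(2)] by blast
  moreover have "Th ^ 9 - Th ^ 3 \<in> B" using V_Z V0 by blast
  ultimately show ?thesis unfolding p h(1) act_pcompose_zpoly using subalg_pev[OF B] by blast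
qed

section \<open>The centre of U(H)\<close>

abbreviation (input) "UH \<equiv> uea s br H :: ('l, 'f) falg set ring"
abbreviation (input) "\<iota> \<equiv> uea_emb s br H :: 'l \<Rightarrow> ('l, 'f) falg set"

lemma iota: "\<iota> y \<in> carrier UH" "\<iota> e1 \<in> carrier UH" "\<iota> e2 \<in> carrier UH" "\<iota> e3 \<in> carrier UH"
  "Phi (\<iota> y) = Th" "Phi (\<iota> e1) = MS (va - vb + vc)" "Phi (\<iota> e2) = MS (vb + vc)" "Phi (\<iota> e3) = MS vc"
  by (simp_all add: emb_closed mem_H Phi_emb subalgebra_H op_basis)

lemma char3_S: "(3 :: 'f sym) = 0"
  by (rule char3_sym[OF char3])

lemma cube_add: "(p + q) ^ 3 = p ^ 3 + q ^ 3" for p q :: "'f sym"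
proof -
  have "(p + q) ^ 3 = p ^ 3 + q ^ 3 + 3 * (p\<^sup>2 * q + p * q\<^sup>2)"
    by (simp add: power3_eq_cube power2_eq_square algebra_simps)
  then show ?thesis using char3_S by simp
qed

lemma cube_diff: "(p - q) ^ 3 = p ^ 3 - q ^ 3" for p q :: "'f sym"
  using cube_add[of p "- q"] by simp

definition center_gens :: "('l, 'f) falg set set"
  where "center_gens =
    {(\<iota> y [^]\<^bsub>UH\<^esub> (9::nat)) \<ominus>\<^bsub>UH\<^esub> (\<iota> y [^]\<^bsub>UH\<^esub> (3::nat)),
     \<iota> e1 [^]\<^bsub>UH\<^esub> (3::nat), \<iota> e2 [^]\<^bsub>UH\<^esub> (3::nat), \<iota> e3 [^]\<^bsub>UH\<^esub> (3::nat),
     (\<iota> e1 \<otimes>\<^bsub>UH\<^esub> (\<iota> e2 [^]\<^bsub>UH\<^esub> (2::nat))) \<oplus>\<^bsub>UH\<^esub> ((\<iota> e1 [^]\<^bsub>UH\<^esub> (2::nat)) \<otimes>\<^bsub>UH\<^esub> \<iota> e3)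
       \<oplus>\<^bsub>UH\<^esub> (\<iota> e2 \<otimes>\<^bsub>UH\<^esub> (\<iota> e3 [^]\<^bsub>UH\<^esub> (2::nat)))}"

lemma center_gens_closed: "center_gens \<subseteq> carrier UH"
  by (simp add: center_gens_def uea_closed subalgebra_H iota)

text \<open>In the variables a, b, c the cubic generator becomes a q - b^3, up to a multiple of
  3.\<close>

lemma Phi_center_gens:
  "Phi ` center_gens = {Th ^ 9 - Th ^ 3, MS ((va - vb + vc) ^ 3), MS ((vb + vc) ^ 3), MS (vc ^ 3),
    MS (va * vq - vb ^ 3)}"
proof -
  have "(va - vb + vc) * (vb + vc)\<^sup>2 + (va - vb + vc)\<^sup>2 * vc + (vb + vc) * vc\<^sup>2 =
      va * vq - vb ^ 3 + 3 * (va * vc\<^sup>2 + vc ^ 3 :: 'f sym)"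
    by (simp add: vq_def power2_eq_square power3_eq_cube algebra_simps)
  then have eq: "va * vq - vb ^ 3 =
      (va - vb + vc) * (vb + vc)\<^sup>2 + (va - vb + vc)\<^sup>2 * vc + (vb + vc) * (vc\<^sup>2 :: 'f sym)"
    using char3_S by simp
  show ?thesis
    unfolding eq center_gens_def
    by (simp only: image_insert image_empty Phi_ops uea_closed subalgebra_H iota MS_add MS_mult MS_power)
qed

lemma center_eq: "ring_center UH = uea_adjoin s br H center_gens"
proof
  let ?T = "uea_adjoin s br H center_gens"
  note T = subalg_adjoin[OF center_gens_closed]
  let ?B = "Phi ` ?T"
  have B: "v + w \<in> ?B" "v - w \<in> ?B" if "v \<in> ?B" "w \<in> ?B" for v w
  proof -
    show "v + w \<in> ?B" using T(2) that unfolding subalg_def by blast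
    have "v + - w \<in> ?B" using T(2) that subalg_minus[OF T(2) that(2)] unfolding subalg_def by blast
    then show "v - w \<in> ?B" by simp
  qed
  have "Phi ` center_gens \<subseteq> ?B" using T(3) by blast
  then have g: "Th ^ 9 - Th ^ 3 \<in> ?B" "MS ((va - vb + vc) ^ 3) \<in> ?B" "MS ((vb + vc) ^ 3) \<in> ?B"
    "MS (vc ^ 3) \<in> ?B" "MS (va * vq - vb ^ 3) \<in> ?B"
    unfolding Phi_center_gens by simp_all
  \<comment> \<open>Cubing is additive, so b^3 = e2^3 - e3^3 and a^3 = e1^3 + b^3 - c^3; adding b^3
    to the cubic generator gives a q.\<close>
  have b: "MS (vb ^ 3) \<in> ?B"
    using B(2)[OF g(3,4)] by (simp add: cube_add MS_add)
  have a: "MS (va ^ 3) \<in> ?B"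
    using B(2)[OF B(1)[OF g(2) b] g(4)] by (simp add: cube_add cube_diff MS_add MS_diff)
  have q: "MS (va * vq) \<in> ?B"
    using B(1)[OF g(5) b] by (simp add: MS_diff)
  show "ring_center UH \<subseteq> ?T"
    using V_0_generated[OF T(2) a b g(4) q g(1)] T(4) center_V by blast
  have V: "Phi X \<in> V 0" if "X \<in> center_gens" for X
  proof -
    have m: "MS t \<in> V 0" if "Dy t = 0" for t using V_MS[of t 0] that by simp
    \<comment> \<open>The derivative of a cube carries the factor 3.\<close>
    have cube: "MS (t ^ 3) \<in> V 0" for t
      by (rule m) (simp add: derivation_power[OF derivation_Dy] char3_S)
    have "MS (va * vq - vb ^ 3) \<in> V 0"
      using V_add[OF const_alg_V[OF const_alg.aq] V_minus[OF cube[of vb]]] by (simp add: MS_diff)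
    then have "Phi ` center_gens \<subseteq> V 0"
      unfolding Phi_center_gens using V_Z cube by blast
    then show ?thesis using that by blast
  qed
  show "?T \<subseteq> ring_center UH"
  proof
    fix X assume X: "X \<in> ?T"
    then have "X \<in> generate_ring UH (range (uea_const s br H) \<union> center_gens)"
      by (simp add: uea_adjoin_def)
    then have "X \<in> carrier UH \<and> Phi X \<in> V 0"
    proof induct
      case one
      show ?case
        using V_MS[of 1 0] derivation_1[OF derivation_Dy] by (simp add: uea_closed Phi_ops subalgebra_H)
    next
      case (incl h)
      then show ?case using center_gens_closed V V_MS[of "kS _" 0]
        by (auto simp: const_closed Phi_const subalgebra_H)
    next
      case (eng_mult h1 h2)
      then show ?case using V_mult[of "Phi h1" 0 "Phi h2" 0] by (simp add: uea_closed Phi_ops subalgebra_H)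
    qed (simp_all add: uea_closed Phi_ops subalgebra_H V_add V_minus)
    then show "X \<in> ring_center UH" using center_V by blast
  qed
qed

section \<open>The semi-centre of U(H)\<close>

definition u :: "('l, 'f) falg set" where "u = \<iota> e1 \<oplus>\<^bsub>UH\<^esub> \<iota> e2 \<oplus>\<^bsub>UH\<^esub> \<iota> e3"
definition v :: "('l, 'f) falg set" where
  "v = (\<iota> e2 [^]\<^bsub>UH\<^esub> (2::nat)) \<oplus>\<^bsub>UH\<^esub> (\<iota> e1 \<otimes>\<^bsub>UH\<^esub> \<iota> e3)
      \<oplus>\<^bsub>UH\<^esub> uea_scale s br H 2 (\<iota> e2 \<otimes>\<^bsub>UH\<^esub> \<iota> e3) \<oplus>\<^bsub>UH\<^esub> uea_scale s br H 2 (\<iota> e3 [^]\<^bsub>UH\<^esub> (2::nat))"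

lemma uv_closed: "u \<in> carrier UH" "v \<in> carrier UH"
  by (simp_all add: u_def v_def uea_closed scale_closed subalgebra_H iota)

lemma Phi_u: "Phi u = MS va"
proof -
  have "(va - vb + vc) + (vb + vc) + vc = va + 3 * (vc :: 'f sym)" by simp
  then show ?thesis
    using char3_S
    by (simp only: u_def Phi_ops uea_closed subalgebra_H iota MS_add[symmetric]) simp
qed

lemma Phi_v: "Phi v = MS vq"
proof -
  have two: "kS 2 = (2 :: 'f sym)"
    using kS_add[of 1 "1::'f"] by simp
  have "(vb + vc)\<^sup>2 + (va - vb + vc) * vc + kS 2 * ((vb + vc) * vc) + kS 2 * vc\<^sup>2 =
      vq + 3 * (vb * vc + 2 * vc\<^sup>2 :: 'f sym)"
    unfolding two by (simp add: vq_def power2_eq_square algebra_simps)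
  then have "(vb + vc)\<^sup>2 + (va - vb + vc) * vc + kS 2 * ((vb + vc) * vc) + kS 2 * vc\<^sup>2 = (vq :: 'f sym)"
    using char3_S by simp
  then show ?thesis
    by (simp only: v_def Phi_ops uea_closed Phi_scale scale_closed subalgebra_H iota
        MS_add[symmetric] MS_mult[symmetric] MS_power[symmetric])
qed

lemma Phi_u_V: "Phi u \<in> V 1" and Phi_v_V: "Phi v \<in> V 2"
proof -
  show "Phi u \<in> V 1" unfolding Phi_u by (rule V_MS) simp
  have two: "kS 2 = (2 :: 'f sym)"
    using kS_add[of 1 "1::'f"] by simp
  show "Phi v \<in> V 2"
    unfolding Phi_v by (rule V_MS) (simp add: two Dy_eq[of vq] Dnil_vq[OF char3])
qed

text \<open>\<open>weight_vector_generated\<close> places each weight vector in the adjoined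
  algebra, which is closed under finite sums.\<close>

lemma semi_center_subset:
  "semi_center s br H \<subseteq> uea_adjoin s br H (ring_center UH \<union> {u, v})"
proof -
  have S: "ring_center UH \<union> {u, v} \<subseteq> carrier UH"
    using uv_closed by (auto simp: ring_center_def)
  let ?T = "uea_adjoin s br H (ring_center UH \<union> {u, v})"
  note T = subalg_adjoin[OF S]
  have V0: "V 0 \<subseteq> Phi ` ?T"
  proof
    fix w assume "w \<in> V 0"
    then obtain X where "X \<in> carrier UH" "Phi X = w" by (rule V_range)
    then have "X \<in> ?T" using center_V \<open>w \<in> V 0\<close> T(3) by blast
    then show "w \<in> Phi ` ?T" using \<open>Phi X = w\<close> by blast
  qed
  have uv: "MS va \<in> Phi ` ?T" "MS vq \<in> Phi ` ?T"
    unfolding Phi_u[symmetric] Phi_v[symmetric] using T(3) by (intro imageI; blast)+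
  have weight: "X \<in> ?T" if "X \<in> weight_space s br H \<mu>" for X \<mu>
    using T(4) weight_vector_generated[OF T(2) V0 uv that] that by (auto simp: weight_space_def)
  interpret ring UH by (rule ring_uea[OF subalgebra_H])
  have sum: "finsum UH w M \<in> ?T"
    if "finite M" "\<And>\<mu>. \<mu> \<in> M \<Longrightarrow> w \<mu> \<in> ?T" for w and M :: "('l \<Rightarrow> 'f) set"
    using that
  proof induct
    case empty
    show ?case by (simp add: uea_adjoin_def zero_in_generate)
  next
    case (insert \<mu> M)
    have "w \<in> M \<rightarrow> carrier UH" "w \<mu> \<in> carrier UH" using insert(4) T(1) by auto
    then have "finsum UH w (insert \<mu> M) = w \<mu> \<oplus>\<^bsub>UH\<^esub> finsum UH w M"
      using insert(1,2) by simp
    also have "\<dots> \<in> ?T"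
      using insert(3,4) unfolding uea_adjoin_def by (intro generate_ring.eng_add) auto
    finally show ?case .
  qed
  show ?thesis
  proof
    fix X assume "X \<in> semi_center s br H"
    then obtain w M where "X = finsum UH w M" "finite M" "\<forall>\<mu>\<in>M. w \<mu> \<in> weight_space s br H \<mu>"
      unfolding semi_center_def by blast
    then show "X \<in> ?T" using sum[of M w] weight by blast
  qed
qed

lemma two_ne_0: "(2::'f) \<noteq> 0"
  using of_nat_eq_0_char3[OF char3, of 2] by simp

text \<open>The weights 0, 1, 2 form the additive group of the prime field, so V 0 + V 1 + V 2 is a
  subalgebra containing all generators. Its elements are sums of weight vectors for the zero form,
  \<mu>1 and \<mu>2.\<close>

lemma semi_center_superset:
  assumes \<mu>: "linear_form_on s H \<mu>1" "\<mu>1 y = 1" "\<And>k. k \<in> K \<Longrightarrow> \<mu>1 k = 0"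
    "linear_form_on s H \<mu>2" "\<mu>2 y = 2" "\<And>k. k \<in> K \<Longrightarrow> \<mu>2 k = 0"
  shows "uea_adjoin s br H (ring_center UH \<union> {u, v}) \<subseteq> semi_center s br H"
proof
  interpret ring UH by (rule ring_uea[OF subalgebra_H])
  define \<mu>0 :: "'l \<Rightarrow> 'f" where "\<mu>0 = (\<lambda>_. 0)"
  have \<mu>0: "linear_form_on s H \<mu>0" "\<mu>0 y = 0" "\<And>k. k \<in> K \<Longrightarrow> \<mu>0 k = 0"
    by (simp_all add: \<mu>0_def linear_form_on_def)
  let ?V = "{w0 + w1 + w2 | w0 w1 w2. w0 \<in> V 0 \<and> w1 \<in> V 1 \<and> w2 \<in> V 2}"
  have V: "w0 + w1 + w2 \<in> ?V" if "w0 \<in> V 0" "w1 \<in> V 1" "w2 \<in> V 2" for w0 w1 w2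
    using that by blast
  have Vi: "w \<in> ?V" if "w \<in> V 0 \<union> V 1 \<union> V 2" for w
    using that V[of w 0 0] V[of 0 w 0] V[of 0 0 w] V_0 by auto
  fix X assume "X \<in> uea_adjoin s br H (ring_center UH \<union> {u, v})"
  then have "X \<in> generate_ring UH (range (uea_const s br H) \<union> (ring_center UH \<union> {u, v}))"
    by (simp add: uea_adjoin_def)
  then have "X \<in> carrier UH \<and> Phi X \<in> ?V"
  proof induct
    case one
    have "1 \<in> V 0" using V_MS[of 1 0] derivation_1[OF derivation_Dy] by simp
    then show ?case using Vi[of 1] by (simp only: Phi_ops uea_closed subalgebra_H) blast
  next
    case (incl h)
    then consider k where "h = uea_const s br H k" | "h \<in> ring_center UH" | "h = u" | "h = v" by blast
    then show ?case
    proof cases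
      case (1 k)
      have "Cst k \<in> V 0" using V_MS[of "kS k" 0] by simp
      then have "Phi h \<in> ?V" using Vi 1 by (simp only: Phi_const[OF subalgebra_H]) blast
      then show ?thesis using 1 const_closed by blast
    next
      case 2
      then show ?thesis using center_V Vi by blast
    next
      case 3
      then show ?thesis using Phi_u_V Vi uv_closed by blast
    next
      case 4
      then show ?thesis using Phi_v_V Vi uv_closed by blast
    qed
  next
    case (a_inv h)
    then obtain w0 w1 w2 where w: "Phi h = w0 + w1 + w2" "w0 \<in> V 0" "w1 \<in> V 1" "w2 \<in> V 2" by blast
    have "Phi (\<ominus>\<^bsub>UH\<^esub> h) = - w0 + - w1 + - w2"
      using a_inv w(1) by (simp add: Phi_ops subalgebra_H)
    then show ?case using V[OF w(2-4)[THEN V_minus]] a_inv by simp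
  next
    case (eng_add h h')
    then obtain w0 w1 w2 w0' w1' w2' where w: "Phi h = w0 + w1 + w2" "w0 \<in> V 0" "w1 \<in> V 1" "w2 \<in> V 2"
      and w': "Phi h' = w0' + w1' + w2'" "w0' \<in> V 0" "w1' \<in> V 1" "w2' \<in> V 2" by blast
    have "Phi (h \<oplus>\<^bsub>UH\<^esub> h') = (w0 + w0') + (w1 + w1') + (w2 + w2')"
      using eng_add w(1) w'(1) by (simp add: Phi_ops subalgebra_H)
    then show ?case
      using V[OF V_add[OF w(2) w'(2)] V_add[OF w(3) w'(3)] V_add[OF w(4) w'(4)]] eng_add by simp
  next
    case (eng_mult h h')
    then obtain w0 w1 w2 w0' w1' w2' where w: "Phi h = w0 + w1 + w2" "w0 \<in> V 0" "w1 \<in> V 1" "w2 \<in> V 2"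
      and w': "Phi h' = w0' + w1' + w2'" "w0' \<in> V 0" "w1' \<in> V 1" "w2' \<in> V 2" by blast
    have n: "0 + 0 = (0::'f)" "1 + 2 = (0::'f)" "2 + 1 = (0::'f)" "0 + 1 = (1::'f)" "1 + 0 = (1::'f)"
      "2 + 2 = (1::'f)" "0 + 2 = (2::'f)" "2 + 0 = (2::'f)" "1 + 1 = (2::'f)"
    proof -
      have "(4::'f) = 3 + 1" by simp
      then show "2 + 2 = (1::'f)" using char3 by simp
    qed (use char3 in simp_all)
    have p: "w0 * w0' + w1 * w2' + w2 * w1' \<in> V 0" "w0 * w1' + w1 * w0' + w2 * w2' \<in> V 1"
      "w0 * w2' + w2 * w0' + w1 * w1' \<in> V 2"
      using V_mult[OF w(2) w'(2)] V_mult[OF w(3) w'(4)] V_mult[OF w(4) w'(3)]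
        V_mult[OF w(2) w'(3)] V_mult[OF w(3) w'(2)] V_mult[OF w(4) w'(4)]
        V_mult[OF w(2) w'(4)] V_mult[OF w(4) w'(2)] V_mult[OF w(3) w'(3)]
      unfolding n by (simp_all only: V_add)
    have "Phi (h \<otimes>\<^bsub>UH\<^esub> h') = (w0 * w0' + w1 * w2' + w2 * w1') + (w0 * w1' + w1 * w0' + w2 * w2') +
        (w0 * w2' + w2 * w0' + w1 * w1')"
      using eng_mult w(1) w'(1) by (simp add: Phi_ops subalgebra_H algebra_simps)
    then show ?case using V[OF p] eng_mult by simp
  qed
  then obtain w0 w1 w2 where X: "X \<in> carrier UH" "Phi X = w0 + w1 + w2"
    and w: "w0 \<in> V 0" "w1 \<in> V 1" "w2 \<in> V 2" by blast
  obtain X0 X1 X2 where X0: "X0 \<in> carrier UH" "Phi X0 = w0" and X1: "X1 \<in> carrier UH" "Phi X1 = w1"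
    and X2: "X2 \<in> carrier UH" "Phi X2 = w2"
    using V_range w by metis
  have ws: "X0 \<in> weight_space s br H \<mu>0" "X1 \<in> weight_space s br H \<mu>1" "X2 \<in> weight_space s br H \<mu>2"
    using weight_space_V[OF X0(1) \<mu>0] weight_space_V[OF X1(1) \<mu>(1-3)] weight_space_V[OF X2(1) \<mu>(4-6)]
      X0 X1 X2 w by simp_all
  \<comment> \<open>The three forms take different values at y, so the sum over the set of forms has
    exactly the three intended terms.\<close>
  have "(2::'f) \<noteq> 1" using one_add_one[where 'a = 'f] by (metis add_cancel_right_left zero_neq_one)
  then have dist: "\<mu>0 \<noteq> \<mu>1" "\<mu>0 \<noteq> \<mu>2" "\<mu>1 \<noteq> \<mu>2"
    using \<mu>0(2) \<mu>(2,5) two_ne_0 by (metis zero_neq_one)+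
  define f where "f \<mu> = (if \<mu> = \<mu>0 then X0 else if \<mu> = \<mu>1 then X1 else X2)" for \<mu>
  have f: "f \<mu>0 = X0" "f \<mu>1 = X1" "f \<mu>2 = X2" using dist by (auto simp: f_def)
  have "X = X0 \<oplus>\<^bsub>UH\<^esub> (X1 \<oplus>\<^bsub>UH\<^esub> X2)"
    by (rule Phi_inj) (simp_all add: X X0 X1 X2 Phi_ops subalgebra_H add.assoc)
  also have "\<dots> = finsum UH f {\<mu>0, \<mu>1, \<mu>2}"
    using dist X0 X1 X2 by (simp add: f)
  finally have "X = finsum UH f {\<mu>0, \<mu>1, \<mu>2}" .
  moreover have "\<forall>\<mu>'\<in>{\<mu>0, \<mu>1, \<mu>2}. linear_form_on s H \<mu>' \<and> f \<mu>' \<in> weight_space s br H \<mu>'"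
    using ws f \<mu> \<mu>0 by auto
  ultimately show "X \<in> semi_center s br H"
    unfolding semi_center_def mem_Collect_eq by (metis finite.emptyI finite.insertI)
qed

section \<open>The action of \<open>x\<close>\<close>

text \<open>The ideal for H lies in the ideal for L and contains 0, so adding it to a coset of the
  latter changes nothing.\<close>

lemma uea_incl_cls:
  assumes p: "p \<in> carrier (free_algebra H)"
  shows "uea_incl s br UNIV (cls H p) = cls UNIV p"
proof -
  interpret ideal "uea_ideal s br UNIV" "free_algebra UNIV :: ('l, 'f) falg ring"
    by (rule ideal_uea_ideal[OF subalgebra_UNIV])
  interpret h: ring_hom_ring "free_algebra H" "uea s br UNIV" "\<lambda>p. cls UNIV p"
  proof (rule ring_hom_ringI[OF ring_free_algebra ring_uea[OF subalgebra_UNIV]])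
    have U: "q \<in> carrier (free_algebra UNIV)" for q :: "('l, 'f) falg" by (simp add: mem_free_algebra)
    note r = ring_hom_memE[OF rcos_ring_hom]
    fix q q' :: "('l, 'f) falg"
    show "cls UNIV q \<in> carrier (uea s br UNIV)" using r(1)[OF U] by (simp add: uea_def)
    show "cls UNIV (q \<otimes>\<^bsub>free_algebra H\<^esub> q') = cls UNIV q \<otimes>\<^bsub>uea s br UNIV\<^esub> cls UNIV q'"
      using r(2)[OF U U] by (simp add: uea_def)
    show "cls UNIV (q \<oplus>\<^bsub>free_algebra H\<^esub> q') = cls UNIV q \<oplus>\<^bsub>uea s br UNIV\<^esub> cls UNIV q'"
      using r(3)[OF U U] by (simp add: uea_def)
    show "cls UNIV \<one>\<^bsub>free_algebra H\<^esub> = \<one>\<^bsub>uea s br UNIV\<^esub>"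
      using r(4) by (simp add: uea_def)
  qed
  have zero: "\<zero>\<^bsub>uea s br UNIV\<^esub> = uea_ideal s br UNIV" by (simp add: uea_def FactRing_def)
  \<comment> \<open>Minimality concerns ideals of the free algebra on \<open>H\<close>, so the ideal
    of L enters through the kernel of the map from that algebra to U(L).\<close>
  have "uea_ideal s br H \<subseteq> a_kernel (free_algebra H) (uea s br UNIV) (\<lambda>p. cls UNIV p)"
  proof (rule uea_ideal_minimal[OF h.kernel_is_ideal])
    have "cls UNIV q = uea_ideal s br UNIV" if "q \<in> uea_relations s br H" for q
    proof -
      have "q \<in> uea_relations s br UNIV" using that unfolding uea_relations_def by blast
      then have "q \<in> uea_ideal s br UNIV" using relations_uea_ideal[OF subalgebra_UNIV] by blast
      then show ?thesis by (rule a_rcos_const)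
    qed
    then show "uea_relations s br H \<subseteq> a_kernel (free_algebra H) (uea s br UNIV) (\<lambda>p. cls UNIV p)"
      using relations_closed[OF subalgebra_H] unfolding a_kernel_def' zero by blast
  qed
  then have sub: "uea_ideal s br H \<subseteq> uea_ideal s br UNIV"
    unfolding a_kernel_def' zero using rcos_const_imp_mem[unfolded mem_free_algebra] by auto
  have z: "0 \<in> uea_ideal s br H" by (rule rc.I_0)
  have a: "i + j \<in> uea_ideal s br UNIV" if "i \<in> uea_ideal s br UNIV" "j \<in> uea_ideal s br UNIV" for i j
    using additive_subgroup.a_closed[OF is_additive_subgroup that] by simp
  show ?thesis
    unfolding uea_incl_def set_add_def' a_r_coset_def'
    using sub a z by (auto simp: add.assoc[symmetric])
qed

lemma uea_incl_closed: "X \<in> carrier UH \<Longrightarrow> uea_incl s br UNIV X \<in> carrier (uea s br UNIV)"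
  and Phi_uea_incl: "X \<in> carrier UH \<Longrightarrow> Phi (uea_incl s br UNIV X) = Phi X"
proof -
  assume "X \<in> carrier UH"
  then obtain p where p: "p \<in> carrier (free_algebra H)" "X = cls H p" using uea_carrier by blast
  have U: "p \<in> carrier (free_algebra UNIV)" by (simp add: mem_free_algebra)
  show "uea_incl s br UNIV X \<in> carrier (uea s br UNIV)"
    unfolding p(2) uea_incl_cls[OF p(1)] uea_carrier by (rule bexI[of _ p]) (simp_all add: U)
  show "Phi (uea_incl s br UNIV X) = Phi X"
    unfolding p(2) uea_incl_cls[OF p(1)] by (simp add: Phi_cls p U subalgebra_UNIV subalgebra_H)
qed

lemma Phi_ad_x:
  assumes "X \<in> carrier UH"
  shows "Phi (ring_commutator (uea s br UNIV) (uea_emb s br UNIV x) (uea_incl s br UNIV X)) =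
    Xi * Phi X - Phi X * Xi"
  using assms by (simp add: Phi_commutator subalgebra_UNIV emb_closed uea_incl_closed Phi_emb op_basis
      Phi_uea_incl)

lemma not_ad_stable:
  assumes X: "X \<in> weight_space s br H \<mu>" "Phi X = MS t" "Dy t = kS (\<mu> y) * t" "t \<noteq> 0" "\<mu> y \<noteq> 0"
  shows "\<not> ad_stable s br UNIV (uea_incl s br UNIV ` weight_space s br H \<mu>)"
proof
  assume st: "ad_stable s br UNIV (uea_incl s br UNIV ` weight_space s br H \<mu>)"
  have c: "Z \<in> carrier UH" if "Z \<in> weight_space s br H \<mu>" for Z
    using that by (simp add: weight_space_def)
  obtain Z where Z: "Z \<in> weight_space s br H \<mu>"
    and eq: "ring_commutator (uea s br UNIV) (uea_emb s br UNIV x) (uea_incl s br UNIV X) = uea_incl s br UNIV Z"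
    using st X(1) unfolding ad_stable_def by blast
  have "Phi Z = Xi * MS t - MS t * Xi"
    using arg_cong[OF eq, of Phi] by (simp add: Phi_ad_x c X Z Phi_uea_incl)
  then have "Phi Z = MS (Dx t)" by (simp add: Xi_MS)
  moreover have "Th * Phi Z - Phi Z * Th = Cst (\<mu> y) * Phi Z"
    using weight_space_Phi[OF subalgebra_H Z mem_H(1)] by (simp add: op_basis)
  ultimately have "MS (Dy (Dx t)) = MS (kS (\<mu> y) * Dx t)" by (simp add: Th_MS MS_mult)
  then have "Dy (Dx t) = kS (\<mu> y) * Dx t" by (simp add: MS_inj)
  moreover have "Dx (Dy t) = kS (\<mu> y) * Dx t" by (simp add: X(3) Dx_rules)
  \<comment> \<open>Both composites of \<open>Dx\<close> and \<open>Dy\<close> send \<open>t\<close>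
    to the same multiple of \<open>Dx t\<close>, so \<open>Dx_Dy\<close> makes 2 \<open>Dy t\<close>
    vanish.\<close>
  ultimately have "2 * (kS (\<mu> y) * t) = 0" using Dx_Dy[OF char3, of t] X(3) by simp
  moreover have "kS (\<mu> y) \<noteq> 0" using X(5) kS_inj[of "\<mu> y" 0] by simp
  moreover have "(2 :: 'f sym) \<noteq> 0"
    using of_nat_eq_0_char3[OF char3_S, of 2] by simp
  ultimately show False using X(4) by simp
qed

text \<open>The bracket of x with u = a is b, which is not a scalar multiple of a.\<close>

lemma u_not_semi_invariant: "\<not> semi_invariant s br UNIV (uea_incl s br UNIV u)"
proof
  assume "semi_invariant s br UNIV (uea_incl s br UNIV u)"
  then obtain \<mu> where "uea_incl s br UNIV u \<in> weight_space s br UNIV \<mu>"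
    unfolding semi_invariant_def by blast
  from weight_space_Phi[OF subalgebra_UNIV this, of x]
  have "Xi * MS va - MS va * Xi = Cst (\<mu> x) * MS va"
    by (simp add: op_basis Phi_uea_incl uv_closed Phi_u)
  then have "MS vb = MS (kS (\<mu> x) * va)" by (simp add: Xi_MS MS_mult)
  then have "vb = kS (\<mu> x) * va" by (simp add: MS_inj)
  then show False by (simp add: va_def vb_def kS_def)
qed

lemma dim_H: "vector_space.dim s (UNIV :: 'l set) = vector_space.dim s H + 1"
proof -
  have "dim UNIV = card {x, y, e1, e2, e3}"
    by (rule dim_eq_card[OF _ indep]) (simp add: span_UNIV)
  moreover have "independent {y, e1, e2, e3}" by (rule independent_mono[OF indep]) auto
  then have "dim H = card {y, e1, e2, e3}" unfolding H_def by (rule dim_span_eq_card_independent)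
  ultimately show ?thesis using dist by simp
qed

lemma L_decomp: "(UNIV :: 'l set) = {s a x + h | a h. h \<in> H}"
proof -
  have "\<exists>a. w - s a x \<in> H" for w
    using span_UNIV unfolding H_def span_insert[of x] by blast
  then show ?thesis by (auto simp: set_eq_iff) (metis add.commute diff_add_cancel)
qed

end

theorem mainTheorem1:
  fixes s :: "'f::field \<Rightarrow> 'l::ab_group_add \<Rightarrow> 'l"
    and br :: "'l \<Rightarrow> 'l \<Rightarrow> 'l"
    and x y e1 e2 e3 :: 'l
    and K H :: "'l set"
    and UH :: "('l, 'f) falg set ring" (structure)
    and \<iota> :: "'l \<Rightarrow> ('l, 'f) falg set"
    and u v :: "('l, 'f) falg set"
    and \<Lambda> :: "nat \<Rightarrow> 'l \<Rightarrow> 'f"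
  assumes char: "CHAR('f) = 3"
    and lie: "lie_algebra s br"
    and basis: "distinct [x, y, e1, e2, e3]"
      "\<not> module.dependent s {x, y, e1, e2, e3}"
      "module.span s {x, y, e1, e2, e3} = UNIV"
    and br_x: "br x e1 = 0" "br x e2 = e2" "br x e3 = s 2 e3"
    and br_y: "br y e1 = e3" "br y e2 = e1" "br y e3 = e2"
    and br_xy: "br x y = s 2 y"
    and br_e: "br e1 e2 = 0" "br e1 e3 = 0" "br e2 e3 = 0"
    and K_def: "K = module.span s {e1, e2, e3}"
    and H_def: "H = {s a y + k | a k. k \<in> K}"
    and UH_def: "UH = uea s br H"
    and \<iota>_def: "\<iota> = uea_emb s br H"
    and u_def: "u = \<iota> e1 \<oplus> \<iota> e2 \<oplus> \<iota> e3"
    and v_def: "v = (\<iota> e2 [^] (2::nat)) \<oplus> (\<iota> e1 \<otimes> \<iota> e3)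
      \<oplus> uea_scale s br H 2 (\<iota> e2 \<otimes> \<iota> e3) \<oplus> uea_scale s br H 2 (\<iota> e3 [^] (2::nat))"
    and \<Lambda>_linear: "\<And>c. c \<in> {1, 2} \<Longrightarrow> linear_form_on s H (\<Lambda> c)"
    and \<Lambda>_y: "\<And>c. c \<in> {1, 2} \<Longrightarrow> \<Lambda> c y = of_nat c"
    and \<Lambda>_K: "\<And>c k. c \<in> {1, 2} \<Longrightarrow> k \<in> K \<Longrightarrow> \<Lambda> c k = 0"
  shows "(lie_ideal s br K \<and> lie_ideal s br H
      \<and> vector_space.dim s (UNIV :: 'l set) = vector_space.dim s H + 1
      \<and> (UNIV :: 'l set) = {s a x + h | a h. h \<in> H})
    \<and> ring_center UH = uea_adjoin s br H
      {(\<iota> y [^] (9::nat)) \<ominus> (\<iota> y [^] (3::nat)),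
       \<iota> e1 [^] (3::nat), \<iota> e2 [^] (3::nat), \<iota> e3 [^] (3::nat),
       (\<iota> e1 \<otimes> (\<iota> e2 [^] (2::nat))) \<oplus> ((\<iota> e1 [^] (2::nat)) \<otimes> \<iota> e3)
         \<oplus> (\<iota> e2 \<otimes> (\<iota> e3 [^] (2::nat)))}
    \<and> (u \<in> weight_space s br H (\<Lambda> 1) \<and> v \<in> weight_space s br H (\<Lambda> 2)
      \<and> semi_center s br H = uea_adjoin s br H (ring_center UH \<union> {u, v}))
    \<and> (\<not> semi_invariant s br UNIV (uea_incl s br UNIV u)
      \<and> (\<forall>c\<in>{1, 2}. \<not> ad_stable s br UNIV (uea_incl s br UNIV ` weight_space s br H (\<Lambda> c))))"
proof -
  have "of_nat CHAR('f) = (0::'f)" by (rule of_nat_CHAR)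
  then have "(3::'f) = 0" using char by simp
  then interpret L: lie_ext s br x y e1 e2 e3
    by (intro lie_ext.intro lie lie_ext_axioms.intro basis br_x br_y br_xy br_e)
  have K: "K = L.K" by (simp add: K_def L.K_def)
  have H: "H = L.H" unfolding H_def K L.H_decomp ..
  have UH: "UH = uea s br L.H" by (simp add: UH_def H)
  have \<iota>: "\<iota> = uea_emb s br L.H" by (simp add: \<iota>_def H)
  have u: "u = L.u" by (simp add: u_def L.u_def UH \<iota>)
  have v: "v = L.v" by (simp add: v_def L.v_def UH \<iota> H)
  have lin: "linear_form_on s L.H (\<Lambda> 1)" "linear_form_on s L.H (\<Lambda> 2)"
    using \<Lambda>_linear[of 1] \<Lambda>_linear[of 2] by (simp_all add: H)
  have val: "\<Lambda> 1 y = 1" "\<Lambda> 2 y = 2"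
    using \<Lambda>_y[of 1] \<Lambda>_y[of 2] by simp_all
  have van: "\<Lambda> 1 k = 0" "\<Lambda> 2 k = 0" if "k \<in> L.K" for k
    using \<Lambda>_K[of 1 k] \<Lambda>_K[of 2 k] that by (simp_all add: K)
  have center: "ring_center UH = uea_adjoin s br H
      {(\<iota> y [^] (9::nat)) \<ominus> (\<iota> y [^] (3::nat)),
       \<iota> e1 [^] (3::nat), \<iota> e2 [^] (3::nat), \<iota> e3 [^] (3::nat),
       (\<iota> e1 \<otimes> (\<iota> e2 [^] (2::nat))) \<oplus> ((\<iota> e1 [^] (2::nat)) \<otimes> \<iota> e3)
         \<oplus> (\<iota> e2 \<otimes> (\<iota> e3 [^] (2::nat)))}"
    using L.center_eq unfolding L.center_gens_def UH \<iota> H .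
  have wu: "u \<in> weight_space s br H (\<Lambda> 1)" and wv: "v \<in> weight_space s br H (\<Lambda> 2)"
    unfolding u v H
    using L.weight_space_V[OF L.uv_closed(1) lin(1) val(1) van(1)] L.Phi_u_V
      L.weight_space_V[OF L.uv_closed(2) lin(2) val(2) van(2)] L.Phi_v_V by simp_all
  have semi: "semi_center s br H = uea_adjoin s br H (ring_center UH \<union> {u, v})"
    unfolding u v H UH
    using L.semi_center_subset L.semi_center_superset[OF lin(1) val(1) van(1) lin(2) val(2) van(2)] by blast
  have two: "kS 2 = (2 :: 'f sym)" using kS_add[of 1 "1::'f"] by simp
  \<comment> \<open>The stability argument applies to u and v with \<open>t\<close> equal to a and
    q; these are nonzero and have the nonzero eigenvalues 1 and 2.\<close>
  have nz: "va \<noteq> (0 :: 'f sym)" "vq \<noteq> (0 :: 'f sym)"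
    by (simp_all add: va_def vq_def vb_def vc_def power2_eq_square)
  have "\<not> ad_stable s br UNIV (uea_incl s br UNIV ` weight_space s br H (\<Lambda> 1))"
    using L.not_ad_stable[OF wu[unfolded u H] L.Phi_u] val(1) nz unfolding H by simp
  moreover have "\<not> ad_stable s br UNIV (uea_incl s br UNIV ` weight_space s br H (\<Lambda> 2))"
    using L.not_ad_stable[OF wv[unfolded v H] L.Phi_v] val(2) nz L.two_ne_0 unfolding H
    by (simp add: two Dy_eq[of vq] Dnil_vq[OF L.char3])
  ultimately show ?thesis
    using L.lie_ideal_K L.lie_ideal_H L.dim_H L.L_decomp L.u_not_semi_invariant center wu wv semi
    unfolding K H u by simp
qed

end
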